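(* Consider the action of $SU(3)$ on the Wolf space $\mathbb{HP}(2)=Sp(3)/(Sp(2)\times Sp(1))$ induced by the embedding $SU(3)\subset Sp(3)$ described in the context. With this action, $\mathbb{HP}(2)$ is a cohomogeneity one manifold obtained by gluing together (equivariantly, along their boundaries) disc bundles over the singular orbits $\mathbb{CP}(2)=SU(3)/U(2)$ and $S^5=SU(3)/SU(2)$. Each principal orbit is a copy of the exceptional Aloff–Wallach space $N^{1,-1}\cong N^{1,0}$.
   Context: The embedding $SU(3)\subset Sp(3)$ is $X\mapsto \begin{pmatrix}X&0\\0&(X^{-1})^T\end{pmatrix}$, where $Sp(3)$ is the compact real form of $Sp(3,\mathbb C)\subset GL(6,\mathbb C)$; $SU(3)$ acts on $\mathbb{HP}(2)$ by restricting the transitive action of $Sp(3)$. An action of a compact Lie group is of cohomogeneity one if its principal orbits have codimension one. For integers $k,l$ not both zero, the Aloff–Wallach space is $N^{k,l}=SU(3)/U(1)_{k,l}$, where $U(1)_{k,l}=\{\mathrm{diag}(e^{ik\theta},e^{il\theta},e^{-i(k+l)\theta})\}$. *)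

theory Defs
  imports
    "HOL-Analysis.Analysis"
    "HOL-Algebra.Group_Action"
    "HOL-Algebra.Left_Coset"
begin

section \<open>Smooth spaces\<close>

text \<open>
  Smooth manifolds (possibly with boundary) are represented by their structure sheaf: a
  topological space together with, for every open set, the real functions that are smooth on
  it. Functions are total, so only their values on the open set are relevant.
\<close>

primrec times_cont_diff_on :: "nat \<Rightarrow> 'e::euclidean_space set \<Rightarrow> ('e \<Rightarrow> real) \<Rightarrow> bool" where
  "times_cont_diff_on 0 W f \<longleftrightarrow> continuous_on W f"
| "times_cont_diff_on (Suc n) W f \<longleftrightarrow>
     (\<forall>x\<in>W. f differentiable (at x)) \<and>
     (\<forall>b\<in>Basis. times_cont_diff_on n W (\<lambda>x. frechet_derivative f (at x) b))"

definition smooth_on :: "'e::euclidean_space set \<Rightarrow> ('e \<Rightarrow> real) \<Rightarrow> bool" where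
  "smooth_on W f \<longleftrightarrow> (\<forall>n. times_cont_diff_on n W f)"

record 'a smooth_space =
  smooth_topology :: "'a topology"
  smooth_functions :: "'a set \<Rightarrow> ('a \<Rightarrow> real) set"

abbreviation points :: "'a smooth_space \<Rightarrow> 'a set" where
  "points M \<equiv> topspace (smooth_topology M)"

text \<open>
  A subset of a Euclidean space: a function is smooth if near every point it extends to a smooth
  function on an open set of the ambient space. For submanifolds, with or without boundary, and
  for products of these, this is the usual smooth structure.
\<close>

definition euclidean_subset :: "'e::euclidean_space set \<Rightarrow> 'e smooth_space" where
  "euclidean_subset X = \<lparr>
     smooth_topology = top_of_set X,
     smooth_functions = (\<lambda>U. {f. \<forall>x\<in>U. \<exists>W F. open W \<and> x \<in> W \<and> smooth_on W F \<and>
                                  (\<forall>y\<in>W \<inter> U. F y = f y)})\<rparr>"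

definition smooth_restrict :: "'a smooth_space \<Rightarrow> 'a set \<Rightarrow> 'a smooth_space" where
  "smooth_restrict M A = \<lparr>
     smooth_topology = subtopology (smooth_topology M) A,
     smooth_functions = (\<lambda>U. {f. \<forall>p\<in>U. \<exists>V F. openin (smooth_topology M) V \<and> p \<in> V \<and>
                                  F \<in> smooth_functions M V \<and> (\<forall>q\<in>V \<inter> U. F q = f q)})\<rparr>"

definition quotient_topology :: "'a topology \<Rightarrow> ('a \<Rightarrow> 'b) \<Rightarrow> 'b topology" where
  "quotient_topology T \<pi> =
     topology (\<lambda>V. V \<subseteq> \<pi> ` topspace T \<and> openin T {x \<in> topspace T. \<pi> x \<in> V})"

lemma openin_quotient_topology:
  "openin (quotient_topology T \<pi>) V \<longleftrightarrow>
     V \<subseteq> \<pi> ` topspace T \<and> openin T {x \<in> topspace T. \<pi> x \<in> V}"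
proof -
  have "istopology (\<lambda>V. V \<subseteq> \<pi> ` topspace T \<and> openin T {x \<in> topspace T. \<pi> x \<in> V})"
    unfolding istopology_def
  proof (rule conjI; clarify)
    fix S S'
    assume o: "openin T {x \<in> topspace T. \<pi> x \<in> S}" "openin T {x \<in> topspace T. \<pi> x \<in> S'}"
      and s: "S \<subseteq> \<pi> ` topspace T"
    have "{x \<in> topspace T. \<pi> x \<in> S \<inter> S'} =
          {x \<in> topspace T. \<pi> x \<in> S} \<inter> {x \<in> topspace T. \<pi> x \<in> S'}" by auto
    with o s show "S \<inter> S' \<subseteq> \<pi> ` topspace T \<and> openin T {x \<in> topspace T. \<pi> x \<in> S \<inter> S'}"
      by auto
  next
    fix K
    assume a: "\<forall>S\<in>K. S \<subseteq> \<pi> ` topspace T \<and> openin T {x \<in> topspace T. \<pi> x \<in> S}"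
    have "{x \<in> topspace T. \<pi> x \<in> \<Union>K} = (\<Union>S\<in>K. {x \<in> topspace T. \<pi> x \<in> S})" by auto
    with a show "\<Union>K \<subseteq> \<pi> ` topspace T \<and> openin T {x \<in> topspace T. \<pi> x \<in> \<Union>K}"
      by auto
  qed
  then show ?thesis
    by (simp add: quotient_topology_def topology_inverse')
qed

lemma topspace_quotient_topology [simp]:
  "topspace (quotient_topology T \<pi>) = \<pi> ` topspace T"
proof
  show "topspace (quotient_topology T \<pi>) \<subseteq> \<pi> ` topspace T"
    by (metis openin_quotient_topology openin_topspace)
  have "{x \<in> topspace T. \<pi> x \<in> \<pi> ` topspace T} = topspace T" by auto
  then have "openin (quotient_topology T \<pi>) (\<pi> ` topspace T)"
    by (simp add: openin_quotient_topology)
  then show "\<pi> ` topspace T \<subseteq> topspace (quotient_topology T \<pi>)"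
    by (rule openin_subset)
qed

text \<open>
  For the quotient by a free action of a compact Lie group this is the unique smooth structure
  for which the projection is a smooth submersion.
\<close>

definition smooth_quotient :: "'a smooth_space \<Rightarrow> ('a \<Rightarrow> 'b) \<Rightarrow> 'b smooth_space" where
  "smooth_quotient M \<pi> = \<lparr>
     smooth_topology = quotient_topology (smooth_topology M) \<pi>,
     smooth_functions = (\<lambda>V. {f. f \<circ> \<pi> \<in> smooth_functions M {x \<in> points M. \<pi> x \<in> V}})\<rparr>"

definition diffeomorphism :: "'a smooth_space \<Rightarrow> 'b smooth_space \<Rightarrow> ('a \<Rightarrow> 'b) \<Rightarrow> bool" where
  "diffeomorphism M N \<phi> \<longleftrightarrow>
     homeomorphic_map (smooth_topology M) (smooth_topology N) \<phi> \<and>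
     (\<forall>V f. openin (smooth_topology N) V \<longrightarrow>
        (f \<in> smooth_functions N V \<longleftrightarrow> f \<circ> \<phi> \<in> smooth_functions M {x \<in> points M. \<phi> x \<in> V}))"

text \<open>A manifold (without boundary) of dimension \<open>DIM('e)\<close>.\<close>

definition smooth_manifold :: "'e::euclidean_space itself \<Rightarrow> 'a smooth_space \<Rightarrow> bool" where
  "smooth_manifold _ M \<longleftrightarrow>
     Hausdorff_space (smooth_topology M) \<and> second_countable (smooth_topology M) \<and>
     (\<forall>p\<in>points M. \<exists>U (V::'e set) \<phi>. openin (smooth_topology M) U \<and> p \<in> U \<and> open V \<and>
        diffeomorphism (smooth_restrict M U) (euclidean_subset V) \<phi>)"

section \<open>Actions\<close>

definition equivariant_diffeomorphism ::
  "('g, 'm) monoid_scheme \<Rightarrow> 'a smooth_space \<Rightarrow> ('g \<Rightarrow> 'a \<Rightarrow> 'a) \<Rightarrow>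
     'b smooth_space \<Rightarrow> ('g \<Rightarrow> 'b \<Rightarrow> 'b) \<Rightarrow> ('a \<Rightarrow> 'b) \<Rightarrow> bool" where
  "equivariant_diffeomorphism G M a N b \<phi> \<longleftrightarrow>
     diffeomorphism M N \<phi> \<and> (\<forall>g\<in>carrier G. \<forall>x\<in>points M. \<phi> (a g x) = b g (\<phi> x))"

definition equivariantly_diffeomorphic ::
  "('g, 'm) monoid_scheme \<Rightarrow> 'a smooth_space \<Rightarrow> ('g \<Rightarrow> 'a \<Rightarrow> 'a) \<Rightarrow>
     'b smooth_space \<Rightarrow> ('g \<Rightarrow> 'b \<Rightarrow> 'b) \<Rightarrow> bool" where
  "equivariantly_diffeomorphic G M a N b \<longleftrightarrow> (\<exists>\<phi>. equivariant_diffeomorphism G M a N b \<phi>)"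

text \<open>
  Orbits of maximal type: \<open>P\<close> is principal if the isotropy group at a point of \<open>P\<close> is conjugate
  to a subgroup of every isotropy group. The conjugates of an isotropy group are the isotropy
  groups at the other points of the orbit.
\<close>

definition principal_orbits ::
  "('g, 'm) monoid_scheme \<Rightarrow> 'a set \<Rightarrow> ('g \<Rightarrow> 'a \<Rightarrow> 'a) \<Rightarrow> 'a set set" where
  "principal_orbits G E a =
     {P \<in> orbits G E a. \<forall>y\<in>E. \<exists>x\<in>P. stabilizer G a x \<subseteq> stabilizer G a y}"

text \<open>
  The principal orbits have dimension \<open>DIM('p)\<close>, and the manifold has dimension
  \<open>DIM('p \<times> real) = DIM('p) + 1\<close>.
\<close>

definition cohomogeneity_one ::
  "'p::euclidean_space itself \<Rightarrow> ('g, 'm) monoid_scheme \<Rightarrow> 'a smooth_space \<Rightarrow>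
     ('g \<Rightarrow> 'a \<Rightarrow> 'a) \<Rightarrow> bool" where
  "cohomogeneity_one _ G M a \<longleftrightarrow>
     group_action G (points M) a \<and>
     smooth_manifold TYPE('p \<times> real) M \<and>
     principal_orbits G (points M) a \<noteq> {} \<and>
     (\<forall>P\<in>principal_orbits G (points M) a. smooth_manifold TYPE('p) (smooth_restrict M P))"

text \<open>A singular orbit has dimension \<open>DIM('s)\<close> smaller than the dimension \<open>DIM('p)\<close> of the
  principal orbits.\<close>

definition singular_orbit ::
  "'s::euclidean_space itself \<Rightarrow> 'p::euclidean_space itself \<Rightarrow> ('g, 'm) monoid_scheme \<Rightarrow>
     'a smooth_space \<Rightarrow> ('g \<Rightarrow> 'a \<Rightarrow> 'a) \<Rightarrow> 'a set \<Rightarrow> bool" where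
  "singular_orbit _ _ G M a S \<longleftrightarrow>
     S \<in> orbits G (points M) a \<and>
     smooth_manifold TYPE('s) (smooth_restrict M S) \<and>
     (\<forall>P\<in>principal_orbits G (points M) a. smooth_manifold TYPE('p) (smooth_restrict M P)) \<and>
     DIM('s) < DIM('p)"

section \<open>Homogeneous spaces and homogeneous disc bundles\<close>

text \<open>Left cosets of \<open>H\<close> in a group \<open>G\<close> of matrices, or of other elements of a Euclidean space.\<close>

definition homogeneous_space ::
  "('e::euclidean_space, 'm) monoid_scheme \<Rightarrow> 'e set \<Rightarrow> 'e set smooth_space" where
  "homogeneous_space G H = smooth_quotient (euclidean_subset (carrier G)) (\<lambda>g. g <#\<^bsub>G\<^esub> H)"

definition coset_action :: "('e, 'm) monoid_scheme \<Rightarrow> 'e \<Rightarrow> 'e set \<Rightarrow> 'e set" where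
  "coset_action G g C = g <#\<^bsub>G\<^esub> C"

definition orthogonal_representation ::
  "('e::euclidean_space, 'm) monoid_scheme \<Rightarrow> 'e set \<Rightarrow> ('e \<Rightarrow> 'v::euclidean_space \<Rightarrow> 'v) \<Rightarrow> bool"
where
  "orthogonal_representation G K \<rho> \<longleftrightarrow>
     (\<forall>k\<in>K. orthogonal_transformation (\<rho> k)) \<and>
     (\<forall>k\<in>K. \<forall>l\<in>K. \<rho> (k \<otimes>\<^bsub>G\<^esub> l) = \<rho> k \<circ> \<rho> l) \<and>
     (\<forall>v. continuous_on K (\<lambda>k. \<rho> k v))"

text \<open>
  The class of \<open>(g, v)\<close> in \<open>G \<times>\<^sub>K V\<close>. The disc bundle \<open>G \<times>\<^sub>K D(V)\<close> is the closed unit disc bundle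
  of the homogeneous vector bundle \<open>G \<times>\<^sub>K V \<rightarrow> G/K\<close>; every \<open>G\<close>-equivariant Euclidean
  vector bundle over \<open>G/K\<close> has this form.
\<close>

definition bundle_class ::
  "('e, 'm) monoid_scheme \<Rightarrow> 'e set \<Rightarrow> ('e \<Rightarrow> 'v \<Rightarrow> 'v) \<Rightarrow> 'e \<times> 'v \<Rightarrow> ('e \<times> 'v) set" where
  "bundle_class G K \<rho> = (\<lambda>(g, v). {(g \<otimes>\<^bsub>G\<^esub> k, \<rho> (inv\<^bsub>G\<^esub> k) v) | k. k \<in> K})"

definition disc_bundle ::
  "('e::euclidean_space, 'm) monoid_scheme \<Rightarrow> 'e set \<Rightarrow> ('e \<Rightarrow> 'v::euclidean_space \<Rightarrow> 'v) \<Rightarrow>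
     ('e \<times> 'v) set smooth_space" where
  "disc_bundle G K \<rho> =
     smooth_quotient (euclidean_subset (carrier G \<times> cball 0 1)) (bundle_class G K \<rho>)"

definition bundle_boundary ::
  "('e, 'm) monoid_scheme \<Rightarrow> 'e set \<Rightarrow> ('e \<Rightarrow> 'v::euclidean_space \<Rightarrow> 'v) \<Rightarrow> ('e \<times> 'v) set set" where
  "bundle_boundary G K \<rho> = bundle_class G K \<rho> ` (carrier G \<times> sphere 0 1)"

definition zero_section ::
  "('e, 'm) monoid_scheme \<Rightarrow> 'e set \<Rightarrow> ('e \<Rightarrow> 'v::euclidean_space \<Rightarrow> 'v) \<Rightarrow> ('e \<times> 'v) set set" where
  "zero_section G K \<rho> = bundle_class G K \<rho> ` (carrier G \<times> {0})"

definition bundle_action ::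
  "('e, 'm) monoid_scheme \<Rightarrow> 'e \<Rightarrow> ('e \<times> 'v) set \<Rightarrow> ('e \<times> 'v) set" where
  "bundle_action G g C = (\<lambda>(h, v). (g \<otimes>\<^bsub>G\<^esub> h, v)) ` C"

text \<open>
  \<open>M\<close> is obtained by gluing \<open>X\<close> and \<open>Y\<close> along an equivariant diffeomorphism \<open>\<phi>\<close> of the boundary \<open>A\<close>
  of \<open>X\<close> onto the boundary \<open>B\<close> of \<open>Y\<close>: the maps \<open>i\<close> and \<open>j\<close> are equivariant smooth embeddings,
  they cover \<open>M\<close>, and the only identification between \<open>X\<close> and \<open>Y\<close> is that of \<open>x \<in> A\<close> with \<open>\<phi> x\<close>.
\<close>

definition equivariant_gluing ::
  "('g, 'm) monoid_scheme \<Rightarrow> 'a smooth_space \<Rightarrow> ('g \<Rightarrow> 'a \<Rightarrow> 'a) \<Rightarrow>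
     'x smooth_space \<Rightarrow> 'x set \<Rightarrow> ('g \<Rightarrow> 'x \<Rightarrow> 'x) \<Rightarrow> ('x \<Rightarrow> 'a) \<Rightarrow>
     'y smooth_space \<Rightarrow> 'y set \<Rightarrow> ('g \<Rightarrow> 'y \<Rightarrow> 'y) \<Rightarrow> ('y \<Rightarrow> 'a) \<Rightarrow> ('x \<Rightarrow> 'y) \<Rightarrow> bool" where
  "equivariant_gluing G M a X A b i Y B c j \<phi> \<longleftrightarrow>
     equivariant_diffeomorphism G (smooth_restrict X A) b (smooth_restrict Y B) c \<phi> \<and>
     equivariant_diffeomorphism G X b (smooth_restrict M (i ` points X)) a i \<and>
     equivariant_diffeomorphism G Y c (smooth_restrict M (j ` points Y)) a j \<and>
     points M = i ` points X \<union> j ` points Y \<and>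
     (\<forall>x\<in>points X. \<forall>y\<in>points Y. i x = j y \<longleftrightarrow> x \<in> A \<and> y = \<phi> x)"

section \<open>The groups\<close>

definition matrix_group :: "(complex^'n^'n) set \<Rightarrow> (complex^'n^'n) monoid" where
  "matrix_group S = \<lparr>carrier = S, mult = (**), one = mat 1\<rparr>"

definition unitary :: "complex^'n^'n \<Rightarrow> bool" where
  "unitary A \<longleftrightarrow> (\<chi> i j. cnj (A $ j $ i)) ** A = mat 1"

definition SU3 :: "(complex^3^3) monoid" where
  "SU3 = matrix_group {A. unitary A \<and> det A = 1}"

text \<open>The index type \<open>'n + 'n\<close> describes the four blocks of a matrix in \<open>GL(2n, \<complex>)\<close>.\<close>

definition block_diag :: "complex^'n::finite^'n \<Rightarrow> complex^'n^'n \<Rightarrow> complex^('n + 'n)^('n + 'n)" where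
  "block_diag A B = (\<chi> i j. case (i, j) of
     (Inl k, Inl l) \<Rightarrow> A $ k $ l | (Inr k, Inr l) \<Rightarrow> B $ k $ l | _ \<Rightarrow> 0)"

definition symplectic_form :: "complex^('n::finite + 'n)^('n + 'n)" where
  "symplectic_form = (\<chi> i j. case (i, j) of
     (Inl k, Inr l) \<Rightarrow> (if k = l then 1 else 0) | (Inr k, Inl l) \<Rightarrow> (if k = l then -1 else 0) | _ \<Rightarrow> 0)"

text \<open>The compact real form of \<open>Sp(3, \<complex>) \<subset> GL(6, \<complex>)\<close>.\<close>

definition Sp3 :: "(complex^(3 + 3)^(3 + 3)) monoid" where
  "Sp3 = matrix_group {A. transpose A ** symplectic_form ** A = symplectic_form \<and> unitary A}"

text \<open>
  The quaternionic coordinates of \<open>\<complex>\<^sup>6 = \<bbbH>\<^sup>3\<close> consist of the complex coordinates with indices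
  \<open>Inl k\<close> and \<open>Inr k\<close>. The subgroup \<open>Sp(2) \<times> Sp(1)\<close> is that of the matrices which are block
  diagonal for \<open>\<bbbH>\<^sup>3 = \<bbbH>\<^sup>2 \<oplus> \<bbbH>\<close>, where \<open>\<bbbH>\<close> is the third coordinate.
\<close>

definition quaternionic_index :: "'n + 'n \<Rightarrow> 'n" where
  "quaternionic_index i = (case i of Inl k \<Rightarrow> k | Inr k \<Rightarrow> k)"

definition Sp2_Sp1 :: "(complex^(3 + 3)^(3 + 3)) set" where
  "Sp2_Sp1 = {A \<in> carrier Sp3.
     \<forall>i j. (quaternionic_index i = 3) \<noteq> (quaternionic_index j = 3) \<longrightarrow> A $ i $ j = 0}"

definition SU3_to_Sp3 :: "complex^3^3 \<Rightarrow> complex^(3 + 3)^(3 + 3)" where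
  "SU3_to_Sp3 X = block_diag X (transpose (matrix_inv X))"

definition HP2 :: "(complex^(3 + 3)^(3 + 3)) set smooth_space" where
  "HP2 = homogeneous_space Sp3 Sp2_Sp1"

definition HP2_action ::
  "complex^3^3 \<Rightarrow> (complex^(3 + 3)^(3 + 3)) set \<Rightarrow> (complex^(3 + 3)^(3 + 3)) set" where
  "HP2_action X = (\<lambda>C\<in>points HP2. coset_action Sp3 (SU3_to_Sp3 X) C)"

text \<open>\<open>U(2)\<close> is embedded in \<open>SU(3)\<close> by \<open>A \<mapsto> diag(A, det(A)\<^sup>-\<^sup>1)\<close>.\<close>

definition U2_to_SU3 :: "complex^2^2 \<Rightarrow> complex^3^3" where
  "U2_to_SU3 A = vector [vector [A$1$1, A$1$2, 0],
                         vector [A$2$1, A$2$2, 0],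
                         vector [0, 0, inverse (det A)]]"

definition U2 :: "(complex^3^3) set" where
  "U2 = U2_to_SU3 ` {A. unitary A}"

definition SU2 :: "(complex^3^3) set" where
  "SU2 = U2_to_SU3 ` {A. unitary A \<and> det A = 1}"

definition U1 :: "int \<Rightarrow> int \<Rightarrow> (complex^3^3) set" where
  "U1 k l = {vector [vector [cis (of_int k * \<theta>), 0, 0],
                     vector [0, cis (of_int l * \<theta>), 0],
                     vector [0, 0, cis (- of_int (k + l) * \<theta>)]] | \<theta>. True}"

definition Aloff_Wallach :: "int \<Rightarrow> int \<Rightarrow> (complex^3^3) set smooth_space" where
  "Aloff_Wallach k l = homogeneous_space SU3 (U1 k l)"

definition S5 :: "(complex^3) smooth_space" where
  "S5 = euclidean_subset (sphere 0 1)"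

definition S5_action :: "complex^3^3 \<Rightarrow> complex^3 \<Rightarrow> complex^3" where
  "S5_action X z = X *v z"

text \<open>The complex lines in \<open>\<complex>\<^sup>3\<close>.\<close>

definition CP2 :: "(complex^3) set smooth_space" where
  "CP2 = smooth_quotient S5 (\<lambda>z. {c *s z | c. True})"

definition CP2_action :: "complex^3^3 \<Rightarrow> (complex^3) set \<Rightarrow> (complex^3) set" where
  "CP2_action X L = (\<lambda>z. X *v z) ` L"

end

(* A unit vector (z, cnj u) of a quaternionic line is unique up to SU(2), and the invariants
   P = z z* + u u* and w = cnj (z x u) of the pair (z, u) determine the line. This turns HP(2) into a
   subset of a Euclidean space on which SU(3) acts by (g P g*, g w). The rank one or two matrix P has
   trace 1 and |w|^2 is the product of its nonzero eigenvalues, so that 0 <= |w| <= 1/2, and the orbits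
   are the level sets of |w|. For w = 0 the point is a complex line (CP(2)); for |w| = 1/2 both
   eigenvalues are 1/2 and w determines P (S^5); in between, g e_3 and g e_1 are determined up to
   opposite phases, which gives N^{1,0}. The slice at w = 0, z = e_3 consists of the vectors u in
   C^2 orthogonal to e_3; the slice at |w| = 1/2 consists of the traceless Hermitian 2x2 matrices
   P - 1/2 on the orthogonal complement of w. Both discs are cut off along |w| = 2/5. Spaces are
   identified with their Euclidean models by means of a smooth equivariant surjection that has local
   smooth sections. *)

theory Submission
  imports Defs
begin

section \<open>Smooth maps between Euclidean spaces\<close>

text \<open>Functions on a quotient are only accessible through their lifts, so every diffeomorphism
  rests on local smooth sections, each given by an explicit formula. Three formulas suffice: a
  reflection that carries one quaternionic line to a nearby one; the spectral projection of P as a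
  polynomial in P with coefficients depending on |w|; and the completion of two vectors to a special
  unitary frame by the conjugate cross product. The second breaks down where the nonzero eigenvalues
  meet, at |w| = 1/2, so the bundle over S^5 takes its sections from w instead of the eigenline. The
  value 2/5 comes from the triple (3, 4, 5): sqrt (1 - 4 (2/5)^2) = 3/5, so the eigenvalues on the
  common boundary are 4/5 and 1/5, and the two slices are cut off at the radii 1/sqrt 5 and 3/5.
  N^{1,-1} and N^{1,0} come from two base points of one orbit that differ by a cyclic permutation
  matrix, so that their circles are conjugate.\<close>

lemma times_cont_diff_on_cong:
  assumes "open W" "\<And>x. x \<in> W \<Longrightarrow> f x = g x" "times_cont_diff_on n W f"
  shows "times_cont_diff_on n W g"
  using assms
proof (induction n arbitrary: f g)
  case 0
  then show ?case by (metis (no_types, lifting) continuous_on_cong times_cont_diff_on.simps(1))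
next
  case (Suc n)
  have d: "(g has_derivative frechet_derivative f (at x)) (at x)" if "x \<in> W" for x
  proof -
    have "(f has_derivative frechet_derivative f (at x)) (at x)"
      using Suc.prems that by (simp add: frechet_derivative_works)
    then show ?thesis
      by (rule has_derivative_transform_within_open [OF _ Suc.prems(1) that]) (use Suc.prems in auto)
  qed
  then have e: "frechet_derivative g (at x) = frechet_derivative f (at x)" if "x \<in> W" for x
    using frechet_derivative_at that by metis
  show ?case
    unfolding times_cont_diff_on.simps
  proof (intro conjI ballI)
    fix x assume "x \<in> W"
    then show "g differentiable at x" using d differentiable_def by blast
  next
    fix b :: 'a assume "b \<in> Basis"
    then show "times_cont_diff_on n W (\<lambda>x. frechet_derivative g (at x) b)"
      using Suc.prems by (auto simp: e intro: Suc.IH [of "\<lambda>x. frechet_derivative f (at x) b"])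
  qed
qed

text \<open>The inductions below work with explicit derivatives, while the recursive definition
  speaks of \<open>frechet_derivative\<close>; uniqueness of the derivative and congruence on the
  open set \<open>W\<close> bridge the two.\<close>

lemma times_cont_diff_on_SucI:
  assumes "open W" "\<And>x. x \<in> W \<Longrightarrow> (f has_derivative D x) (at x)"
    and "\<And>b. b \<in> Basis \<Longrightarrow> times_cont_diff_on n W (\<lambda>x. D x b)"
  shows "times_cont_diff_on (Suc n) W f"
  unfolding times_cont_diff_on.simps
proof (intro conjI ballI)
  fix x assume "x \<in> W"
  then show "f differentiable at x" using assms differentiable_def by blast
next
  fix b :: 'a assume "b \<in> Basis"
  show "times_cont_diff_on n W (\<lambda>x. frechet_derivative f (at x) b)"
  proof (rule times_cont_diff_on_cong [OF assms(1) _ assms(3) [OF \<open>b \<in> Basis\<close>]])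
    show "D x b = frechet_derivative f (at x) b" if "x \<in> W" for x
      using frechet_derivative_at [OF assms(2) [OF that]] by simp
  qed
qed

lemma times_cont_diff_on_has_derivative:
  "times_cont_diff_on (Suc n) W f \<Longrightarrow> x \<in> W \<Longrightarrow> (f has_derivative frechet_derivative f (at x)) (at x)"
  by (simp add: frechet_derivative_works)

lemma times_cont_diff_on_mono: "times_cont_diff_on (Suc n) W f \<Longrightarrow> times_cont_diff_on n W f"
proof (induction n arbitrary: f)
  case 0
  then show ?case
    by (auto intro!: differentiable_imp_continuous_on differentiable_at_imp_differentiable_on)
next
  case (Suc n)
  then show ?case by (metis times_cont_diff_on.simps(2))
qed

lemma times_cont_diff_on_subset:
  "times_cont_diff_on n V f \<Longrightarrow> W \<subseteq> V \<Longrightarrow> times_cont_diff_on n W f"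
proof (induction n arbitrary: f)
  case 0 then show ?case by (auto intro: continuous_on_subset)
next
  case (Suc n) then show ?case by fastforce
qed

lemma times_cont_diff_on_const: "times_cont_diff_on n W (\<lambda>x. c)"
  by (induction n arbitrary: c) auto

lemma times_cont_diff_on_linear:
  assumes "open W" "bounded_linear L"
  shows "times_cont_diff_on n W L"
proof (cases n)
  case 0
  then show ?thesis using assms by (simp add: linear_continuous_on)
next
  case (Suc m)
  show ?thesis
    unfolding Suc
    by (rule times_cont_diff_on_SucI [where D = "\<lambda>x. L"])
       (use assms bounded_linear_imp_has_derivative times_cont_diff_on_const in auto)
qed

lemma times_cont_diff_on_add:
  assumes "open W" "times_cont_diff_on n W f" "times_cont_diff_on n W g"
  shows "times_cont_diff_on n W (\<lambda>x. f x + g x)"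
  using assms
proof (induction n arbitrary: f g)
  case 0 then show ?case by (simp add: continuous_on_add)
next
  case (Suc n)
  show ?case
  proof (rule times_cont_diff_on_SucI [OF \<open>open W\<close>])
    fix x assume "x \<in> W"
    with Suc.prems show "((\<lambda>x. f x + g x) has_derivative
        (\<lambda>b. frechet_derivative f (at x) b + frechet_derivative g (at x) b)) (at x)"
      by (intro has_derivative_add times_cont_diff_on_has_derivative)
  qed (use Suc in auto)
qed

lemma times_cont_diff_on_mult:
  assumes "open W" "times_cont_diff_on n W f" "times_cont_diff_on n W g"
  shows "times_cont_diff_on n W (\<lambda>x. f x * g x)"
  using assms
proof (induction n arbitrary: f g)
  case 0 then show ?case by (simp add: continuous_on_mult)
next
  case (Suc n)
  show ?case
  proof (rule times_cont_diff_on_SucI [OF \<open>open W\<close>])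
    fix x assume "x \<in> W"
    with Suc.prems show "((\<lambda>x. f x * g x) has_derivative
        (\<lambda>b. f x * frechet_derivative g (at x) b + frechet_derivative f (at x) b * g x)) (at x)"
      by (intro has_derivative_mult times_cont_diff_on_has_derivative)
  next
    fix b :: 'a assume "b \<in> Basis"
    then have "times_cont_diff_on n W (\<lambda>x. frechet_derivative f (at x) b)"
      "times_cont_diff_on n W (\<lambda>x. frechet_derivative g (at x) b)"
      using Suc.prems by auto
    then show "times_cont_diff_on n W
       (\<lambda>x. f x * frechet_derivative g (at x) b + frechet_derivative f (at x) b * g x)"
      using Suc.prems times_cont_diff_on_mono [of n W]
      by (intro times_cont_diff_on_add [OF assms(1)] Suc.IH [OF assms(1)]) auto
  qed
qed

lemma times_cont_diff_on_sum:
  assumes "open W" "\<And>i. i \<in> I \<Longrightarrow> times_cont_diff_on n W (f i)"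
  shows "times_cont_diff_on n W (\<lambda>x. \<Sum>i\<in>I. f i x)"
proof (cases "finite I")
  case True
  then show ?thesis
    using assms(2) by (induction I rule: finite_induct)
      (auto simp: times_cont_diff_on_const intro!: times_cont_diff_on_add assms(1))
qed (simp add: times_cont_diff_on_const)

text \<open>Chain rule in coordinates: the partial derivative in direction \<open>b\<close> is a sum
  over \<open>c\<close> of a partial derivative of a component of \<open>g\<close> times a partial
  derivative of \<open>f\<close> taken at \<open>g x\<close>. The second factor is again a composite
  with \<open>g\<close>, hence the induction generalizes over \<open>f\<close> only.\<close>

lemma times_cont_diff_on_compose:
  fixes g :: "'e::euclidean_space \<Rightarrow> 'f::euclidean_space"
  assumes "open W" "open V" "times_cont_diff_on n V f"
    and "\<And>b. b \<in> Basis \<Longrightarrow> times_cont_diff_on n W (\<lambda>x. g x \<bullet> b)"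
    and "g ` W \<subseteq> V"
  shows "times_cont_diff_on n W (\<lambda>x. f (g x))"
  using assms
proof (induction n arbitrary: f)
  case 0
  then have "continuous_on W g"
    by (subst continuous_on_componentwise) auto
  with 0 show ?case
    by (auto intro: continuous_on_compose2)
next
  case (Suc n)
  let ?Dg = "\<lambda>x h. \<Sum>c\<in>Basis. frechet_derivative (\<lambda>x. g x \<bullet> c) (at x) h *\<^sub>R c"
  show ?case
  proof (rule times_cont_diff_on_SucI [OF \<open>open W\<close>])
    fix x assume x: "x \<in> W"
    have g: "(g has_derivative ?Dg x) (at x)"
    proof (rule has_derivative_componentwise_within [THEN iffD2], rule ballI)
      fix c :: 'f assume c: "c \<in> Basis"
      have "((\<lambda>x. g x \<bullet> c) has_derivative frechet_derivative (\<lambda>x. g x \<bullet> c) (at x)) (at x)"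
        using Suc.prems(4) [OF c] x by (rule times_cont_diff_on_has_derivative)
      also have "frechet_derivative (\<lambda>x. g x \<bullet> c) (at x) = (\<lambda>h. ?Dg x h \<bullet> c)"
        using c by (auto simp: inner_sum_left_Basis)
      finally show "((\<lambda>x. g x \<bullet> c) has_derivative (\<lambda>h. ?Dg x h \<bullet> c)) (at x)" .
    qed
    have f: "(f has_derivative frechet_derivative f (at (g x))) (at (g x))"
      using Suc.prems(3,5) x by (intro times_cont_diff_on_has_derivative) auto
    have "((\<lambda>x. f (g x)) has_derivative (\<lambda>h. frechet_derivative f (at (g x)) (?Dg x h))) (at x)"
      using has_derivative_compose [OF g f] .
    also have "(\<lambda>h. frechet_derivative f (at (g x)) (?Dg x h)) =
        (\<lambda>h. \<Sum>c\<in>Basis. frechet_derivative (\<lambda>x. g x \<bullet> c) (at x) h * frechet_derivative f (at (g x)) c)"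
      using has_derivative_linear [OF f] by (simp add: linear_sum linear_cmul)
    finally show "((\<lambda>x. f (g x)) has_derivative
       (\<lambda>h. \<Sum>c\<in>Basis. frechet_derivative (\<lambda>x. g x \<bullet> c) (at x) h * frechet_derivative f (at (g x)) c)) (at x)" .
  next
    fix b :: 'e assume b: "b \<in> Basis"
    have m: "\<And>c. c \<in> Basis \<Longrightarrow> times_cont_diff_on n W (\<lambda>x. g x \<bullet> c)"
      using Suc.prems(4) times_cont_diff_on_mono by blast
    show "times_cont_diff_on n W (\<lambda>x. \<Sum>c\<in>Basis. frechet_derivative (\<lambda>x. g x \<bullet> c) (at x) b *
        frechet_derivative f (at (g x)) c)"
    proof (intro times_cont_diff_on_sum times_cont_diff_on_mult assms(1))
      fix c :: 'f assume c: "c \<in> Basis"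
      show "times_cont_diff_on n W (\<lambda>x. frechet_derivative (\<lambda>x. g x \<bullet> c) (at x) b)"
        using Suc.prems(4) [OF c] b by simp
      show "times_cont_diff_on n W (\<lambda>x. frechet_derivative f (at (g x)) c)"
        using Suc.prems c m by (intro Suc.IH [of "\<lambda>y. frechet_derivative f (at y) c"]) auto
    qed
  qed
qed

lemma times_cont_diff_on_real_compose:
  fixes g :: "'e::euclidean_space \<Rightarrow> real"
  assumes "open W" "open V" "times_cont_diff_on n V f" "times_cont_diff_on n W g" "g ` W \<subseteq> V"
  shows "times_cont_diff_on n W (\<lambda>x. f (g x))"
  by (rule times_cont_diff_on_compose) (use assms in auto)

text \<open>The derivative of \<open>inverse\<close> is a polynomial in \<open>inverse\<close>, so
  the induction hypothesis covers it.\<close>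

lemma times_cont_diff_on_inverse: "times_cont_diff_on n (- {0 :: real}) inverse"
proof (induction n)
  case 0
  then show ?case by (auto intro!: continuous_intros)
next
  case (Suc n)
  show ?case
  proof (rule times_cont_diff_on_SucI)
    fix x :: real assume "x \<in> - {0}"
    then show "(inverse has_derivative (\<lambda>h. - (inverse x * h * inverse x))) (at x)"
      by (intro has_derivative_inverse') auto
  next
    fix b :: real assume "b \<in> Basis"
    have "times_cont_diff_on n (- {0}) (\<lambda>x. - 1 * (inverse x * inverse x))"
      by (intro times_cont_diff_on_mult times_cont_diff_on_const Suc) auto
    with \<open>b \<in> Basis\<close> show "times_cont_diff_on n (- {0}) (\<lambda>x. - (inverse x * b * inverse x))"
      by simp
  qed auto
qed

text \<open>The derivative is half of \<open>inverse\<close> composed with \<open>sqrt\<close>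
  itself, so the induction closes.\<close>

lemma times_cont_diff_on_sqrt: "times_cont_diff_on n {0 <..} sqrt"
proof (induction n)
  case 0
  then show ?case by (auto intro!: continuous_intros)
next
  case (Suc n)
  show ?case
  proof (rule times_cont_diff_on_SucI)
    fix x :: real assume "x \<in> {0 <..}"
    then show "(sqrt has_derivative (\<lambda>h. (inverse (sqrt x) / 2) * h)) (at x)"
      by (intro has_derivative_eq_rhs [OF DERIV_real_sqrt [unfolded has_field_derivative_def]]) auto
  next
    fix b :: real assume "b \<in> Basis"
    have "times_cont_diff_on n {0<..} (\<lambda>x::real. inverse (sqrt x) * (1/2))"
      by (intro times_cont_diff_on_mult times_cont_diff_on_const Suc
          times_cont_diff_on_real_compose [OF _ _ times_cont_diff_on_inverse]) auto
    with \<open>b \<in> Basis\<close> show "times_cont_diff_on n {0<..} (\<lambda>x. (inverse (sqrt x) / 2) * b)"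
      by simp
  qed auto
qed

text \<open>Openness of \<open>W\<close> is built in, so that it travels along with smoothness
  through the introduction rules. Components are used because \<open>smooth_on\<close> speaks of
  real-valued functions.\<close>

definition smooth_map :: "'e::euclidean_space set \<Rightarrow> ('e \<Rightarrow> 'f::euclidean_space) \<Rightarrow> bool" where
  "smooth_map W f \<longleftrightarrow> open W \<and> (\<forall>b\<in>Basis. smooth_on W (\<lambda>x. f x \<bullet> b))"

named_theorems smooth_intros

lemma smooth_map_open: "smooth_map W f \<Longrightarrow> open W"
  by (simp add: smooth_map_def)

lemma smooth_map_real: "smooth_map W (f :: _ \<Rightarrow> real) \<longleftrightarrow> open W \<and> smooth_on W f"
  by (simp add: smooth_map_def)

lemma smooth_map_subset: "smooth_map V f \<Longrightarrow> open W \<Longrightarrow> W \<subseteq> V \<Longrightarrow> smooth_map W f"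
  unfolding smooth_map_def smooth_on_def using times_cont_diff_on_subset by blast

lemma smooth_map_imp_continuous_on: "smooth_map W f \<Longrightarrow> continuous_on W f"
  unfolding smooth_map_def smooth_on_def
  by (subst continuous_on_componentwise) (metis times_cont_diff_on.simps(1))

lemma smooth_map_compose:
  assumes "smooth_map V f" "smooth_map W g" "g ` W \<subseteq> V"
  shows "smooth_map W (\<lambda>x. f (g x))"
  unfolding smooth_map_def smooth_on_def
proof (intro conjI ballI allI)
  fix b :: 'b and n assume "b \<in> Basis"
  with assms show "times_cont_diff_on n W (\<lambda>x. f (g x) \<bullet> b)"
    by (rule_tac times_cont_diff_on_compose [where f = "\<lambda>y. f y \<bullet> b" and V = V])
       (auto simp: smooth_map_def smooth_on_def)
qed (use assms smooth_map_open in blast)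

lemma smooth_map_const [smooth_intros]: "open W \<Longrightarrow> smooth_map W (\<lambda>x. c)"
  by (simp add: smooth_map_def smooth_on_def times_cont_diff_on_const)

lemma smooth_map_linear:
  assumes "bounded_linear L" "smooth_map W f"
  shows "smooth_map W (\<lambda>x. L (f x))"
proof (rule smooth_map_compose [OF _ assms(2)])
  show "smooth_map UNIV L"
    unfolding smooth_map_def smooth_on_def
    using assms(1) bounded_linear_inner_left_comp by (blast intro: times_cont_diff_on_linear open_UNIV)
qed auto

lemma smooth_map_id [smooth_intros]: "open W \<Longrightarrow> smooth_map W (\<lambda>x. x)"
  unfolding smooth_map_def smooth_on_def
  using bounded_linear_inner_left by (blast intro: times_cont_diff_on_linear)

lemma smooth_map_add [smooth_intros]:
  "smooth_map W f \<Longrightarrow> smooth_map W g \<Longrightarrow> smooth_map W (\<lambda>x. f x + g x)"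
  by (simp add: smooth_map_def smooth_on_def inner_add_left times_cont_diff_on_add)

lemma smooth_map_sum [smooth_intros]:
  "open W \<Longrightarrow> (\<And>i. i \<in> I \<Longrightarrow> smooth_map W (f i)) \<Longrightarrow> smooth_map W (\<lambda>x. \<Sum>i\<in>I. f i x)"
  by (simp add: smooth_map_def smooth_on_def inner_sum_left times_cont_diff_on_sum)

lemma smooth_map_scaleR [smooth_intros]:
  "smooth_map W f \<Longrightarrow> smooth_map W g \<Longrightarrow> smooth_map W (\<lambda>x. f x *\<^sub>R g x)"
  by (simp add: smooth_map_def smooth_on_def times_cont_diff_on_mult)

text \<open>Expanding both arguments in the standard bases gives a sum of products of coordinates
  with constant vectors.\<close>

lemma smooth_map_bilinear:
  fixes prod :: "'a::euclidean_space \<Rightarrow> 'b::euclidean_space \<Rightarrow> 'c::euclidean_space"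
  assumes "bounded_bilinear prod" "smooth_map W f" "smooth_map W g"
  shows "smooth_map W (\<lambda>x. prod (f x) (g x))"
proof -
  interpret bounded_bilinear prod by fact
  have "smooth_map W (\<lambda>x. \<Sum>a\<in>Basis. \<Sum>b\<in>Basis. (f x \<bullet> a) *\<^sub>R (g x \<bullet> b) *\<^sub>R prod a b)"
    by (intro smooth_map_sum smooth_map_scaleR smooth_map_const smooth_map_linear [OF _ assms(2)]
        smooth_map_linear [OF _ assms(3)] bounded_linear_inner_left smooth_map_open [OF assms(2)])
  moreover have "(\<Sum>a\<in>Basis. \<Sum>b\<in>Basis. (f x \<bullet> a) *\<^sub>R (g x \<bullet> b) *\<^sub>R prod a b) = prod (f x) (g x)" for x
  proof -
    have "prod (f x) (g x) = prod (\<Sum>a\<in>Basis. (f x \<bullet> a) *\<^sub>R a) (\<Sum>b\<in>Basis. (g x \<bullet> b) *\<^sub>R b)"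
      by (simp add: euclidean_representation)
    then show ?thesis
      by (simp only: sum_left sum_right scaleR_left scaleR_right scaleR_sum_right)
        (subst sum.swap, simp add: mult.commute)
  qed
  ultimately show ?thesis by simp
qed

lemmas smooth_map_mult [smooth_intros] = smooth_map_bilinear [OF bounded_bilinear_mult]
lemmas smooth_map_inner [smooth_intros] = smooth_map_bilinear [OF bounded_bilinear_inner]
lemmas smooth_map_minus [smooth_intros] = smooth_map_linear [OF bounded_linear_minus [OF bounded_linear_ident]]
lemmas smooth_map_cnj [smooth_intros] = smooth_map_linear [OF bounded_linear_cnj]
lemmas smooth_map_Re [smooth_intros] = smooth_map_linear [OF bounded_linear_Re]
lemmas smooth_map_Im [smooth_intros] = smooth_map_linear [OF bounded_linear_Im]
lemmas smooth_map_fst [smooth_intros] = smooth_map_linear [OF bounded_linear_fst]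
lemmas smooth_map_snd [smooth_intros] = smooth_map_linear [OF bounded_linear_snd]
lemmas smooth_map_vec_nth [smooth_intros] = smooth_map_linear [OF bounded_linear_vec_nth]
lemmas smooth_map_of_real [smooth_intros] = smooth_map_linear [OF bounded_linear_of_real]

lemma smooth_map_diff [smooth_intros]:
  "smooth_map W f \<Longrightarrow> smooth_map W g \<Longrightarrow> smooth_map W (\<lambda>x. f x - g x)"
  using smooth_map_add [of W f "\<lambda>x. - g x"] smooth_map_minus [of W g] by simp

lemma smooth_map_Pair [smooth_intros]:
  "smooth_map W f \<Longrightarrow> smooth_map W g \<Longrightarrow> smooth_map W (\<lambda>x. (f x, g x))"
  by (auto simp: smooth_map_def Basis_prod_def)

lemma smooth_map_vec_lambda [smooth_intros]:
  "(\<And>i. smooth_map W (\<lambda>x. f x i)) \<Longrightarrow> smooth_map W (\<lambda>x. \<chi> i. f x i)"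
  by (auto simp: smooth_map_def Basis_vec_def inner_axis)

lemma smooth_map_Complex [smooth_intros]:
  "smooth_map W f \<Longrightarrow> smooth_map W g \<Longrightarrow> smooth_map W (\<lambda>x. Complex (f x) (g x))"
  by (auto simp: smooth_map_def Basis_complex_def)

lemma smooth_map_inverse [smooth_intros]:
  fixes f :: "'e::euclidean_space \<Rightarrow> real"
  assumes "smooth_map W f" "\<And>x. x \<in> W \<Longrightarrow> f x \<noteq> 0"
  shows "smooth_map W (\<lambda>x. inverse (f x))"
proof (rule smooth_map_compose [OF _ assms(1)])
  show "smooth_map (- {0::real}) inverse"
    by (simp add: smooth_map_real smooth_on_def times_cont_diff_on_inverse open_Compl)
qed (use assms in auto)

lemma smooth_map_divide [smooth_intros]:
  fixes f :: "'e::euclidean_space \<Rightarrow> real"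
  assumes "smooth_map W f" "smooth_map W g" "\<And>x. x \<in> W \<Longrightarrow> g x \<noteq> 0"
  shows "smooth_map W (\<lambda>x. f x / g x)"
  unfolding divide_inverse by (intro smooth_intros assms)

lemma smooth_map_inverse_complex [smooth_intros]:
  fixes f :: "'e::euclidean_space \<Rightarrow> complex"
  assumes "smooth_map W f" "\<And>x. x \<in> W \<Longrightarrow> f x \<noteq> 0"
  shows "smooth_map W (\<lambda>x. inverse (f x))"
proof -
  \<comment> \<open>1/z = conj z / |z|^2 reduces the complex inverse to the real one.\<close>
  have "inverse (f x) = inverse (Re (f x) * Re (f x) + Im (f x) * Im (f x)) *\<^sub>R cnj (f x)" for x
    by (simp add: complex_eq_iff power2_eq_square divide_inverse mult.commute)
  moreover have "Re (f x) * Re (f x) + Im (f x) * Im (f x) \<noteq> 0" if "x \<in> W" for x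
    using assms(2) [OF that] by (metis complex_eq_iff sum_squares_eq_zero_iff zero_complex.simps)
  ultimately show ?thesis
    by (simp only:) (intro smooth_intros assms)
qed

lemma smooth_map_divide_complex [smooth_intros]:
  fixes f :: "'e::euclidean_space \<Rightarrow> complex"
  assumes "smooth_map W f" "smooth_map W g" "\<And>x. x \<in> W \<Longrightarrow> g x \<noteq> 0"
  shows "smooth_map W (\<lambda>x. f x / g x)"
  unfolding divide_inverse by (intro smooth_intros assms)

lemma smooth_map_sqrt [smooth_intros]:
  assumes "smooth_map W f" "\<And>x. x \<in> W \<Longrightarrow> f x > 0"
  shows "smooth_map W (\<lambda>x. sqrt (f x))"
proof (rule smooth_map_compose [OF _ assms(1)])
  show "smooth_map {0 <..} sqrt"
    by (simp add: smooth_map_real smooth_on_def times_cont_diff_on_sqrt)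
qed (use assms in auto)

lemma smooth_map_norm_power2 [smooth_intros]:
  "smooth_map W f \<Longrightarrow> smooth_map W (\<lambda>x. (norm (f x))\<^sup>2)"
  by (simp add: power2_norm_eq_inner smooth_map_inner)

lemma smooth_map_norm [smooth_intros]:
  assumes "smooth_map W f" "\<And>x. x \<in> W \<Longrightarrow> f x \<noteq> 0"
  shows "smooth_map W (\<lambda>x. norm (f x))"
  unfolding norm_eq_sqrt_inner by (intro smooth_intros assms) (use assms in auto)

lemma smooth_map_matrix_mult [smooth_intros]:
  fixes f :: "'e::euclidean_space \<Rightarrow> complex^'n^'m" and g :: "'e \<Rightarrow> complex^'k^'n"
  shows "smooth_map W f \<Longrightarrow> smooth_map W g \<Longrightarrow> smooth_map W (\<lambda>x. f x ** g x)"
  unfolding matrix_matrix_mult_def by (auto intro!: smooth_intros dest: smooth_map_open)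

lemma smooth_map_matrix_vector_mult [smooth_intros]:
  fixes f :: "'e::euclidean_space \<Rightarrow> complex^'n^'m" and g :: "'e \<Rightarrow> complex^'n"
  shows "smooth_map W f \<Longrightarrow> smooth_map W g \<Longrightarrow> smooth_map W (\<lambda>x. f x *v g x)"
  unfolding matrix_vector_mult_def by (auto intro!: smooth_intros dest: smooth_map_open)

lemma smooth_map_vector_3 [smooth_intros]:
  fixes a b c :: "'e::euclidean_space \<Rightarrow> 'f::euclidean_space"
  assumes "smooth_map W a" "smooth_map W b" "smooth_map W c"
  shows "smooth_map W (\<lambda>x. vector [a x, b x, c x] :: 'f^3)"
proof -
  have "(vector [a x, b x, c x] :: 'f^3) = (\<chi> i. if i = 1 then a x else if i = 2 then b x else c x)" for x
    by (simp add: vec_eq_iff forall_3)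
  moreover have "smooth_map W (\<lambda>x. if i = 1 then a x else if i = 2 then b x else c x)" for i :: 3
    using assms by (cases "i = 1"; cases "i = 2") auto
  ultimately show ?thesis by (auto intro!: smooth_intros)
qed

section \<open>Diffeomorphisms onto subsets of Euclidean spaces\<close>

lemma smooth_topology_euclidean_subset [simp]: "smooth_topology (euclidean_subset X) = top_of_set X"
  by (simp add: euclidean_subset_def)

lemma smooth_topology_smooth_restrict [simp]:
  "smooth_topology (smooth_restrict M A) = subtopology (smooth_topology M) A"
  by (simp add: smooth_restrict_def)

lemma smooth_topology_smooth_quotient [simp]:
  "smooth_topology (smooth_quotient M \<pi>) = quotient_topology (smooth_topology M) \<pi>"
  by (simp add: smooth_quotient_def)

lemma smooth_functions_euclidean_subset:
  "f \<in> smooth_functions (euclidean_subset X) U \<longleftrightarrow>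
     (\<forall>x\<in>U. \<exists>W F. x \<in> W \<and> smooth_map W F \<and> (\<forall>y\<in>W \<inter> U. F y = f y))"
  by (simp add: euclidean_subset_def smooth_map_real conj_ac)

lemma smooth_functions_smooth_restrict:
  "f \<in> smooth_functions (smooth_restrict M A) U \<longleftrightarrow>
     (\<forall>p\<in>U. \<exists>V F. openin (smooth_topology M) V \<and> p \<in> V \<and>
        F \<in> smooth_functions M V \<and> (\<forall>q\<in>V \<inter> U. F q = f q))"
  by (simp add: smooth_restrict_def)

lemma smooth_functions_smooth_quotient:
  "f \<in> smooth_functions (smooth_quotient M \<pi>) V \<longleftrightarrow>
     f \<circ> \<pi> \<in> smooth_functions M {x \<in> points M. \<pi> x \<in> V}"
  by (simp add: smooth_quotient_def)

text \<open>Functions are total, and an arbitrary \<open>smooth_space\<close> could distinguish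
  functions that agree on the open set. Excluding this matters when a function is composed with a
  map and its inverse, since the result agrees with it only on the space.\<close>

definition determined_by_values :: "'a smooth_space \<Rightarrow> bool" where
  "determined_by_values M \<longleftrightarrow>
     (\<forall>V f g. (\<forall>x\<in>V. f x = g x) \<longrightarrow> f \<in> smooth_functions M V \<longrightarrow> g \<in> smooth_functions M V)"

lemma determined_by_valuesD:
  "determined_by_values M \<Longrightarrow> f \<in> smooth_functions M V \<Longrightarrow> (\<And>x. x \<in> V \<Longrightarrow> f x = g x) \<Longrightarrow>
     g \<in> smooth_functions M V"
  unfolding determined_by_values_def by blast

lemma determined_by_values_euclidean_subset: "determined_by_values (euclidean_subset X)"
  unfolding determined_by_values_def smooth_functions_euclidean_subset by (metis IntD2)

lemma determined_by_values_smooth_restrict: "determined_by_values (smooth_restrict M A)"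
  unfolding determined_by_values_def smooth_functions_smooth_restrict by (metis IntD2)

lemma determined_by_values_smooth_quotient:
  "determined_by_values M \<Longrightarrow> determined_by_values (smooth_quotient M \<pi>)"
  by (auto simp: smooth_functions_smooth_quotient determined_by_values_def [of "smooth_quotient M \<pi>"]
      elim!: determined_by_valuesD)

lemma diffeomorphism_image:
  "diffeomorphism M N \<phi> \<Longrightarrow> \<phi> ` points M = points N"
  by (simp add: diffeomorphism_def homeomorphic_imp_surjective_map)

lemma diffeomorphism_inj_on:
  "diffeomorphism M N \<phi> \<Longrightarrow> inj_on \<phi> (points M)"
  unfolding diffeomorphism_def using homeomorphic_imp_injective_map by blast

lemma diffeomorphism_trans:
  assumes "diffeomorphism M N \<phi>" "diffeomorphism N L \<xi>"
  shows "diffeomorphism M L (\<xi> \<circ> \<phi>)"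
  unfolding diffeomorphism_def
proof (intro conjI allI impI)
  show "homeomorphic_map (smooth_topology M) (smooth_topology L) (\<xi> \<circ> \<phi>)"
    using assms by (auto simp: diffeomorphism_def intro: homeomorphic_map_compose)
next
  fix V f assume V: "openin (smooth_topology L) V"
  let ?U = "{y \<in> points N. \<xi> y \<in> V}"
  have "openin (smooth_topology N) ?U"
    using V assms(2)
    by (auto simp: diffeomorphism_def intro: homeomorphic_imp_continuous_map openin_continuous_map_preimage)
  moreover have "{x \<in> points M. \<phi> x \<in> ?U} = {x \<in> points M. (\<xi> \<circ> \<phi>) x \<in> V}"
    using diffeomorphism_image [OF assms(1)] by auto
  ultimately show "f \<in> smooth_functions L V \<longleftrightarrow>
      f \<circ> (\<xi> \<circ> \<phi>) \<in> smooth_functions M {x \<in> points M. (\<xi> \<circ> \<phi>) x \<in> V}"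
    using assms V unfolding diffeomorphism_def by (simp add: o_assoc)
qed

lemma diffeomorphism_inverse:
  assumes "diffeomorphism M N \<phi>" "determined_by_values M"
    and inv: "\<And>x. x \<in> points M \<Longrightarrow> \<phi>' (\<phi> x) = x"
  shows "diffeomorphism N M \<phi>'"
  unfolding diffeomorphism_def
proof (intro conjI allI impI)
  have h: "homeomorphic_map (smooth_topology M) (smooth_topology N) \<phi>"
    using assms by (simp add: diffeomorphism_def)
  have "homeomorphic_maps (smooth_topology M) (smooth_topology N) \<phi> \<phi>'"
  proof -
    obtain g where g: "homeomorphic_maps (smooth_topology M) (smooth_topology N) \<phi> g"
      using h homeomorphic_map_maps by blast
    have "g y = \<phi>' y" if y: "y \<in> points N" for y
    proof -
      from y have "y \<in> \<phi> ` points M" by (simp only: diffeomorphism_image [OF assms(1)])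
      then show ?thesis using g inv by (auto simp: homeomorphic_maps_def)
    qed
    then show ?thesis
      using homeomorphic_maps_eq [OF g] by simp
  qed
  then show "homeomorphic_map (smooth_topology N) (smooth_topology M) \<phi>'"
    using homeomorphic_map_maps homeomorphic_maps_sym by blast
  fix V f assume V: "openin (smooth_topology M) V"
  have sub: "V \<subseteq> points M" using V openin_subset by blast
  have e: "{y \<in> points N. \<phi>' y \<in> V} = \<phi> ` V"
    unfolding diffeomorphism_image [OF assms(1), symmetric] using sub inv by force
  have o: "openin (smooth_topology N) (\<phi> ` V)"
    using h V homeomorphic_imp_open_map open_map_def by blast
  have e': "{x \<in> points M. \<phi> x \<in> \<phi> ` V} = V"
    using sub inv by (auto, metis subsetD)
  have "f \<circ> \<phi>' \<in> smooth_functions N (\<phi> ` V) \<longleftrightarrow> (f \<circ> \<phi>') \<circ> \<phi> \<in> smooth_functions M V"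
    using assms(1) o e' unfolding diffeomorphism_def by metis
  also have "\<dots> \<longleftrightarrow> f \<in> smooth_functions M V"
    using assms(2) inv sub by (auto elim!: determined_by_valuesD)
  finally show "f \<in> smooth_functions M V \<longleftrightarrow> f \<circ> \<phi>' \<in> smooth_functions N {y \<in> points N. \<phi>' y \<in> V}"
    by (simp add: e)
qed

text \<open>A local extension to an open set of \<open>M\<close> corresponds under \<psi> to one on
  an open set of \<open>Y\<close>, and near each point that is the restriction of a smooth function
  on the ambient space. So restricting in two stages gives the sheaf of the smaller Euclidean
  subset.\<close>

lemma diffeomorphism_restrict_euclidean:
  assumes "diffeomorphism M (euclidean_subset Y) \<psi>" "determined_by_values M" "A \<subseteq> points M"
  shows "diffeomorphism (smooth_restrict M A) (euclidean_subset (\<psi> ` A)) \<psi>"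
  unfolding diffeomorphism_def
proof (intro conjI allI impI)
  have Y: "\<psi> ` points M = Y" using diffeomorphism_image [OF assms(1)] by simp
  have inj: "inj_on \<psi> (points M)" using diffeomorphism_inj_on [OF assms(1)] .
  have h: "homeomorphic_map (smooth_topology M) (top_of_set Y) \<psi>"
    using assms by (simp add: diffeomorphism_def)
  have "homeomorphic_map (subtopology (smooth_topology M) A) (subtopology (top_of_set Y) (\<psi> ` A)) \<psi>"
    by (rule homeomorphic_map_subtopologies [OF h]) (use assms(3) Y in auto)
  moreover have "subtopology (top_of_set Y) (\<psi> ` A) = top_of_set (\<psi> ` A)"
    using assms(3) Y by (simp add: subtopology_subtopology inf_absorb2 image_mono subset_image_iff) 
      (metis image_mono inf.absorb2)
  ultimately show "homeomorphic_map (smooth_topology (smooth_restrict M A))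
      (smooth_topology (euclidean_subset (\<psi> ` A))) \<psi>"
    by simp
  fix V f assume "openin (smooth_topology (euclidean_subset (\<psi> ` A))) V"
  then have V: "V \<subseteq> \<psi> ` A" using openin_subset by fastforce
  let ?U = "{x \<in> points (smooth_restrict M A). \<psi> x \<in> V}"
  have U: "?U = {x \<in> A. \<psi> x \<in> V}" using assms(3) by auto
  show "f \<in> smooth_functions (euclidean_subset (\<psi> ` A)) V \<longleftrightarrow>
      f \<circ> \<psi> \<in> smooth_functions (smooth_restrict M A) ?U"
    unfolding U
  proof
    assume f: "f \<in> smooth_functions (euclidean_subset (\<psi> ` A)) V"
    show "f \<circ> \<psi> \<in> smooth_functions (smooth_restrict M A) {x \<in> A. \<psi> x \<in> V}"
      unfolding smooth_functions_smooth_restrict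
    proof
      fix p assume p: "p \<in> {x \<in> A. \<psi> x \<in> V}"
      then obtain W F where W: "\<psi> p \<in> W" "smooth_map W F" "\<forall>y\<in>W \<inter> V. F y = f y"
        using f unfolding smooth_functions_euclidean_subset by blast
      let ?W = "Y \<inter> W"
      let ?V = "{x \<in> points M. \<psi> x \<in> ?W}"
      have oW: "openin (top_of_set Y) ?W"
        using smooth_map_open [OF W(2)] by (simp add: openin_open_Int)
      then have "openin (smooth_topology M) ?V"
        using h homeomorphic_imp_continuous_map openin_continuous_map_preimage by fastforce
      moreover have "F \<in> smooth_functions (euclidean_subset Y) ?W"
        unfolding smooth_functions_euclidean_subset using W by blast
      then have "F \<circ> \<psi> \<in> smooth_functions M ?V"
        using assms(1) oW unfolding diffeomorphism_def by simp
      moreover have "p \<in> ?V" using p W(1) assms(3) Y by blast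
      moreover have "\<forall>q\<in>?V \<inter> {x \<in> A. \<psi> x \<in> V}. (F \<circ> \<psi>) q = (f \<circ> \<psi>) q"
        using W(3) by auto
      ultimately show "\<exists>V' G. openin (smooth_topology M) V' \<and> p \<in> V' \<and>
          G \<in> smooth_functions M V' \<and> (\<forall>q\<in>V' \<inter> {x \<in> A. \<psi> x \<in> V}. G q = (f \<circ> \<psi>) q)"
        by blast
    qed
  next
    assume f: "f \<circ> \<psi> \<in> smooth_functions (smooth_restrict M A) {x \<in> A. \<psi> x \<in> V}"
    show "f \<in> smooth_functions (euclidean_subset (\<psi> ` A)) V"
      unfolding smooth_functions_euclidean_subset
    proof
      fix q assume q: "q \<in> V"
      then obtain p where p: "p \<in> A" "q = \<psi> p" using V by blast
      then obtain V' G where V': "openin (smooth_topology M) V'" "p \<in> V'" "G \<in> smooth_functions M V'"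
          "\<forall>x\<in>V' \<inter> {x \<in> A. \<psi> x \<in> V}. G x = (f \<circ> \<psi>) x"
        using f q unfolding smooth_functions_smooth_restrict by blast
      define \<psi>' where "\<psi>' = inv_into (points M) \<psi>"
      have inv: "\<psi>' (\<psi> x) = x" if "x \<in> points M" for x
        using inj that by (simp add: \<psi>'_def)
      have sub: "V' \<subseteq> points M" using V'(1) openin_subset by blast
      have o: "openin (top_of_set Y) (\<psi> ` V')"
        using h V' homeomorphic_imp_open_map open_map_def by blast
      then obtain W' where W': "open W'" "\<psi> ` V' = Y \<inter> W'"
        by (auto simp: openin_open)
      have "{x \<in> points M. \<psi> x \<in> \<psi> ` V'} = V'"
        using sub inj by (auto dest: inj_onD)
      moreover have "(G \<circ> \<psi>') \<circ> \<psi> \<in> smooth_functions M V'"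
        by (rule determined_by_valuesD [OF assms(2) V'(3)]) (use sub inv in auto)
      ultimately have "G \<circ> \<psi>' \<in> smooth_functions (euclidean_subset Y) (\<psi> ` V')"
        using assms(1) o unfolding diffeomorphism_def by simp
      then obtain W F where W: "q \<in> W" "smooth_map W F" "\<forall>y\<in>W \<inter> \<psi> ` V'. F y = (G \<circ> \<psi>') y"
        using p V'(2) unfolding smooth_functions_euclidean_subset by blast
      have "smooth_map (W \<inter> W') F"
        using W(2) W'(1) smooth_map_open smooth_map_subset by blast
      moreover have "q \<in> W \<inter> W'" using W(1) W'(2) p V'(2) by blast
      moreover have "F y = f y" if "y \<in> W \<inter> W' \<inter> V" for y
      proof -
        from that V have "y \<in> \<psi> ` A" by blast
        then obtain x where x: "x \<in> A" "y = \<psi> x" by blast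
        then have "y \<in> \<psi> ` V'" using that W'(2) assms(3) Y by blast
        then have "x \<in> V'" using x sub assms(3) inj by (auto dest: inj_onD)
        then show ?thesis
          using that x W(3) V'(4) inv sub by auto
      qed
      ultimately show "\<exists>W F. q \<in> W \<and> smooth_map W F \<and> (\<forall>y\<in>W \<inter> V. F y = f y)" by blast
    qed
  qed
qed

text \<open>Smoothness of \<Phi> carries functions on \<open>Y\<close> to the quotient; the local
  sections carry them back, because \<open>f\<close> near \<open>y\<close> is its lift composed with
  a section. The sections also show that \<psi> is open.\<close>

lemma diffeomorphism_euclidean_quotient:
  fixes \<Phi> :: "'e::euclidean_space \<Rightarrow> 'f::euclidean_space"
  assumes \<Phi>: "smooth_map D \<Phi>" "X \<subseteq> D" and into: "\<And>x. x \<in> X \<Longrightarrow> \<Phi> x \<in> Y"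
    and fibres: "\<And>x x'. x \<in> X \<Longrightarrow> x' \<in> X \<Longrightarrow> \<Phi> x = \<Phi> x' \<Longrightarrow> \<pi> x = \<pi> x'"
    and \<psi>: "\<And>x. x \<in> X \<Longrightarrow> \<psi> (\<pi> x) = \<Phi> x"
    and sections: "\<And>y. y \<in> Y \<Longrightarrow>
      \<exists>W s. y \<in> W \<and> smooth_map W s \<and> (\<forall>y'\<in>W \<inter> Y. s y' \<in> X \<and> \<Phi> (s y') = y')"
  shows "diffeomorphism (smooth_quotient (euclidean_subset X) \<pi>) (euclidean_subset Y) \<psi>"
  unfolding diffeomorphism_def smooth_topology_euclidean_subset smooth_topology_smooth_quotient
proof (intro conjI allI impI)
  let ?Q = "quotient_topology (top_of_set X) \<pi>"
  have cont: "continuous_on D \<Phi>" and "open D"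
    using \<Phi> smooth_map_imp_continuous_on smooth_map_open by auto
  have surj: "\<Phi> ` X = Y"
  proof
    show "Y \<subseteq> \<Phi> ` X"
      by clarify (metis IntI image_eqI sections)
  qed (use into in auto)
  show "homeomorphic_map ?Q (top_of_set Y) \<psi>"
  proof (rule bijective_open_imp_homeomorphic_map)
    show "\<psi> ` topspace ?Q = topspace (top_of_set Y)"
      using surj \<psi> by (simp add: image_image)
    show "inj_on \<psi> (topspace ?Q)"
      unfolding inj_on_def by (simp add: \<psi>) (meson fibres)
    show "continuous_map ?Q (top_of_set Y) \<psi>"
      unfolding continuous_map_def
    proof (intro conjI allI impI)
      show "\<psi> \<in> topspace ?Q \<rightarrow> topspace (top_of_set Y)" using \<psi> into by auto
      fix V assume "openin (top_of_set Y) V"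
      then have "openin (top_of_set X) (X \<inter> \<Phi> -` V)"
        using continuous_openin_preimage_gen continuous_on_subset [OF cont \<Phi>(2)] surj
        by (metis continuous_openin_preimage image_subset_iff_funcset subset_refl)
      moreover have "{x \<in> topspace (top_of_set X). \<pi> x \<in> {q \<in> topspace ?Q. \<psi> q \<in> V}} = X \<inter> \<Phi> -` V"
        using \<psi> by (auto, metis)
      ultimately show "openin ?Q {q \<in> topspace ?Q. \<psi> q \<in> V}"
        by (auto simp: openin_quotient_topology)
    qed
    show "open_map ?Q (top_of_set Y) \<psi>"
      unfolding open_map_def
    proof (intro allI impI)
      fix U assume "openin ?Q U"
      then have U: "U \<subseteq> \<pi> ` X" and "openin (top_of_set X) {x \<in> X. \<pi> x \<in> U}"
        by (auto simp: openin_quotient_topology)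
      then obtain T where T: "open T" "{x \<in> X. \<pi> x \<in> U} = X \<inter> T" by (auto simp: openin_open)
      have T': "x \<in> T \<longleftrightarrow> \<pi> x \<in> U" if "x \<in> X" for x using T(2) that by blast
      show "openin (top_of_set Y) (\<psi> ` U)"
      proof (subst openin_subopen, intro ballI)
        fix y assume "y \<in> \<psi> ` U"
        then obtain x where x: "x \<in> X" "\<pi> x \<in> U" "y = \<Phi> x" using U \<psi> by auto
        then have y: "y \<in> Y" using into by simp
        obtain W s where W: "y \<in> W" "smooth_map W s" "\<forall>y'\<in>W \<inter> Y. s y' \<in> X \<and> \<Phi> (s y') = y'"
          using sections [OF y] by blast
        have "open (W \<inter> s -` T)"
          using smooth_map_imp_continuous_on [OF W(2)] smooth_map_open [OF W(2)] T(1)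
          by (simp add: continuous_open_preimage)
        then have "openin (top_of_set Y) (Y \<inter> (W \<inter> s -` T))" by (simp add: openin_open_Int)
        \<comment> \<open>The section need not pass through \<open>x\<close>, but \<open>s y\<close>
          and \<open>x\<close> lie in one fibre, and \<open>T\<close> meets \<open>X\<close> in a
          union of fibres.\<close>
        moreover have "s y \<in> T"
        proof -
          have "s y \<in> X" "\<Phi> (s y) = \<Phi> x" using W y x by auto
          then have "\<pi> (s y) = \<pi> x" using fibres x by blast
          then show ?thesis using T' [OF \<open>s y \<in> X\<close>] x(2) by simp
        qed
        then have "y \<in> Y \<inter> (W \<inter> s -` T)" using y W by auto
        moreover have "Y \<inter> (W \<inter> s -` T) \<subseteq> \<psi> ` U"
        proof
          fix y' assume y': "y' \<in> Y \<inter> (W \<inter> s -` T)"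
          then have "s y' \<in> X" "\<Phi> (s y') = y'" "\<pi> (s y') \<in> U" using W T' by auto
          then show "y' \<in> \<psi> ` U" using \<psi> [of "s y'"] by (metis imageI)
        qed
        ultimately show "\<exists>T. openin (top_of_set Y) T \<and> y \<in> T \<and> T \<subseteq> \<psi> ` U" by blast
      qed
    qed
  qed
  fix V f assume "openin (top_of_set Y) V"
  then have V: "V \<subseteq> Y" using openin_subset by fastforce
  have e: "{x \<in> points (euclidean_subset X). \<pi> x \<in> {q \<in> topspace ?Q. \<psi> q \<in> V}} = {x \<in> X. \<Phi> x \<in> V}"
    using \<psi> by (auto, metis)
  show "f \<in> smooth_functions (euclidean_subset Y) V \<longleftrightarrow>
      f \<circ> \<psi> \<in> smooth_functions (smooth_quotient (euclidean_subset X) \<pi>) {q \<in> topspace ?Q. \<psi> q \<in> V}"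
    unfolding smooth_functions_smooth_quotient e
  proof
    assume f: "f \<in> smooth_functions (euclidean_subset Y) V"
    show "f \<circ> \<psi> \<circ> \<pi> \<in> smooth_functions (euclidean_subset X) {x \<in> X. \<Phi> x \<in> V}"
      unfolding smooth_functions_euclidean_subset
    proof
      fix x assume x: "x \<in> {x \<in> X. \<Phi> x \<in> V}"
      then obtain W F where W: "\<Phi> x \<in> W" "smooth_map W F" "\<forall>y\<in>W \<inter> V. F y = f y"
        using f unfolding smooth_functions_euclidean_subset by blast
      have "open (D \<inter> \<Phi> -` W)"
        using cont \<open>open D\<close> smooth_map_open [OF W(2)] by (simp add: continuous_open_preimage)
      then have "smooth_map (D \<inter> \<Phi> -` W) \<Phi>" using \<Phi>(1) smooth_map_subset by blast
      then have "smooth_map (D \<inter> \<Phi> -` W) (\<lambda>x. F (\<Phi> x))" using W(2) smooth_map_compose by blast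
      then show "\<exists>W F. x \<in> W \<and> smooth_map W F \<and>
          (\<forall>y\<in>W \<inter> {x \<in> X. \<Phi> x \<in> V}. F y = (f \<circ> \<psi> \<circ> \<pi>) y)"
        using x \<Phi>(2) W \<psi> by (intro exI [of _ "D \<inter> \<Phi> -` W"] exI [of _ "\<lambda>x. F (\<Phi> x)"]) auto
    qed
  next
    assume f: "f \<circ> \<psi> \<circ> \<pi> \<in> smooth_functions (euclidean_subset X) {x \<in> X. \<Phi> x \<in> V}"
    show "f \<in> smooth_functions (euclidean_subset Y) V"
      unfolding smooth_functions_euclidean_subset
    proof
      fix y assume y: "y \<in> V"
      obtain W s where W: "y \<in> W" "smooth_map W s" "\<forall>y'\<in>W \<inter> Y. s y' \<in> X \<and> \<Phi> (s y') = y'"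
        using sections y V by (meson subsetD)
      have "s y \<in> {x \<in> X. \<Phi> x \<in> V}" using W y V by auto
      then obtain W' F where W': "s y \<in> W'" "smooth_map W' F"
          "\<forall>x\<in>W' \<inter> {x \<in> X. \<Phi> x \<in> V}. F x = (f \<circ> \<psi> \<circ> \<pi>) x"
        using f unfolding smooth_functions_euclidean_subset by blast
      have "open (W \<inter> s -` W')"
        using smooth_map_imp_continuous_on [OF W(2)] smooth_map_open [OF W(2)] smooth_map_open [OF W'(2)]
        by (simp add: continuous_open_preimage)
      then have "smooth_map (W \<inter> s -` W') s" using W(2) smooth_map_subset by blast
      then have "smooth_map (W \<inter> s -` W') (\<lambda>x. F (s x))" using W'(2) smooth_map_compose by blast
      moreover have "F (s y') = f y'" if "y' \<in> W \<inter> s -` W' \<inter> V" for y'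
      proof -
        have "s y' \<in> X" "\<Phi> (s y') = y'" using that W V by auto
        then show ?thesis using that W'(3) \<psi> by auto
      qed
      ultimately show "\<exists>W F. y \<in> W \<and> smooth_map W F \<and> (\<forall>y'\<in>W \<inter> V. F y' = f y')"
        using W(1) W'(1) by (intro exI [of _ "W \<inter> s -` W'"] exI [of _ "\<lambda>x. F (s x)"]) auto
    qed
  qed
qed

text \<open>A subset is its own quotient, which makes the preceding criterion available for plain
  subsets.\<close>

lemma diffeomorphism_smooth_quotient_id:
  "diffeomorphism (euclidean_subset X) (smooth_quotient (euclidean_subset X) id) id"
proof -
  have "quotient_topology (top_of_set X) id = top_of_set X"
  proof (rule topology_eq [THEN iffD2], intro allI)
    fix V :: "'a set"
    have "V \<subseteq> X \<Longrightarrow> {x \<in> X. x \<in> V} = V" by auto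
    then show "openin (quotient_topology (top_of_set X) id) V \<longleftrightarrow> openin (top_of_set X) V"
      using openin_subset [of "top_of_set X" V] by (auto simp: openin_quotient_topology)
  qed
  then show ?thesis
    by (simp add: diffeomorphism_def smooth_functions_smooth_quotient)
qed

lemma diffeomorphism_euclidean:
  fixes \<Phi> :: "'e::euclidean_space \<Rightarrow> 'f::euclidean_space"
  assumes "smooth_map D \<Phi>" "X \<subseteq> D" "smooth_map D' \<Psi>" "Y \<subseteq> D'"
    and "\<And>x. x \<in> X \<Longrightarrow> \<Phi> x \<in> Y \<and> \<Psi> (\<Phi> x) = x" "\<And>y. y \<in> Y \<Longrightarrow> \<Psi> y \<in> X \<and> \<Phi> (\<Psi> y) = y"
  shows "diffeomorphism (euclidean_subset X) (euclidean_subset Y) \<Phi>"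
proof -
  have "diffeomorphism (smooth_quotient (euclidean_subset X) id) (euclidean_subset Y) \<Phi>"
  proof (rule diffeomorphism_euclidean_quotient [OF assms(1,2)])
    show "\<exists>W s. y \<in> W \<and> smooth_map W s \<and> (\<forall>y'\<in>W \<inter> Y. s y' \<in> X \<and> \<Phi> (s y') = y')" if "y \<in> Y" for y
      using assms that by blast
  next
    show "id x = id x'" if "x \<in> X" "x' \<in> X" "\<Phi> x = \<Phi> x'" for x x'
      using assms(5) that by (metis id_apply)
  qed (simp_all add: assms(5))
  from diffeomorphism_trans [OF diffeomorphism_smooth_quotient_id this] show ?thesis
    by simp
qed

text \<open>Hausdorffness and second countability are inherited from the Euclidean space. The charts
  may take values in any space \<open>'c\<close> of the right dimension, so that complex coordinates
  can be used; a linear isomorphism moves them to \<open>'e\<close>.\<close>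

lemma smooth_manifold_euclidean_model:
  fixes \<psi> :: "'a \<Rightarrow> 'f::euclidean_space"
  assumes M: "determined_by_values M" "diffeomorphism M (euclidean_subset Y) \<psi>"
    and dim: "DIM('c::euclidean_space) = DIM('e::euclidean_space)"
    and charts: "\<And>y. y \<in> Y \<Longrightarrow> \<exists>D V (c :: 'f \<Rightarrow> 'c) d. y \<in> D \<and> smooth_map D c \<and> smooth_map V d \<and>
      (\<forall>y'\<in>D \<inter> Y. c y' \<in> V \<and> d (c y') = y') \<and> (\<forall>v\<in>V. d v \<in> D \<inter> Y \<and> c (d v) = v)"
  shows "smooth_manifold TYPE('e) M"
  unfolding smooth_manifold_def
proof (intro conjI ballI)
  have h: "homeomorphic_map (smooth_topology M) (top_of_set Y) \<psi>"
    using M by (simp add: diffeomorphism_def)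
  then have hs: "smooth_topology M homeomorphic_space top_of_set Y"
    by (rule homeomorphic_map_imp_homeomorphic_space)
  show "Hausdorff_space (smooth_topology M)"
    using homeomorphic_Hausdorff_space [OF hs] by (simp add: Hausdorff_space_subtopology)
  have "second_countable (euclidean :: 'f topology)"
  proof -
    obtain B :: "'f set set" where "countable B" "topological_basis B"
      using ex_countable_basis by blast
    then show ?thesis
      unfolding second_countable_def
      by (metis open_openin topological_basisE topological_basis_open)
  qed
  then show "second_countable (smooth_topology M)"
    using homeomorphic_space_second_countability [OF hs] second_countable_subtopology by blast
next
  have h: "homeomorphic_map (smooth_topology M) (top_of_set Y) \<psi>"
    using M by (simp add: diffeomorphism_def)
  fix p assume p: "p \<in> points M"
  have Y: "\<psi> ` points M = Y" using diffeomorphism_image [OF M(2)] by simp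
  then obtain D V and c :: "'f \<Rightarrow> 'c" and d where c: "\<psi> p \<in> D" "smooth_map D c" "smooth_map V d"
    "\<forall>y'\<in>D \<inter> Y. c y' \<in> V \<and> d (c y') = y'" "\<forall>v\<in>V. d v \<in> D \<inter> Y \<and> c (d v) = v"
    using p charts [of "\<psi> p"] by blast
  obtain f :: "'c \<Rightarrow> 'e" and g where fg: "linear f" "linear g"
      "\<And>x. g (f x) = x" "\<And>y. f (g y) = y"
    using isomorphisms_UNIV_UNIV [where 'M = 'c and 'N = 'e, OF dim] by metis
  define U where "U = {x \<in> points M. \<psi> x \<in> Y \<inter> D}"
  have "openin (top_of_set Y) (Y \<inter> D)" using smooth_map_open [OF c(2)] by (simp add: openin_open_Int)
  then have oU: "openin (smooth_topology M) U"
    unfolding U_def by (rule openin_continuous_map_preimage [OF homeomorphic_imp_continuous_map [OF h]])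
  have bl: "bounded_linear f" "bounded_linear g" using fg linear_linear by auto
  have sf: "smooth_map UNIV f" "smooth_map UNIV g"
    using smooth_map_linear [OF bl(1) smooth_map_id] smooth_map_linear [OF bl(2) smooth_map_id] by auto
  have eq: "f ` V = g -` V" using fg(3,4) by (auto simp: image_iff) metis
  have oV: "open (g -` V)"
    using sf(2) c(3) smooth_map_imp_continuous_on smooth_map_open open_vimage by blast
  have "diffeomorphism (euclidean_subset (\<psi> ` U)) (euclidean_subset (f ` V)) (\<lambda>x. f (c x))"
  proof (rule diffeomorphism_euclidean)
    show "smooth_map D (\<lambda>x. f (c x))" by (rule smooth_map_linear [OF bl(1) c(2)])
    show "smooth_map (g -` V) (\<lambda>x. d (g x))"
      by (rule smooth_map_compose [OF c(3) smooth_map_subset [OF sf(2)]]) (use oV in auto)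
    show "f (c x) \<in> f ` V \<and> d (g (f (c x))) = x" if "x \<in> \<psi> ` U" for x
      using that c fg by (auto simp: U_def)
    show "d (g y) \<in> \<psi> ` U \<and> f (c (d (g y))) = y" if "y \<in> f ` V" for y
    proof -
      have "g y \<in> V" using that eq by auto
      moreover from this have "d (g y) \<in> \<psi> ` U" using c(5) Y by (force simp: U_def)
      ultimately show ?thesis using c(5) fg by auto
    qed
  qed (auto simp: eq U_def)
  from diffeomorphism_trans [OF diffeomorphism_restrict_euclidean [OF M(2,1)] this]
  have "diffeomorphism (smooth_restrict M U) (euclidean_subset (f ` V)) ((\<lambda>x. f (c x)) \<circ> \<psi>)"
    by (auto simp: U_def)
  moreover have "p \<in> U" using p c(1) Y by (auto simp: U_def)
  ultimately show "\<exists>U (V::'e set) \<phi>. openin (smooth_topology M) U \<and> p \<in> U \<and> open V \<and>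
        diffeomorphism (smooth_restrict M U) (euclidean_subset V) \<phi>"
    using oU oV eq by metis
qed

lemma equivariant_diffeomorphism_trans:
  assumes "equivariant_diffeomorphism G M a N b \<phi>" "equivariant_diffeomorphism G N b L c \<xi>"
  shows "equivariant_diffeomorphism G M a L c (\<xi> \<circ> \<phi>)"
  using assms diffeomorphism_trans diffeomorphism_image
  unfolding equivariant_diffeomorphism_def by fastforce

lemma equivariant_diffeomorphism_inverse:
  assumes "equivariant_diffeomorphism G M a N b \<phi>" "determined_by_values M"
    and "\<And>g x. g \<in> carrier G \<Longrightarrow> x \<in> points M \<Longrightarrow> a g x \<in> points M"
    and inv: "\<And>x. x \<in> points M \<Longrightarrow> \<phi>' (\<phi> x) = x"
  shows "equivariant_diffeomorphism G N b M a \<phi>'"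
  unfolding equivariant_diffeomorphism_def
proof (intro conjI ballI)
  have d: "diffeomorphism M N \<phi>" using assms by (simp add: equivariant_diffeomorphism_def)
  from d assms(2) inv show "diffeomorphism N M \<phi>'" by (rule diffeomorphism_inverse)
  fix g y assume g: "g \<in> carrier G" and "y \<in> points N"
  then obtain x where x: "x \<in> points M" "y = \<phi> x" using diffeomorphism_image [OF d] by blast
  then have "b g y = \<phi> (a g x)" using assms(1) g by (simp add: equivariant_diffeomorphism_def)
  then show "\<phi>' (b g y) = a g (\<phi>' y)" using inv x assms(3) g by simp
qed

lemma equivariant_diffeomorphism_restrict_euclidean:
  assumes "equivariant_diffeomorphism G M a (euclidean_subset Y) b \<psi>" "determined_by_values M"
    and "A \<subseteq> points M"
  shows "equivariant_diffeomorphism G (smooth_restrict M A) a (euclidean_subset (\<psi> ` A)) b \<psi>"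
  using assms diffeomorphism_restrict_euclidean unfolding equivariant_diffeomorphism_def by auto

section \<open>Unitary matrices\<close>

definition dag :: "complex^'n^'m \<Rightarrow> complex^'m^'n" where
  "dag A = (\<chi> i j. cnj (A $ j $ i))"

lemma dag_nth [simp]: "dag A $ i $ j = cnj (A $ j $ i)"
  by (simp add: dag_def)

lemma dag_dag [simp]: "dag (dag A) = A"
  by (simp add: vec_eq_iff)

lemma dag_mult: "dag (A ** B) = dag B ** dag A"
  by (simp add: vec_eq_iff matrix_matrix_mult_def mult.commute)

lemma dag_mat [simp]: "dag (mat 1) = mat 1"
  by (simp add: vec_eq_iff mat_def)

lemma dag_add: "dag (A + B) = dag A + dag B"
  by (simp add: vec_eq_iff)

lemma dag_diff: "dag (A - B) = dag A - dag B"
  by (simp add: vec_eq_iff)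

lemma dag_scaleR: "dag (c *\<^sub>R A) = c *\<^sub>R dag A"
  by (simp add: vec_eq_iff)

lemma matrix_mult_scaleR_left: "(c *\<^sub>R A) ** (B :: complex^'k^'n) = c *\<^sub>R (A ** B)"
  by (simp add: vec_eq_iff matrix_matrix_mult_def scaleR_sum_right)

lemma matrix_mult_scaleR_right: "(A :: complex^'n^'m) ** (c *\<^sub>R B) = c *\<^sub>R (A ** B)"
  by (simp add: vec_eq_iff matrix_matrix_mult_def scaleR_sum_right)

lemma matrix_vector_scaleR_right: "(A :: complex^'n^'m) *v (c *\<^sub>R x) = c *\<^sub>R (A *v x)"
  by (simp add: vec_eq_iff matrix_vector_mult_def scaleR_sum_right)

lemma matrix_mult_diff_left: "(A - B) ** (C :: complex^'k^'n) = A ** C - B ** C"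
  by (simp add: vec_eq_iff matrix_matrix_mult_def left_diff_distrib sum_subtractf)

lemma matrix_mult_diff_right: "(A :: complex^'n^'m) ** (B - C) = A ** B - A ** C"
  by (simp add: vec_eq_iff matrix_matrix_mult_def right_diff_distrib sum_subtractf)

lemma matrix_add_rdistrib: "(A + B) ** (C :: complex^'k^'n) = A ** C + B ** C"
  by (simp add: vec_eq_iff matrix_matrix_mult_def distrib_right sum.distrib)

lemmas matrix_distribs =
  matrix_mult_scaleR_left matrix_mult_scaleR_right matrix_mult_diff_left matrix_mult_diff_right
  matrix_add_ldistrib matrix_add_rdistrib

lemma unitary_iff: "unitary A \<longleftrightarrow> dag A ** A = mat 1"
  by (simp add: unitary_def dag_def)

lemma unitary_right: "unitary A \<Longrightarrow> A ** dag A = mat 1"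
  by (simp add: unitary_iff matrix_left_right_inverse)

lemma unitary_dag: "unitary A \<Longrightarrow> unitary (dag A)"
  by (simp add: unitary_iff unitary_right)

lemma unitary_mat [simp]: "unitary (mat 1)"
  by (simp add: unitary_iff)

lemma unitary_mult:
  assumes "unitary A" "unitary B"
  shows "unitary (A ** B)"
proof -
  have "dag (A ** B) ** (A ** B) = dag B ** (dag A ** A) ** B"
    by (simp add: dag_mult matrix_mul_assoc)
  with assms show ?thesis by (simp add: unitary_iff)
qed

lemma matrix_inv_unitary:
  assumes "unitary A"
  shows "matrix_inv A = dag A"
  unfolding matrix_inv_def
proof (rule some_equality)
  show d: "A ** dag A = mat 1 \<and> dag A ** A = mat 1"
    using assms unitary_right by (simp add: unitary_iff)
  fix B assume "A ** B = mat 1 \<and> B ** A = mat 1"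
  then have "dag A ** (A ** B) = dag A" by simp
  then show "B = dag A" using d by (simp add: matrix_mul_assoc)
qed

lemma smooth_map_dag [smooth_intros]: "smooth_map W f \<Longrightarrow> smooth_map W (\<lambda>x. dag (f x))"
  unfolding dag_def by (intro smooth_intros)

text \<open>All groups involved consist of unitary matrices, whose inverse is the smooth expression
  \<open>dag\<close>.\<close>

locale unitary_group =
  fixes S :: "(complex^'n^'n) set"
  assumes unitary: "g \<in> S \<Longrightarrow> unitary g"
    and one: "mat 1 \<in> S"
    and mult: "g \<in> S \<Longrightarrow> h \<in> S \<Longrightarrow> g ** h \<in> S"
    and dag: "g \<in> S \<Longrightarrow> dag g \<in> S"
begin

lemma left_inverse: "g \<in> S \<Longrightarrow> dag g ** g = mat 1"
  and right_inverse: "g \<in> S \<Longrightarrow> g ** dag g = mat 1"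
  using unitary unitary_right by (auto simp: unitary_iff)

lemma cancel: "g \<in> S \<Longrightarrow> dag g ** (g ** h) = h" "g \<in> S \<Longrightarrow> g ** (dag g ** h) = h"
  by (simp_all add: matrix_mul_assoc left_inverse right_inverse)

lemma carrier: "carrier (matrix_group S) = S"
  by (simp add: matrix_group_def)

lemma group: "group (matrix_group S)"
proof (rule groupI)
  show "\<exists>y\<in>carrier (matrix_group S). y \<otimes>\<^bsub>matrix_group S\<^esub> x = \<one>\<^bsub>matrix_group S\<^esub>"
    if "x \<in> carrier (matrix_group S)" for x
    using that dag left_inverse by (auto simp: matrix_group_def)
qed (auto simp: matrix_group_def one mult matrix_mul_assoc)

lemma inv: "g \<in> S \<Longrightarrow> inv\<^bsub>matrix_group S\<^esub> g = dag g"
  by (rule group.inv_equality [OF group]) (simp_all add: dag left_inverse matrix_group_def)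

lemma l_coset: "g <#\<^bsub>matrix_group S\<^esub> H = (\<lambda>h. g ** h) ` H"
  by (auto simp: l_coset_def matrix_group_def)

lemma coset_action_l_coset:
  "coset_action (matrix_group S) g (h <#\<^bsub>matrix_group S\<^esub> H) = (g ** h) <#\<^bsub>matrix_group S\<^esub> H"
  by (simp add: coset_action_def l_coset image_image matrix_mul_assoc)

end

locale unitary_subgroup = unitary_group S + sub: unitary_group H
  for S H :: "(complex^'n^'n) set" +
  assumes subset: "H \<subseteq> S"
begin

lemma l_coset_eq:
  assumes "g \<in> S" "dag g ** g' \<in> H"
  shows "g <#\<^bsub>matrix_group S\<^esub> H = g' <#\<^bsub>matrix_group S\<^esub> H"
proof -
  have "g' = g ** (dag g ** g')" using assms by (simp add: cancel)
  then obtain k where k: "k \<in> H" "g' = g ** k" using assms by blast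
  have "(\<lambda>h. k ** h) ` H = H"
  proof (intro equalityI subsetI)
    fix h assume "h \<in> H"
    then show "h \<in> (\<lambda>h. k ** h) ` H"
      using k(1) sub.mult sub.dag by (intro image_eqI [of _ _ "dag k ** h"]) (simp_all only: sub.cancel)
  qed (use k(1) sub.mult in auto)
  then have "(\<lambda>h. g' ** h) ` H = (\<lambda>h. g ** h) ` H"
    unfolding k(2) by (metis (no_types, lifting) image_cong image_image matrix_mul_assoc)
  then show ?thesis by (simp add: l_coset)
qed

end

section \<open>The special unitary group in dimension three\<close>

definition hdot :: "complex^3 \<Rightarrow> complex^3 \<Rightarrow> complex" where
  "hdot z u = (\<Sum>i\<in>UNIV. cnj (z $ i) * u $ i)"

definition outer :: "complex^3 \<Rightarrow> complex^3 \<Rightarrow> complex^3^3" where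
  "outer z u = (\<chi> i j. z $ i * cnj (u $ j))"

text \<open>The complex conjugate of the cross product, so that it is equivariant under \<open>SU(3)\<close>.\<close>

definition ccross :: "complex^3 \<Rightarrow> complex^3 \<Rightarrow> complex^3" where
  "ccross z u = vector [cnj (z$2 * u$3 - z$3 * u$2), cnj (z$3 * u$1 - z$1 * u$3),
     cnj (z$1 * u$2 - z$2 * u$1)]"

abbreviation unit_vec :: "3 \<Rightarrow> complex^3" where
  "unit_vec i \<equiv> axis i 1"

lemma smooth_map_outer [smooth_intros]:
  "smooth_map W f \<Longrightarrow> smooth_map W g \<Longrightarrow> smooth_map W (\<lambda>x. outer (f x) (g x))"
  unfolding outer_def by (intro smooth_intros)

lemma smooth_map_ccross [smooth_intros]:
  "smooth_map W f \<Longrightarrow> smooth_map W g \<Longrightarrow> smooth_map W (\<lambda>x. ccross (f x) (g x))"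
  unfolding ccross_def by (intro smooth_intros)

lemma outer_nth [simp]: "outer z u $ i $ j = z $ i * cnj (u $ j)"
  by (simp add: outer_def)

lemma ccross_nth [simp]:
  "ccross z u $ 1 = cnj (z$2 * u$3 - z$3 * u$2)"
  "ccross z u $ 2 = cnj (z$3 * u$1 - z$1 * u$3)"
  "ccross z u $ 3 = cnj (z$1 * u$2 - z$2 * u$1)"
  by (simp_all add: ccross_def)

lemma hdot_self: "hdot z z = of_real ((norm z)\<^sup>2)"
proof -
  have "(norm z)\<^sup>2 = (\<Sum>i\<in>UNIV. (cmod (z $ i))\<^sup>2)"
    by (simp add: norm_vec_def L2_set_def sum_nonneg)
  then show ?thesis
    by (simp add: hdot_def complex_norm_square mult.commute del: of_real_power)
qed

lemma norm_eq_hdot: "(norm z)\<^sup>2 = Re (hdot z z)"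
  by (simp add: hdot_self)

lemma hdot_commute: "hdot u z = cnj (hdot z u)"
  by (simp add: hdot_def mult.commute)

lemma hdot_scaleR [simp]: "hdot (c *\<^sub>R z) u = of_real c * hdot z u" "hdot z (c *\<^sub>R u) = of_real c * hdot z u"
  by (simp_all add: hdot_def sum_distrib_left scaleR_conv_of_real [where 'a = complex] mult_ac)

lemma outer_mult_vec: "outer z u *v v = hdot u v *s z"
  by (simp add: vec_eq_iff matrix_vector_mult_def hdot_def sum_distrib_left mult_ac)

lemma outer_scaleR: "outer (c *\<^sub>R z) (d *\<^sub>R u) = (c * d) *\<^sub>R outer z u"
  by (simp add: vec_eq_iff scaleR_conv_of_real [where 'a = complex] mult_ac)

lemma ccross_scaleR: "ccross (c *\<^sub>R z) (d *\<^sub>R u) = (c * d) *\<^sub>R ccross z u"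
  by (simp add: vec_eq_iff forall_3 scaleR_conv_of_real [where 'a = complex] algebra_simps)

lemma outer_conjugate: "g ** outer z u ** dag g = outer (g *v z) (g *v u)"
  by (simp add: vec_eq_iff forall_3 matrix_matrix_mult_def matrix_vector_mult_def sum_3 algebra_simps)

lemma hdot_ccross [simp]: "hdot z (ccross z u) = 0" "hdot u (ccross z u) = 0"
  by (simp_all add: hdot_def sum_3 algebra_simps)

text \<open>Lagrange's identity in Hermitian form.\<close>

lemma hdot_ccross_self:
  "hdot (ccross z u) (ccross z u) = hdot z z * hdot u u - hdot z u * cnj (hdot z u)"
  by (simp add: hdot_def sum_3 algebra_simps)

lemma norm_ccross:
  assumes "hdot z u = 0"
  shows "norm (ccross z u) = norm z * norm u"
proof -
  have "complex_of_real ((norm (ccross z u))\<^sup>2) = of_real ((norm z * norm u)\<^sup>2)"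
    using hdot_ccross_self [of z u] assms by (simp only: hdot_self power_mult_distrib) simp
  then have "(norm (ccross z u))\<^sup>2 = (norm z * norm u)\<^sup>2"
    using of_real_eq_iff by blast
  then show ?thesis by simp
qed

text \<open>A nonzero vector is not proportional to both of two coordinate vectors.\<close>

lemma exists_ccross_nonzero:
  assumes "c \<noteq> 0"
  shows "\<exists>b. ccross c b \<noteq> 0"
proof -
  have "ccross c (unit_vec 1) \<noteq> 0 \<or> ccross c (unit_vec 2) \<noteq> 0"
    using assms by (auto simp: vec_eq_iff forall_3 axis_def)
  then show ?thesis by blast
qed

section \<open>SU(3) and its orthonormal frames\<close>

lemma carrier_SU3: "g \<in> carrier SU3 \<longleftrightarrow> unitary g \<and> det g = 1"
  by (simp add: SU3_def matrix_group_def)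

lemma det_dag_3: "det (dag (A :: complex^3^3)) = cnj (det A)"
  by (simp add: det_3 mult_ac)

interpretation SU3: unitary_group "carrier SU3"
  rewrites "matrix_group (carrier SU3) = SU3"
proof -
  show "unitary_group (carrier SU3)"
    by unfold_locales (auto simp: carrier_SU3 unitary_mult unitary_dag det_mul det_dag_3)
qed (simp add: SU3_def matrix_group_def)

lemma hdot_unitary:
  assumes "unitary g"
  shows "hdot (g *v z) (g *v u) = hdot z u"
proof -
  have "hdot (g *v z) v = hdot z (dag g *v v)" for v
    by (simp add: hdot_def matrix_vector_mult_def sum_3 algebra_simps)
  then have "hdot (g *v z) (g *v u) = hdot z (dag g *v (g *v u))" .
  also have "dag g *v (g *v u) = u"
    using assms by (simp add: matrix_vector_mul_assoc unitary_iff)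
  finally show ?thesis .
qed

lemma norm_unitary: "unitary (g :: complex^3^3) \<Longrightarrow> norm (g *v z) = norm z"
  using hdot_unitary [of g z z] by (metis norm_eq_hdot norm_ge_zero power2_eq_imp_eq)

text \<open>The cofactor identity: the transpose of g maps the cross product of g z and g u to det g
  times the cross product of z and u. Conjugating turns the transpose into \<open>dag g\<close>, the
  inverse of g.\<close>

lemma ccross_SU3:
  assumes "g \<in> carrier SU3"
  shows "ccross (g *v z) (g *v u) = g *v ccross z u"
proof -
  have "dag g *v ccross (g *v z) (g *v u) = cnj (det g) *s ccross z u"
    by (simp add: vec_eq_iff forall_3 matrix_vector_mult_def sum_3 det_3 algebra_simps)
  then have "dag g *v ccross (g *v z) (g *v u) = ccross z u"
    using assms by (simp add: carrier_SU3)
  then have "(g ** dag g) *v ccross (g *v z) (g *v u) = g *v ccross z u"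
    by (simp only: matrix_vector_mul_assoc [symmetric])
  then show ?thesis using assms by (simp add: SU3.right_inverse)
qed

text \<open>The middle column completes an orthonormal pair to a matrix of determinant 1; its
  argument order follows \<open>ccross (unit_vec 3) (unit_vec 1) = unit_vec 2\<close>.\<close>

definition frame :: "complex^3 \<Rightarrow> complex^3 \<Rightarrow> complex^3^3" where
  "frame a c = (\<chi> i. vector [a $ i, ccross c a $ i, c $ i])"

lemma smooth_map_frame [smooth_intros]:
  "smooth_map W f \<Longrightarrow> smooth_map W g \<Longrightarrow> smooth_map W (\<lambda>x. frame (f x) (g x))"
  unfolding frame_def by (intro smooth_intros)

lemma frame_unit_vec [simp]:
  "frame a c *v unit_vec 1 = a" "frame a c *v unit_vec 2 = ccross c a" "frame a c *v unit_vec 3 = c"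
  by (simp_all add: vec_eq_iff frame_def matrix_vector_mult_def sum_3 axis_def)

lemma frame_SU3:
  assumes "hdot a a = 1" "hdot c c = 1" "hdot c a = 0"
  shows "frame a c \<in> carrier SU3"
proof -
  let ?b = "ccross c a"
  have b: "hdot ?b ?b = 1" using hdot_ccross_self [of c a] assms by simp
  have o: "hdot a c = 0" using assms(3) hdot_commute [of a c] by simp
  have o': "hdot ?b a = 0" "hdot ?b c = 0"
    using hdot_commute [of ?b a] hdot_commute [of ?b c] by simp_all
  \<comment> \<open>Expansion along the middle column, whose cofactors are the conjugates of its
    entries.\<close>
  have "det (frame a c) = hdot ?b ?b"
    by (simp add: det_3 frame_def hdot_def sum_3 algebra_simps)
  moreover have "dag (frame a c) ** frame a c =
      (\<chi> i j. hdot (frame a c *v unit_vec i) (frame a c *v unit_vec j))"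
    by (simp add: vec_eq_iff matrix_matrix_mult_def matrix_vector_mult_def hdot_def axis_def
        if_distrib [of "\<lambda>x. _ * x"] cong: if_cong)
  then have "unitary (frame a c)"
    using assms b o o' by (simp add: unitary_iff vec_eq_iff forall_3 mat_def)
  ultimately show ?thesis using b by (simp add: carrier_SU3)
qed

definition normalize_vec :: "complex^3 \<Rightarrow> complex^3" where
  "normalize_vec z = inverse (norm z) *\<^sub>R z"

lemma smooth_map_normalize_vec [smooth_intros]:
  assumes "smooth_map W f" "\<And>x. x \<in> W \<Longrightarrow> f x \<noteq> 0"
  shows "smooth_map W (\<lambda>x. normalize_vec (f x))"
  unfolding normalize_vec_def by (intro smooth_intros assms) (use assms in auto)

lemma hdot_normalize_vec: "z \<noteq> 0 \<Longrightarrow> hdot (normalize_vec z) (normalize_vec z) = 1"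
  by (simp add: normalize_vec_def hdot_self)

lemma frame_normalize_SU3:
  assumes "a \<noteq> 0" "c \<noteq> 0" "hdot c a = 0"
  shows "frame (normalize_vec a) (normalize_vec c) \<in> carrier SU3"
  by (rule frame_SU3) (use assms in \<open>simp_all add: hdot_normalize_vec, simp add: normalize_vec_def\<close>)

lemma exists_SU3_third_column:
  assumes "hdot c c = 1"
  shows "\<exists>g\<in>carrier SU3. g *v unit_vec 3 = c"
proof -
  have c: "c \<noteq> 0" using assms by (auto simp: hdot_def)
  then obtain b where "ccross c b \<noteq> 0" using exists_ccross_nonzero by blast
  then have "frame (normalize_vec (ccross c b)) c \<in> carrier SU3"
    by (intro frame_SU3) (use assms in \<open>simp_all add: hdot_normalize_vec, simp add: normalize_vec_def\<close>)
  then show ?thesis by (intro bexI [of _ "frame (normalize_vec (ccross c b)) c"]) auto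
qed

section \<open>A Euclidean model of the quaternionic projective plane\<close>

text \<open>
  A quaternionic line in \<open>\<bbbH>\<^sup>3 = \<complex>\<^sup>3 \<oplus> \<complex>\<^sup>3\<close> with unit basis vector \<open>(z, cnj u)\<close> is represented by the
  invariants of the pair \<open>(z, u)\<close> under \<open>Sp(1) = SU(2)\<close>.
\<close>

definition line_point :: "complex^3 \<Rightarrow> complex^3 \<Rightarrow> (complex^3^3) \<times> (complex^3)" where
  "line_point z u = (outer z z + outer u u, ccross z u)"

definition HP2_model :: "((complex^3^3) \<times> (complex^3)) set" where
  "HP2_model = {line_point z u | z u. hdot z z + hdot u u = 1}"

definition act :: "complex^3^3 \<Rightarrow> (complex^3^3) \<times> (complex^3) \<Rightarrow> (complex^3^3) \<times> (complex^3)" where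
  "act g y = (g ** fst y ** dag g, g *v snd y)"

lemma smooth_map_act [smooth_intros]:
  "smooth_map W f \<Longrightarrow> smooth_map W h \<Longrightarrow> smooth_map W (\<lambda>x. act (f x) (h x))"
  unfolding act_def by (intro smooth_intros)

lemma smooth_map_line_point [smooth_intros]:
  "smooth_map W f \<Longrightarrow> smooth_map W h \<Longrightarrow> smooth_map W (\<lambda>x. line_point (f x) (h x))"
  unfolding line_point_def by (intro smooth_intros)

lemma act_mult: "act (g ** h) y = act g (act h y)"
  by (simp add: act_def dag_mult matrix_mul_assoc matrix_vector_mul_assoc)

lemma act_one [simp]: "act (mat 1) y = y"
  by (simp add: act_def)

lemma act_cancel:
  "g \<in> carrier SU3 \<Longrightarrow> act (dag g) (act g y) = y" "g \<in> carrier SU3 \<Longrightarrow> act g (act (dag g) y) = y"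
  by (simp_all add: act_mult [symmetric] SU3.left_inverse SU3.right_inverse)

lemma act_eq_iff:
  assumes "g \<in> carrier SU3"
  shows "act g x = y \<longleftrightarrow> x = act (dag g) y"
  using act_cancel [OF assms] by metis

lemma act_line_point:
  "g \<in> carrier SU3 \<Longrightarrow> act g (line_point z u) = line_point (g *v z) (g *v u)"
  by (simp add: act_def line_point_def ccross_SU3 matrix_distribs outer_conjugate)

lemma norm_snd_act: "g \<in> carrier SU3 \<Longrightarrow> norm (snd (act g y)) = norm (snd y)"
  by (simp add: act_def norm_unitary SU3.unitary)

lemma act_HP2_model:
  assumes "g \<in> carrier SU3" "y \<in> HP2_model"
  shows "act g y \<in> HP2_model"
proof -
  obtain z u where "y = line_point z u" "hdot z z + hdot u u = 1"
    using assms(2) by (auto simp: HP2_model_def)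
  then show ?thesis
    using assms(1) unfolding HP2_model_def
    by (auto simp: act_line_point hdot_unitary SU3.unitary intro!: exI)
qed

text \<open>The normalization of the pair becomes a condition on the point alone, so it passes to
  every other representative.\<close>

lemma line_point_trace: "hdot z z + hdot u u = (\<Sum>i\<in>UNIV. fst (line_point z u) $ i $ i)"
  by (simp add: line_point_def hdot_def sum.distrib mult.commute)

text \<open>The coefficient matrix is a quaternion of squared norm \<open>?n\<close>; this is its
  determinant as well as the scalar by which it multiplies Hermitian products. Hence both invariants
  are multiplied by \<open>?n\<close>.\<close>

lemma line_point_rotate:
  assumes "\<alpha> * cnj \<alpha> + \<beta> * cnj \<beta> = 1"
  shows "line_point (\<alpha> *s z + \<beta> *s u) (- cnj \<beta> *s z + cnj \<alpha> *s u) = line_point z u"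
proof -
  let ?n = "\<alpha> * cnj \<alpha> + \<beta> * cnj \<beta>"
  have "outer (\<alpha> *s z + \<beta> *s u) (\<alpha> *s z + \<beta> *s u) +
      outer (- cnj \<beta> *s z + cnj \<alpha> *s u) (- cnj \<beta> *s z + cnj \<alpha> *s u) =
      (\<chi> i j. ?n * (outer z z + outer u u) $ i $ j)"
    by (simp add: vec_eq_iff algebra_simps)
  moreover have "ccross (\<alpha> *s z + \<beta> *s u) (- cnj \<beta> *s z + cnj \<alpha> *s u) = ?n *s ccross z u"
    by (simp add: vec_eq_iff forall_3 algebra_simps)
  ultimately show ?thesis
    unfolding assms line_point_def by (simp add: vec_eq_iff)
qed

lemma line_point_swap: "line_point u (- z) = line_point z u"
  using line_point_rotate [of 0 1 z u] by simp

text \<open>Diagonalization of the Gram matrix of \<open>(z, u)\<close> by an element of \<open>SU(2)\<close>.\<close>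

lemma line_point_orthogonal:
  obtains z' u' where "line_point z' u' = line_point z u" "hdot z' u' = 0" "norm u' \<le> norm z'"
proof -
  define q where "q = hdot z u"
  obtain \<alpha> \<beta> where n: "\<alpha> * cnj \<alpha> + \<beta> * cnj \<beta> = 1"
    and e: "- cnj \<alpha> * cnj \<beta> * hdot z z + (cnj \<alpha>)\<^sup>2 * q - (cnj \<beta>)\<^sup>2 * cnj q + cnj \<alpha> * cnj \<beta> * hdot u u = 0"
  proof (cases "q = 0")
    case True
    then show ?thesis using that [of 1 0] by simp
  next
    case False
    \<comment> \<open>With \<alpha> = x \<beta> and \<beta> real, orthogonality becomes the
      conjugate of \<open>cnj q * x\<^sup>2 - d * x - q = 0\<close>. Its discriminant
      \<open>d\<^sup>2 + 4 * (cmod q)\<^sup>2\<close> is nonnegative, so a real square root is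
      enough.\<close>
    define d where "d = (norm z)\<^sup>2 - (norm u)\<^sup>2"
    define s where "s = sqrt (d\<^sup>2 + 4 * (cmod q)\<^sup>2)"
    define x where "x = complex_of_real (d + s) / (2 * cnj q)"
    define N where "N = sqrt ((cmod x)\<^sup>2 + 1)"
    have "s\<^sup>2 = d\<^sup>2 + 4 * (cmod q)\<^sup>2" by (simp add: s_def)
    then have s: "(complex_of_real s)\<^sup>2 = (complex_of_real d)\<^sup>2 + 4 * (q * cnj q)"
      by (simp only: of_real_power [symmetric] complex_norm_square [symmetric]) simp
    have x': "2 * (cnj q * x) = d + s" using False by (simp add: x_def)
    have "4 * cnj q * (cnj q * x\<^sup>2 - d * x - q) = (2 * (cnj q * x))\<^sup>2 - 2 * d * (2 * (cnj q * x)) - 4 * (q * cnj q)"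
      by (simp add: algebra_simps power2_eq_square)
    also have "\<dots> = 0"
      unfolding x' using s by (simp add: algebra_simps power2_eq_square)
    finally have "cnj q * x\<^sup>2 - d * x - q = 0" using False by simp
    then have "cnj (cnj q * x\<^sup>2 - d * x - q) = 0" by simp
    then have x: "q * (cnj x)\<^sup>2 - d * cnj x - cnj q = 0" by simp
    have N: "N > 0" "N\<^sup>2 = (cmod x)\<^sup>2 + 1" by (simp_all add: N_def add_pos_nonneg add_nonneg_pos)
    then have N': "(complex_of_real N)\<^sup>2 = x * cnj x + 1" "complex_of_real N \<noteq> 0"
      by (simp_all only: of_real_power [symmetric] complex_norm_square [symmetric]) simp_all
    show ?thesis
    proof (rule that [of "x / complex_of_real N" "1 / complex_of_real N"])
      show "x / complex_of_real N * cnj (x / complex_of_real N) +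
          1 / complex_of_real N * cnj (1 / complex_of_real N) = 1"
        unfolding complex_cnj_divide complex_cnj_one complex_cnj_complex_of_real times_divide_times_eq
          add_divide_distrib [symmetric] mult_1 N'(1) [symmetric] using N'(2)
        by (simp add: power2_eq_square)
      have "d = hdot z z - hdot u u" by (simp add: d_def hdot_self)
      then have "- cnj x * hdot z z + (cnj x)\<^sup>2 * q - cnj q + cnj x * hdot u u = 0"
        using x by (simp add: \<open>complex_of_real d = _\<close> algebra_simps)
      moreover have "- cnj (x / complex_of_real N) * cnj (1 / complex_of_real N) * hdot z z +
          (cnj (x / complex_of_real N))\<^sup>2 * q - (cnj (1 / complex_of_real N))\<^sup>2 * cnj q +
          cnj (x / complex_of_real N) * cnj (1 / complex_of_real N) * hdot u u =
          (- cnj x * hdot z z + (cnj x)\<^sup>2 * q - cnj q + cnj x * hdot u u) / (complex_of_real N)\<^sup>2"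
        using N'(2) by (simp add: field_simps power2_eq_square)
      ultimately show "- cnj (x / complex_of_real N) * cnj (1 / complex_of_real N) * hdot z z +
          (cnj (x / complex_of_real N))\<^sup>2 * q - (cnj (1 / complex_of_real N))\<^sup>2 * cnj q +
          cnj (x / complex_of_real N) * cnj (1 / complex_of_real N) * hdot u u = 0"
        by (simp only: div_0)
    qed
  qed
  define z' u' where "z' = \<alpha> *s z + \<beta> *s u" and "u' = - cnj \<beta> *s z + cnj \<alpha> *s u"
  have p: "line_point z' u' = line_point z u"
    unfolding z'_def u'_def by (rule line_point_rotate [OF n])
  have "hdot z' u' = - cnj \<alpha> * cnj \<beta> * hdot z z + (cnj \<alpha>)\<^sup>2 * hdot z u - (cnj \<beta>)\<^sup>2 * hdot u z
      + cnj \<alpha> * cnj \<beta> * hdot u u"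
    by (simp add: z'_def u'_def hdot_def sum_3 algebra_simps power2_eq_square)
  then have o: "hdot z' u' = 0" using e by (simp add: q_def hdot_commute [of u z])
  show ?thesis
  proof (cases "norm u' \<le> norm z'")
    case True
    then show ?thesis using that p o by blast
  next
    \<comment> \<open>Exchanging the two vectors up to a sign is itself an element of SU(2) and
      restores the order of the norms.\<close>
    case False
    have "hdot u' (- z') = - hdot u' z'" by (simp add: hdot_def sum_negf)
    then show ?thesis
      using that [of u' "- z'"] p o False line_point_swap hdot_commute [of u' z'] by simp
  qed
qed

section \<open>Normal forms of points and the spectral projection\<close>

definition top_eigenvalue :: "real \<Rightarrow> real" where
  "top_eigenvalue r = (1 + sqrt (1 - 4 * r\<^sup>2)) / 2"

text \<open>The top eigenvector is placed at \<open>unit_vec 3\<close> so that the isotropy group at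
  \<open>r = 0\<close> is \<open>U2\<close> itself; w is then parallel to
  \<open>ccross (unit_vec 3) (unit_vec 1)\<close>.\<close>

definition normal_form :: "real \<Rightarrow> (complex^3^3) \<times> (complex^3)" where
  "normal_form r = (top_eigenvalue r *\<^sub>R outer (unit_vec 3) (unit_vec 3) +
     (1 - top_eigenvalue r) *\<^sub>R outer (unit_vec 1) (unit_vec 1), r *\<^sub>R unit_vec 2)"

lemma top_eigenvalue:
  assumes "0 \<le> r" "r \<le> 1 / 2"
  shows "top_eigenvalue r * (1 - top_eigenvalue r) = r\<^sup>2" "1 / 2 \<le> top_eigenvalue r" "top_eigenvalue r \<le> 1"
proof -
  have "r\<^sup>2 \<le> (1/2)\<^sup>2" using assms by (intro power_mono) auto
  then have "0 \<le> 1 - 4 * r\<^sup>2" by (simp add: power2_eq_square)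
  then have "(sqrt (1 - 4 * r\<^sup>2))\<^sup>2 = 1 - 4 * r\<^sup>2" "0 \<le> sqrt (1 - 4 * r\<^sup>2)" "sqrt (1 - 4 * r\<^sup>2) \<le> 1" by simp_all
  then show "top_eigenvalue r * (1 - top_eigenvalue r) = r\<^sup>2" "1 / 2 \<le> top_eigenvalue r" "top_eigenvalue r \<le> 1"
    by (simp_all add: top_eigenvalue_def field_simps power2_eq_square)
qed

lemma top_eigenvalue_strict:
  assumes "0 \<le> r" "r < 1 / 2"
  shows "1 / 2 < top_eigenvalue r"
proof -
  have "r\<^sup>2 < (1/2)\<^sup>2" using assms by (intro power_strict_mono) auto
  then show ?thesis by (simp add: top_eigenvalue_def power2_eq_square)
qed

lemma top_eigenvalue_values [simp]: "top_eigenvalue 0 = 1" "top_eigenvalue (1 / 2) = 1 / 2"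
  by (simp_all add: top_eigenvalue_def power2_eq_square)

lemma top_eigenvalue_unique:
  assumes "1 / 2 \<le> l" "l * (1 - l) = r\<^sup>2"
  shows "top_eigenvalue r = l"
proof -
  have "1 - 4 * r\<^sup>2 = (2 * l - 1)\<^sup>2"
    unfolding assms(2) [symmetric] by (simp add: power2_eq_square algebra_simps)
  then show ?thesis
    using assms(1) by (simp add: top_eigenvalue_def)
qed

lemma hdot_unit_vec [simp]: "hdot (unit_vec i) (unit_vec j) = (if i = j then 1 else 0)"
  by (simp add: hdot_def axis_def if_distrib [of "\<lambda>x. _ * x"] cong: if_cong)

lemma ccross_unit_vec [simp]:
  "ccross (unit_vec 1) (unit_vec 2) = unit_vec 3" "ccross (unit_vec 2) (unit_vec 3) = unit_vec 1"
  "ccross (unit_vec 3) (unit_vec 1) = unit_vec 2"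
  by (simp_all add: vec_eq_iff forall_3 axis_def)

lemma norm_snd_normal_form: "0 \<le> r \<Longrightarrow> norm (snd (normal_form r)) = r"
  by (simp add: normal_form_def norm_axis_1)

text \<open>\<open>x\<close> and \<open>y\<close> are the lengths of two orthogonal vectors;
  \<open>y \<le> x\<close> singles out \<open>x\<^sup>2\<close> as the larger root of
  \<open>l * (1 - l) = (x * y)\<^sup>2\<close>.\<close>

lemma line_point_normal_form:
  assumes "x\<^sup>2 + y\<^sup>2 = 1" "0 \<le> y" "y \<le> x"
  shows "line_point (x *\<^sub>R unit_vec 3) (y *\<^sub>R unit_vec 1) = normal_form (x * y)"
proof -
  have "y\<^sup>2 \<le> x\<^sup>2" using assms by (intro power_mono) auto
  then have "1 / 2 \<le> x\<^sup>2" using assms(1) by linarith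
  moreover have e: "1 - x\<^sup>2 = y\<^sup>2" using assms by simp
  ultimately have t: "top_eigenvalue (x * y) = x\<^sup>2"
    using assms by (intro top_eigenvalue_unique) (auto simp: power_mult_distrib)
  show ?thesis
    unfolding line_point_def normal_form_def outer_scaleR ccross_scaleR t e by (simp add: power2_eq_square)
qed

lemma normal_form_in_HP2_model:
  assumes "0 \<le> r" "r \<le> 1 / 2"
  shows "normal_form r \<in> HP2_model"
proof -
  define l where "l = top_eigenvalue r"
  have l: "1/2 \<le> l" "l \<le> 1" "l * (1 - l) = r\<^sup>2" using top_eigenvalue [OF assms] by (simp_all add: l_def)
  have "sqrt l * sqrt (1 - l) = sqrt (r\<^sup>2)"
    by (simp add: l(3) [symmetric] real_sqrt_mult)
  then have "normal_form r = line_point (sqrt l *\<^sub>R unit_vec 3) (sqrt (1 - l) *\<^sub>R unit_vec 1)"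
    using l assms by (subst line_point_normal_form) auto
  moreover have "hdot (sqrt l *\<^sub>R unit_vec 3) (sqrt l *\<^sub>R unit_vec 3) +
      hdot (sqrt (1 - l) *\<^sub>R unit_vec 1) (sqrt (1 - l) *\<^sub>R unit_vec 1) = 1"
    using l by (simp flip: of_real_mult)
  ultimately show ?thesis unfolding HP2_model_def by blast
qed

text \<open>An orthogonal representative diagonalizes P: the directions of \<open>z\<close> and
  \<open>u\<close> become the third and first columns of a frame, and their lengths are the square
  roots of the eigenvalues.\<close>

theorem HP2_model_normal_form:
  assumes "y \<in> HP2_model"
  obtains g r where "g \<in> carrier SU3" "0 \<le> r" "r \<le> 1 / 2" "y = act g (normal_form r)"
proof -
  obtain z0 u0 where y0: "y = line_point z0 u0" "hdot z0 z0 + hdot u0 u0 = 1"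
    using assms by (auto simp: HP2_model_def)
  obtain z u where zu: "line_point z u = y" "hdot z u = 0" "norm u \<le> norm z"
    using line_point_orthogonal y0(1) by metis
  have "hdot z z + hdot u u = 1"
    using y0 zu(1) by (simp add: line_point_trace)
  then have "complex_of_real ((norm z)\<^sup>2 + (norm u)\<^sup>2) = of_real 1" by (simp add: hdot_self)
  then have n: "(norm z)\<^sup>2 + (norm u)\<^sup>2 = 1" using of_real_eq_iff by blast
  then have z: "z \<noteq> 0" using zu(3) by auto
  define c where "c = normalize_vec z"
  have c: "hdot c c = 1" "norm z *\<^sub>R c = z"
    using z hdot_normalize_vec by (auto simp: c_def normalize_vec_def)
  obtain a where a: "hdot a a = 1" "hdot c a = 0" "norm u *\<^sub>R a = u"
  proof (cases "u = 0")
    case True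
    \<comment> \<open>For \<open>u = 0\<close> the direction is arbitrary; the first column of any
      special unitary matrix with third column \<open>c\<close> will do.\<close>
    obtain g where "g \<in> carrier SU3" "g *v unit_vec 3 = c" using exists_SU3_third_column [OF c(1)] by blast
    then show ?thesis
      using that [of "g *v unit_vec 1"] True hdot_unitary [of g "unit_vec 3" "unit_vec 1"]
        hdot_unitary [of g "unit_vec 1" "unit_vec 1"] SU3.unitary by simp
  next
    case False
    then show ?thesis
      using that [of "normalize_vec u"] zu(2) hdot_normalize_vec by (simp add: c_def normalize_vec_def)
  qed
  have g: "frame a c \<in> carrier SU3" using a c by (intro frame_SU3)
  have "y = act (frame a c) (line_point (norm z *\<^sub>R unit_vec 3) (norm u *\<^sub>R unit_vec 1))"
    using zu(1) a c by (simp add: act_line_point [OF g] matrix_vector_scaleR_right)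
  also have "\<dots> = act (frame a c) (normal_form (norm z * norm u))"
    using n zu(3) by (subst line_point_normal_form) auto
  finally show ?thesis
  proof (rule that [OF g, rotated 2])
    \<comment> \<open>The arithmetic-geometric mean inequality for the squared lengths, whose sum is
      1.\<close>
    have "0 \<le> (norm z - norm u)\<^sup>2" by simp
    then show "norm z * norm u \<le> 1 / 2" using n by (simp add: power2_diff)
  qed simp
qed

corollary HP2_model_normal_form_norm:
  assumes "y \<in> HP2_model"
  obtains g where "g \<in> carrier SU3" "y = act g (normal_form (norm (snd y)))" "norm (snd y) \<le> 1 / 2"
  using HP2_model_normal_form [OF assms] norm_snd_act norm_snd_normal_form by metis

lemma normal_form_orbit:
  assumes "0 \<le> r" "r \<le> 1 / 2"
  shows "(\<lambda>g. act g (normal_form r)) ` carrier SU3 = {y \<in> HP2_model. norm (snd y) = r}"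
proof (intro equalityI subsetI)
  fix y assume "y \<in> {y \<in> HP2_model. norm (snd y) = r}"
  then show "y \<in> (\<lambda>g. act g (normal_form r)) ` carrier SU3"
    using HP2_model_normal_form_norm by blast
qed (use assms in \<open>auto simp: act_HP2_model normal_form_in_HP2_model norm_snd_act norm_snd_normal_form\<close>)

text \<open>P has the eigenvalues l, 1 - l and 0, where l is known from |w|. The polynomial
  \<open>P ** P - (1 - l) *\<^sub>R P\<close> takes the values l (2 l - 1), 0 and 0 on them, which
  yields the spectral projection of the top eigenvalue.\<close>

definition top_projection :: "(complex^3^3) \<times> (complex^3) \<Rightarrow> complex^3^3" where
  "top_projection y = (let l = top_eigenvalue (norm (snd y)) in
     inverse (l * (2 * l - 1)) *\<^sub>R (fst y ** fst y - (1 - l) *\<^sub>R fst y))"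

lemma smooth_map_top_projection:
  assumes "open W" "\<And>y. y \<in> W \<Longrightarrow> norm (snd y) < 1 / 2"
  shows "smooth_map W top_projection"
proof -
  have "1 / 2 < top_eigenvalue (norm (snd y))" "1 - 4 * (norm (snd y))\<^sup>2 > 0" if "y \<in> W" for y
  proof -
    have "(norm (snd y))\<^sup>2 < (1/2)\<^sup>2" using assms(2) [OF that] by (intro power_strict_mono) auto
    then show "1 - 4 * (norm (snd y))\<^sup>2 > 0" by (simp add: power2_eq_square)
    show "1 / 2 < top_eigenvalue (norm (snd y))"
      by (rule top_eigenvalue_strict) (use assms(2) [OF that] in auto)
  qed
  note l = this
  \<comment> \<open>Only the square of the norm enters \<open>top_eigenvalue\<close>, so there is no
    singularity at w = 0.\<close>
  have "smooth_map W (\<lambda>y :: (complex^3^3) \<times> (complex^3). top_eigenvalue (norm (snd y)))"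
    unfolding top_eigenvalue_def by (intro smooth_intros assms(1)) (use l(2) in auto)
  then show ?thesis
    unfolding top_projection_def Let_def
    by (intro smooth_intros assms(1)) (use l(1) in fastforce)+
qed

lemma top_projection_act:
  assumes "g \<in> carrier SU3"
  shows "top_projection (act g y) = g ** top_projection y ** dag g"
proof -
  have "(g ** A ** dag g) ** (g ** B ** dag g) = g ** (A ** B) ** dag g" for A B
    by (metis SU3.cancel(1) assms matrix_mul_assoc)
  then show ?thesis
    unfolding top_projection_def norm_snd_act [OF assms] Let_def
    by (simp add: act_def matrix_distribs)
qed

lemma top_projection_normal_form:
  assumes "0 \<le> r" "r < 1 / 2"
  shows "top_projection (normal_form r) = outer (unit_vec 3) (unit_vec 3)"
proof -
  define l where "l = top_eigenvalue r"
  have l: "1 / 2 < l" using top_eigenvalue_strict [OF assms] by (simp add: l_def)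
  have "fst (normal_form r) ** fst (normal_form r) - (1 - l) *\<^sub>R fst (normal_form r) =
      (l * (2 * l - 1)) *\<^sub>R outer (unit_vec 3) (unit_vec 3)"
    by (simp add: normal_form_def l_def [symmetric] vec_eq_iff forall_3 matrix_matrix_mult_def sum_3 axis_def
        scaleR_conv_of_real [where 'a = complex] algebra_simps)
  then show ?thesis
    using l assms unfolding top_projection_def norm_snd_normal_form [OF assms(1)] l_def [symmetric] Let_def
    by (simp del: inverse_mult_distrib)
qed

lemma top_projection_act_normal_form:
  assumes "g \<in> carrier SU3" "0 \<le> r" "r < 1 / 2"
  shows "top_projection (act g (normal_form r)) = outer (g *v unit_vec 3) (g *v unit_vec 3)"
  using assms by (simp add: top_projection_act top_projection_normal_form outer_conjugate)

section \<open>Homogeneous spaces as subsets of Euclidean spaces\<close>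

text \<open>The quotient criterion for cosets. The sections are smooth on an open set of the ambient
  space, but have to take values in \<open>S\<close> only over \<open>Y\<close>.\<close>

lemma (in unitary_subgroup) homogeneous_space_model:
  fixes \<Phi> :: "complex^'n^'n \<Rightarrow> 'f::euclidean_space"
  assumes smooth: "smooth_map UNIV \<Phi>" and into: "\<And>g. g \<in> S \<Longrightarrow> \<Phi> g \<in> Y"
    and fibres: "\<And>g g'. g \<in> S \<Longrightarrow> g' \<in> S \<Longrightarrow> \<Phi> g = \<Phi> g' \<Longrightarrow> dag g ** g' \<in> H"
    and invariant: "\<And>g h. g \<in> S \<Longrightarrow> h \<in> H \<Longrightarrow> \<Phi> (g ** h) = \<Phi> g"
    and sections: "\<And>y. y \<in> Y \<Longrightarrow>
      \<exists>W s. y \<in> W \<and> smooth_map W s \<and> (\<forall>y'\<in>W \<inter> Y. s y' \<in> S \<and> \<Phi> (s y') = y')"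
  obtains \<psi> where
    "diffeomorphism (homogeneous_space (matrix_group S) H) (euclidean_subset Y) \<psi>"
    "\<And>g. g \<in> S \<Longrightarrow> \<psi> (g <#\<^bsub>matrix_group S\<^esub> H) = \<Phi> g"
proof
  \<comment> \<open>Any representative may be chosen, because \<Phi> is constant on cosets.\<close>
  let ?\<psi> = "\<lambda>C. \<Phi> (SOME g. g \<in> C)"
  show \<psi>: "?\<psi> (g <#\<^bsub>matrix_group S\<^esub> H) = \<Phi> g" if "g \<in> S" for g
  proof -
    have "g \<in> g <#\<^bsub>matrix_group S\<^esub> H"
      unfolding l_coset using sub.one by (intro image_eqI [of _ _ "mat 1"]) auto
    then have "(SOME g'. g' \<in> g <#\<^bsub>matrix_group S\<^esub> H) \<in> g <#\<^bsub>matrix_group S\<^esub> H"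
      by (rule someI)
    then show ?thesis using invariant that by (auto simp: l_coset)
  qed
  show "diffeomorphism (homogeneous_space (matrix_group S) H) (euclidean_subset Y) ?\<psi>"
    unfolding homogeneous_space_def carrier
  proof (rule diffeomorphism_euclidean_quotient [OF smooth])
    show "g <#\<^bsub>matrix_group S\<^esub> H = g' <#\<^bsub>matrix_group S\<^esub> H"
      if "g \<in> S" "g' \<in> S" "\<Phi> g = \<Phi> g'" for g g'
      using that fibres by (intro l_coset_eq)
  qed (use into sections \<psi> in auto)
qed

lemma (in unitary_subgroup) homogeneous_space_equivariant_model:
  fixes \<Phi> :: "complex^'n^'n \<Rightarrow> 'f::euclidean_space"
  assumes "smooth_map UNIV \<Phi>" "\<And>g. g \<in> S \<Longrightarrow> \<Phi> g \<in> Y"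
    and "\<And>g g'. g \<in> S \<Longrightarrow> g' \<in> S \<Longrightarrow> \<Phi> g = \<Phi> g' \<Longrightarrow> dag g ** g' \<in> H"
    and "\<And>g h. g \<in> S \<Longrightarrow> h \<in> H \<Longrightarrow> \<Phi> (g ** h) = \<Phi> g"
    and "\<And>y. y \<in> Y \<Longrightarrow>
      \<exists>W s. y \<in> W \<and> smooth_map W s \<and> (\<forall>y'\<in>W \<inter> Y. s y' \<in> S \<and> \<Phi> (s y') = y')"
    and equivariant: "\<And>g h. g \<in> S \<Longrightarrow> h \<in> S \<Longrightarrow> \<Phi> (g ** h) = b g (\<Phi> h)"
  obtains \<psi> where
    "equivariant_diffeomorphism (matrix_group S)
       (homogeneous_space (matrix_group S) H) (coset_action (matrix_group S)) (euclidean_subset Y) b \<psi>"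
proof (rule homogeneous_space_model [OF assms(1-5)])
  fix \<psi>
  assume d: "diffeomorphism (homogeneous_space (matrix_group S) H) (euclidean_subset Y) \<psi>"
    and \<psi>: "\<And>g. g \<in> S \<Longrightarrow> \<psi> (g <#\<^bsub>matrix_group S\<^esub> H) = \<Phi> g"
  have "\<psi> (coset_action (matrix_group S) g C) = b g (\<psi> C)"
    if "g \<in> S" "C \<in> points (homogeneous_space (matrix_group S) H)" for g C
    using that equivariant \<psi> mult
    by (auto simp: homogeneous_space_def carrier coset_action_l_coset)
  then show thesis
    using d by (intro that [of \<psi>]) (simp add: equivariant_diffeomorphism_def carrier)
qed (use assms in blast)+

section \<open>The quaternionic projective plane\<close>

type_synonym mat6 = "complex^(3 + 3)^(3 + 3)"

lemma matrix_mult_nth: "(A ** B) $ i $ j = (\<Sum>k\<in>UNIV. A $ i $ k * B $ k $ j)"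
  by (simp add: matrix_matrix_mult_def)

lemma mat_nth: "mat c $ i $ j = (if i = j then c else 0)"
  by (simp add: mat_def)

lemma sum_3_3: "sum f (UNIV :: (3 + 3) set) = (\<Sum>k\<in>UNIV. f (Inl k)) + (\<Sum>k\<in>UNIV. f (Inr k))"
  unfolding UNIV_Plus_UNIV [symmetric] by (subst sum.Plus) auto

lemma mat6_eq_iff:
  "(A :: mat6) = B \<longleftrightarrow> (\<forall>k l. A $ Inl k $ Inl l = B $ Inl k $ Inl l \<and> A $ Inl k $ Inr l = B $ Inl k $ Inr l \<and>
     A $ Inr k $ Inl l = B $ Inr k $ Inl l \<and> A $ Inr k $ Inr l = B $ Inr k $ Inr l)"
  by (auto simp: vec_eq_iff split_sum_all)

text \<open>The matrices of quaternion-linear maps of C^6 = H^3. In contrast to the symplectic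
  condition this one is real linear, so it survives the sums in the reflection formula.\<close>

definition quaternionic :: "mat6 \<Rightarrow> bool" where
  "quaternionic A \<longleftrightarrow> (\<forall>k l. A $ Inr k $ Inr l = cnj (A $ Inl k $ Inl l) \<and>
     A $ Inr k $ Inl l = - cnj (A $ Inl k $ Inr l))"

lemma quaternionic_nth:
  assumes "quaternionic A"
  shows "A $ Inr k $ Inr l = cnj (A $ Inl k $ Inl l)" "A $ Inr k $ Inl l = - cnj (A $ Inl k $ Inr l)"
  using assms by (auto simp: quaternionic_def)

lemma quaternionic_mat: "quaternionic (mat 1)"
  by (simp add: quaternionic_def mat_def)

lemma quaternionic_add: "quaternionic A \<Longrightarrow> quaternionic B \<Longrightarrow> quaternionic (A + B)"
  by (simp add: quaternionic_def)

lemma quaternionic_diff: "quaternionic A \<Longrightarrow> quaternionic B \<Longrightarrow> quaternionic (A - B)"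
  by (simp add: quaternionic_def)

lemma quaternionic_scaleR: "quaternionic A \<Longrightarrow> quaternionic (c *\<^sub>R A)"
  by (simp add: quaternionic_def)

lemma quaternionic_dag: "quaternionic A \<Longrightarrow> quaternionic (dag A)"
  by (simp add: quaternionic_def)

lemma quaternionic_mult: "quaternionic A \<Longrightarrow> quaternionic B \<Longrightarrow> quaternionic (A ** B)"
  unfolding quaternionic_def
  by (simp add: matrix_matrix_mult_def sum_3_3 sum_negf add.commute)

lemmas quaternionic_intros = quaternionic_mat quaternionic_add quaternionic_diff quaternionic_scaleR
  quaternionic_dag quaternionic_mult

text \<open>\<open>C\<close> is the entrywise conjugate of \<open>A\<close>, which for unitary
  \<open>A\<close> is the inverse of \<open>transpose A\<close>. So the symplectic condition says
  that \<open>symplectic_form\<close> intertwines \<open>A\<close> and \<open>C\<close>, and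
  comparing blocks gives \<open>quaternionic A\<close>.\<close>

lemma carrier_Sp3: "A \<in> carrier Sp3 \<longleftrightarrow> unitary A \<and> quaternionic A"
proof -
  define C :: mat6 where "C = transpose (dag A)"
  have q: "symplectic_form ** A = C ** symplectic_form \<longleftrightarrow> quaternionic A"
  proof -
    have "(symplectic_form ** A) $ Inl k $ l = A $ Inr k $ l" "(symplectic_form ** A) $ Inr k $ l = - A $ Inl k $ l"
      "(C ** symplectic_form) $ i $ Inr k = C $ i $ Inl k" "(C ** symplectic_form) $ i $ Inl k = - C $ i $ Inr k"
      for i k l
      by (simp_all add: matrix_matrix_mult_def sum_3_3 symplectic_form_def if_distrib [of "\<lambda>x. x * _"]
          if_distrib [of "\<lambda>x. _ * x"] sum_negf cong: if_cong)
    note entries = this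
    have C: "C $ i $ j = cnj (A $ i $ j)" for i j by (simp add: C_def transpose_def)
    show ?thesis
    proof
      assume e: "symplectic_form ** A = C ** symplectic_form"
      have "A $ Inr k $ Inr l = cnj (A $ Inl k $ Inl l)" "A $ Inr k $ Inl l = - cnj (A $ Inl k $ Inr l)" for k l
        using arg_cong [OF e, of "\<lambda>M. M $ Inl k $ Inr l"] arg_cong [OF e, of "\<lambda>M. M $ Inl k $ Inl l"]
        unfolding entries C .
      then show "quaternionic A" by (simp add: quaternionic_def)
    next
      assume "quaternionic A"
      then show "symplectic_form ** A = C ** symplectic_form"
        by (simp add: mat6_eq_iff entries C quaternionic_nth)
    qed
  qed
  have "transpose A ** symplectic_form ** A = symplectic_form \<longleftrightarrow> symplectic_form ** A = C ** symplectic_form"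
    if "unitary A"
  proof -
    have *: "C ** transpose A = mat 1" "transpose A ** C = mat 1"
      using that unitary_right [OF that]
      by (simp_all add: C_def unitary_iff flip: matrix_transpose_mul)
    show ?thesis
    proof
      assume "transpose A ** symplectic_form ** A = symplectic_form"
      then have "C ** (transpose A ** symplectic_form ** A) = C ** symplectic_form" by simp
      then show "symplectic_form ** A = C ** symplectic_form" by (simp add: matrix_mul_assoc *)
    next
      assume "symplectic_form ** A = C ** symplectic_form"
      then have "transpose A ** (symplectic_form ** A) = transpose A ** (C ** symplectic_form)" by simp
      then show "transpose A ** symplectic_form ** A = symplectic_form" by (simp add: matrix_mul_assoc *)
    qed
  qed
  then show ?thesis
    using q by (auto simp: Sp3_def matrix_group_def)
qed

lemma unitary_group_Sp3: "unitary_group (carrier Sp3)"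
  by unfold_locales (auto simp: carrier_Sp3 quaternionic_intros unitary_mult unitary_dag)

lemma matrix_group_carrier_Sp3: "matrix_group (carrier Sp3) = Sp3"
  by (simp add: Sp3_def matrix_group_def)

text \<open>The projection onto the third quaternionic coordinate. Its centralizer in
  \<open>Sp3\<close> is \<open>Sp2_Sp1\<close>, and its conjugates are the projections onto
  quaternionic lines.\<close>

definition third_line :: mat6 where
  "third_line = (\<chi> i j. if i = j \<and> quaternionic_index i = 3 then 1 else 0)"

lemma third_line_nth [simp]:
  "third_line $ Inl k $ Inl l = (if k = l \<and> k = 3 then 1 else 0)" "third_line $ Inl k $ Inr l = 0"
  "third_line $ Inr k $ Inl l = 0" "third_line $ Inr k $ Inr l = (if k = l \<and> k = 3 then 1 else 0)"
  by (simp_all add: third_line_def quaternionic_index_def)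

lemma third_line_mult:
  "(third_line ** A) $ i $ j = (if quaternionic_index i = 3 then A $ i $ j else 0)"
  "(A ** third_line) $ i $ j = (if quaternionic_index j = 3 then A $ i $ j else 0)"
  by (simp_all add: third_line_def matrix_matrix_mult_def if_distrib [of "\<lambda>x. x * _"]
      if_distrib [of "\<lambda>x. _ * x"] if_conn(1) cong: if_cong conj_cong)

lemma Sp2_Sp1_iff: "A \<in> Sp2_Sp1 \<longleftrightarrow> A \<in> carrier Sp3 \<and> third_line ** A = A ** third_line"
  unfolding Sp2_Sp1_def vec_eq_iff third_line_mult by auto

lemma quaternionic_third_line: "quaternionic third_line"
  by (simp add: quaternionic_def)

lemma third_line_idem: "third_line ** third_line = third_line"
  by (auto simp: mat6_eq_iff third_line_mult quaternionic_index_def)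

lemma dag_third_line: "dag third_line = third_line"
  by (auto simp: vec_eq_iff third_line_def)

lemma unitary_subgroup_Sp2_Sp1: "unitary_subgroup (carrier Sp3) Sp2_Sp1"
proof -
  interpret unitary_group "carrier Sp3" by (rule unitary_group_Sp3)
  have "unitary_group Sp2_Sp1"
  proof
    fix g h assume g: "g \<in> Sp2_Sp1" and h: "h \<in> Sp2_Sp1"
    show "unitary g" using g unitary by (simp add: Sp2_Sp1_iff)
    have "third_line ** (g ** h) = g ** h ** third_line"
    proof -
      have "third_line ** (g ** h) = g ** (third_line ** h)"
        using g by (simp add: Sp2_Sp1_iff matrix_mul_assoc)
      also have "third_line ** h = h ** third_line" using h by (simp add: Sp2_Sp1_iff)
      finally show ?thesis by (simp add: matrix_mul_assoc)
    qed
    then show "g ** h \<in> Sp2_Sp1" using g h mult by (simp add: Sp2_Sp1_iff)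
    have "dag (third_line ** g) = dag (g ** third_line)" using g by (simp add: Sp2_Sp1_iff)
    then have "dag g ** third_line = third_line ** dag g" by (simp add: dag_mult dag_third_line)
    then show "dag g \<in> Sp2_Sp1" using g dag by (simp add: Sp2_Sp1_iff)
  qed (simp add: Sp2_Sp1_iff one)
  then show ?thesis
    by (intro unitary_subgroup.intro unitary_group_Sp3 unitary_subgroup_axioms.intro)
       (auto simp: Sp2_Sp1_iff)
qed

text \<open>The column \<open>Inl 3\<close> of a quaternionic \<open>A\<close> is (z, cnj u) for
  this z and u; the sign comes from the lower left block of a quaternionic matrix.\<close>

definition line_of :: "mat6 \<Rightarrow> (complex^3^3) \<times> (complex^3)" where
  "line_of A = line_point (\<chi> k. A $ Inl k $ Inl 3) (\<chi> k. - A $ Inl k $ Inr 3)"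

text \<open>The orthogonal projection onto the quaternionic line with the given invariants.\<close>

definition line_projection :: "(complex^3^3) \<times> (complex^3) \<Rightarrow> mat6" where
  "line_projection y =
    (let K = vector [vector [0, cnj (snd y $ 3), - cnj (snd y $ 2)],
                     vector [- cnj (snd y $ 3), 0, cnj (snd y $ 1)],
                     vector [cnj (snd y $ 2), - cnj (snd y $ 1), 0]] :: complex^3^3
     in \<chi> i j. case i of
          Inl k \<Rightarrow> (case j of Inl l \<Rightarrow> fst y $ k $ l | Inr l \<Rightarrow> K $ k $ l)
        | Inr k \<Rightarrow> (case j of Inl l \<Rightarrow> - cnj (K $ k $ l) | Inr l \<Rightarrow> cnj (fst y $ k $ l)))"

lemma line_projection_inj:
  assumes "line_projection y = line_projection y'"
  shows "y = y'"
proof -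
  have "line_projection y $ Inl k $ j = line_projection y' $ Inl k $ j" for k j using assms by simp
  from this [of _ "Inl _"] this [of 2 "Inr 3"] this [of 3 "Inr 1"] this [of 1 "Inr 2"]
  show ?thesis
    by (simp add: line_projection_def Let_def prod_eq_iff vec_eq_iff forall_3)
qed

lemma smooth_map_line_projection: "smooth_map UNIV line_projection"
proof -
  have "smooth_map UNIV (\<lambda>y. line_projection y $ i $ j)" for i j
  proof -
    have "smooth_map UNIV (\<lambda>y :: (complex^3^3) \<times> (complex^3).
        (vector [vector [0, cnj (snd y $ 3), - cnj (snd y $ 2)],
                     vector [- cnj (snd y $ 3), 0, cnj (snd y $ 1)],
                     vector [cnj (snd y $ 2), - cnj (snd y $ 1), 0]] :: complex^3^3) $ k $ l)" for k l
      using exhaust_3 [of k] by (elim disjE) (simp_all, (intro smooth_intros open_UNIV)+)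
    then show ?thesis
      by (cases i; cases j)
         (simp_all add: line_projection_def Let_def smooth_map_cnj smooth_map_minus, (intro smooth_intros open_UNIV)+)
  qed
  then have "smooth_map UNIV (\<lambda>y. \<chi> i j. line_projection y $ i $ j)"
    by (intro smooth_map_vec_lambda)
  then show ?thesis by simp
qed

text \<open>The image of the third coordinate line is spanned by (z, cnj u) and its quaternionic
  partner (- u, cnj z). The upper blocks of its projection are therefore P and the antisymmetric
  matrix with entries z_k u_l - u_k z_l.\<close>

lemma line_projection_line_of:
  assumes "quaternionic A"
  shows "A ** third_line ** dag A = line_projection (line_of A)"
  unfolding mat6_eq_iff
  by (simp add: line_projection_def line_of_def line_point_def Let_def matrix_matrix_mult_def [of "A ** third_line"]
      third_line_mult sum_3_3 sum_3 quaternionic_index_def forall_3 quaternionic_nth [OF assms])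

lemma line_of_in_HP2_model:
  assumes "A \<in> carrier Sp3"
  shows "line_of A \<in> HP2_model"
proof -
  have "(dag A ** A) $ Inl 3 $ Inl 3 = 1" using assms by (simp add: carrier_Sp3 unitary_iff mat_def)
  then have "hdot (\<chi> k. A $ Inl k $ Inl 3) (\<chi> k. A $ Inl k $ Inl 3) +
      hdot (\<chi> k. - A $ Inl k $ Inr 3) (\<chi> k. - A $ Inl k $ Inr 3) = 1"
    using assms by (simp add: carrier_Sp3 hdot_def matrix_matrix_mult_def sum_3_3 quaternionic_nth mult.commute)
  then show ?thesis unfolding HP2_model_def line_of_def by blast
qed

section \<open>The embedding of SU(3) in Sp(3)\<close>

lemma SU3_to_Sp3_nth:
  assumes "g \<in> carrier SU3"
  shows "SU3_to_Sp3 g $ Inl k $ Inl l = g $ k $ l" "SU3_to_Sp3 g $ Inl k $ Inr l = 0"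
    "SU3_to_Sp3 g $ Inr k $ Inl l = 0" "SU3_to_Sp3 g $ Inr k $ Inr l = cnj (g $ k $ l)"
  using assms by (simp_all add: SU3_to_Sp3_def block_diag_def transpose_def matrix_inv_unitary SU3.unitary)

lemma SU3_to_Sp3:
  assumes "g \<in> carrier SU3"
  shows "SU3_to_Sp3 g \<in> carrier Sp3"
proof -
  have "dag g ** g = mat 1" using assms by (rule SU3.left_inverse)
  then have e: "(\<Sum>i\<in>UNIV. cnj (g $ i $ k) * g $ i $ l) = (if k = l then 1 else 0)" for k l
    by (simp add: vec_eq_iff matrix_matrix_mult_def mat_def)
  have "(\<Sum>i\<in>UNIV. g $ i $ k * cnj (g $ i $ l)) = (if k = l then 1 else 0)" for k l
    using e [of l k] by (auto simp: mult.commute)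
  then have "unitary (SU3_to_Sp3 g)"
    using e by (simp add: unitary_iff mat6_eq_iff matrix_matrix_mult_def sum_3_3 SU3_to_Sp3_nth [OF assms] mat_def)
  then show ?thesis
    by (simp add: carrier_Sp3 quaternionic_def SU3_to_Sp3_nth [OF assms])
qed

lemma SU3_to_Sp3_mult:
  assumes "g \<in> carrier SU3" "h \<in> carrier SU3"
  shows "SU3_to_Sp3 (g ** h) = SU3_to_Sp3 g ** SU3_to_Sp3 h"
  by (simp add: mat6_eq_iff SU3_to_Sp3_nth assms SU3.mult matrix_mult_nth sum_3_3)

lemma SU3_to_Sp3_one: "SU3_to_Sp3 (mat 1) = mat 1"
  by (simp add: mat6_eq_iff SU3_to_Sp3_nth SU3.one mat_nth)

lemma line_of_SU3_to_Sp3: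
  assumes "g \<in> carrier SU3"
  shows "line_of (SU3_to_Sp3 g ** A) = act g (line_of A)"
proof -
  have "(\<chi> k. (SU3_to_Sp3 g ** A) $ Inl k $ j) = g *v (\<chi> k. A $ Inl k $ j)" for j
    by (simp add: vec_eq_iff matrix_matrix_mult_def matrix_vector_mult_def sum_3_3 SU3_to_Sp3_nth [OF assms])
  moreover from this [of "Inr 3"]
  have "(\<chi> k. - (SU3_to_Sp3 g ** A) $ Inl k $ Inr 3) = g *v (\<chi> k. - A $ Inl k $ Inr 3)"
    by (simp add: vec_eq_iff matrix_vector_mult_def sum_negf)
  ultimately show ?thesis
    by (simp add: line_of_def act_line_point [OF assms])
qed

lemma line_of_surj:
  assumes "y \<in> HP2_model"
  shows "\<exists>A\<in>carrier Sp3. line_of A = y"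
proof -
  obtain g r where g: "g \<in> carrier SU3" "0 \<le> r" "r \<le> 1 / 2" "y = act g (normal_form r)"
    using HP2_model_normal_form [OF assms] by blast
  define c s where "c = sqrt (top_eigenvalue r)" and "s = sqrt (1 - top_eigenvalue r)"
  have cs: "c\<^sup>2 + s\<^sup>2 = 1" "0 \<le> s" "s \<le> c" using top_eigenvalue [OF g(2,3)] by (simp_all add: c_def s_def)
  have "c * s = sqrt (r\<^sup>2)"
    using top_eigenvalue(1) [OF g(2,3)] by (simp add: c_def s_def flip: real_sqrt_mult)
  then have r: "c * s = r" using g by simp
  \<comment> \<open>A rotation in the first and third quaternionic coordinates, with
    \<open>c\<close> on the diagonal and multiples of j off it; its third column has the invariants
    of \<open>c *\<^sub>R unit_vec 3\<close> and \<open>s *\<^sub>R unit_vec 1\<close>.\<close>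
  define a :: "3 \<Rightarrow> 3 \<Rightarrow> complex" where "a = (\<lambda>k l. if k = l then (if k = 2 then 1 else of_real c) else 0)"
  define b :: "3 \<Rightarrow> 3 \<Rightarrow> complex" where "b = (\<lambda>k l. if k = 1 \<and> l = 3 \<or> k = 3 \<and> l = 1 then - of_real s else 0)"
  define A :: mat6 where "A = (\<chi> i j. case i of Inl k \<Rightarrow> (case j of Inl l \<Rightarrow> a k l | Inr l \<Rightarrow> b k l)
    | Inr k \<Rightarrow> (case j of Inl l \<Rightarrow> - b k l | Inr l \<Rightarrow> a k l))"
  have "complex_of_real (c * c + s * s) = 1" using cs(1) by (simp add: power2_eq_square)
  then have "unitary A"
    by (simp add: unitary_iff mat6_eq_iff A_def matrix_matrix_mult_def sum_3_3 sum_3 forall_3 a_def b_def mat_def add.commute)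
  then have A: "A \<in> carrier Sp3"
    by (auto simp: carrier_Sp3 quaternionic_def A_def a_def b_def)
  have "line_of A = line_point (c *\<^sub>R unit_vec 3) (s *\<^sub>R unit_vec 1)"
    unfolding line_of_def by (intro arg_cong2 [where f = line_point])
      (simp_all add: vec_eq_iff A_def a_def b_def axis_def scaleR_conv_of_real [where 'a = complex] forall_3)
  also have "\<dots> = normal_form r"
    using line_point_normal_form [OF cs] r by simp
  finally have "line_of (SU3_to_Sp3 g ** A) = y"
    using g by (simp add: line_of_SU3_to_Sp3)
  then show ?thesis
    using A SU3_to_Sp3 [OF g(1)] unitary_group.mult [OF unitary_group_Sp3] by blast
qed

text \<open>Squared norm of the quaternionic entry (3, 3). For \<open>C = dag A0 ** A\<close> it is
  the squared cosine of the angle between the lines of \<open>A0\<close> and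
  \<open>A\<close>.\<close>

definition overlap :: "mat6 \<Rightarrow> real" where
  "overlap C = (cmod (C $ Inl 3 $ Inl 3))\<^sup>2 + (cmod (C $ Inl 3 $ Inr 3))\<^sup>2"

text \<open>Compression to the third line leaves only the quaternionic entry (3, 3), whose product
  with its conjugate is the real number \<open>overlap C\<close>.\<close>

lemma third_line_compression:
  assumes "quaternionic C"
  shows "third_line ** C ** third_line ** dag C ** third_line = overlap C *\<^sub>R third_line"
    "third_line ** dag C ** third_line ** C ** third_line = overlap C *\<^sub>R third_line"
    "(C ** third_line ** dag C) $ Inl 3 $ Inl 3 = overlap C"
proof -
  have *: "third_line ** D ** third_line ** dag D ** third_line = overlap D *\<^sub>R third_line" if "quaternionic D" for D
    unfolding mat6_eq_iff
    by (auto simp: overlap_def matrix_matrix_mult_def [of "third_line ** D ** third_line"] third_line_mult sum_3_3 sum_3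
        quaternionic_index_def quaternionic_nth [OF that] scaleR_conv_of_real [where 'a = complex]
        complex_norm_square [symmetric] mult.commute simp flip: of_real_power)
  show "third_line ** C ** third_line ** dag C ** third_line = overlap C *\<^sub>R third_line" using * assms .
  have "overlap (dag C) = overlap C"
    by (simp add: overlap_def quaternionic_nth [OF assms])
  then show "third_line ** dag C ** third_line ** C ** third_line = overlap C *\<^sub>R third_line"
    using * [OF quaternionic_dag [OF assms]] by simp
  show "(C ** third_line ** dag C) $ Inl 3 $ Inl 3 = overlap C"
    by (simp add: overlap_def matrix_matrix_mult_def [of "C ** third_line"] third_line_mult sum_3_3 sum_3
        quaternionic_index_def complex_norm_square del: of_real_power)
qed

text \<open>
  For two projections \<open>P\<close> and \<open>Q\<close> of rank one (over the quaternions) with \<open>P Q P = s\<^sup>2 P\<close>, this is the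
  reflection in the line that bisects the angle between the images of \<open>P\<close> and \<open>Q\<close>.
\<close>

definition bisecting_reflection :: "real \<Rightarrow> mat6 \<Rightarrow> mat6 \<Rightarrow> mat6" where
  "bisecting_reflection s P Q = inverse (1 + s) *\<^sub>R (P + Q + inverse s *\<^sub>R (Q ** P + P ** Q)) - mat 1"

text \<open>\<open>B\<close> satisfies \<open>B ** B = (2 * (1 + s)) *\<^sub>R B\<close>, so
  \<open>R\<close> is twice a projection minus the identity. Moreover
  \<open>R ** P = inverse s *\<^sub>R (Q ** P)\<close>, and multiplying by \<open>R\<close> from the
  right leaves \<open>Q\<close>.\<close>

lemma bisecting_reflection:
  assumes s: "s > 0" and idem: "P ** P = P" "Q ** Q = Q"
    and PQP: "P ** Q ** P = s\<^sup>2 *\<^sub>R P" "Q ** P ** Q = s\<^sup>2 *\<^sub>R Q"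
  shows "bisecting_reflection s P Q ** bisecting_reflection s P Q = mat 1"
    "bisecting_reflection s P Q ** P ** bisecting_reflection s P Q = Q"
proof -
  define B where "B = P + Q + inverse s *\<^sub>R (Q ** P + P ** Q)"
  define R where "R = bisecting_reflection s P Q"
  have R: "R = inverse (1 + s) *\<^sub>R B - mat 1" by (simp add: R_def B_def bisecting_reflection_def)
  have c: "s\<^sup>2 * inverse s = s" "inverse s * s\<^sup>2 = s" "(1 + s) * inverse s = 1 + inverse s"
    using s by (simp_all add: power2_eq_square field_simps)
  have c': "1 + s \<noteq> 0" "s * inverse s = 1" "s * (s * inverse s) = s" using s by simp_all
  have BP: "B ** P = (1 + s) *\<^sub>R (P + inverse s *\<^sub>R (Q ** P))"
    using s by (simp add: B_def matrix_distribs idem PQP scaleR_add_right scaleR_add_left c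
        flip: matrix_mul_assoc)
      (simp add: matrix_mul_assoc idem PQP scaleR_add_right scaleR_add_left c)
  have BQ: "B ** Q = (1 + s) *\<^sub>R (Q + inverse s *\<^sub>R (P ** Q))"
    using s by (simp add: B_def matrix_distribs idem PQP scaleR_add_right scaleR_add_left c
        flip: matrix_mul_assoc)
      (simp add: matrix_mul_assoc idem PQP scaleR_add_right scaleR_add_left c)
  have B1: "B ** P + B ** Q = (1 + s) *\<^sub>R B"
    unfolding BP BQ by (simp add: B_def scaleR_add_right add_ac)
  have e1: "B ** P ** Q + B ** Q ** P = (1 + s) *\<^sub>R ((P ** Q + s *\<^sub>R Q) + (Q ** P + s *\<^sub>R P))"
    unfolding BP BQ by (simp add: matrix_distribs PQP c(1,2) mult.assoc c'(2,3) scaleR_add_right add_ac)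
  have e2: "inverse s *\<^sub>R ((P ** Q + s *\<^sub>R Q) + (Q ** P + s *\<^sub>R P)) = B"
    using s by (simp add: B_def scaleR_add_right add_ac)
  have B2: "inverse s *\<^sub>R (B ** P ** Q + B ** Q ** P) = (1 + s) *\<^sub>R B"
    unfolding e1 scaleR_left_commute [of "inverse s" "1 + s"] e2 ..
  have "B ** B = (B ** P + B ** Q) + inverse s *\<^sub>R (B ** P ** Q + B ** Q ** P)"
    by (subst (2) B_def) (simp add: matrix_distribs matrix_mul_assoc add_ac)
  then have BB: "B ** B = (2 * (1 + s)) *\<^sub>R B"
    unfolding B1 B2 mult_2 scaleR_add_left .
  define k where "k = inverse (1 + s)"
  have "k * (1 + s) = 1" using c'(1) by (simp add: k_def)
  then have "k * (k * (2 * (1 + s))) = k + k"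
    by (metis mult.left_commute mult.right_neutral mult_2)
  then have "k *\<^sub>R (k *\<^sub>R (B ** B)) = k *\<^sub>R B + k *\<^sub>R B"
    unfolding BB scaleR_add_left [symmetric] by (metis scaleR_scaleR)
  moreover have "R ** R = k *\<^sub>R (k *\<^sub>R (B ** B)) - k *\<^sub>R B - k *\<^sub>R B + mat 1"
    unfolding R k_def [symmetric] matrix_distribs matrix_mul_lid matrix_mul_rid scaleR_diff_right
    by (rule diff_diff_eq2 [THEN trans]) (rule add_diff_eq [symmetric, THEN trans], simp only: add.commute diff_add_eq add_diff_eq)
  ultimately show "bisecting_reflection s P Q ** bisecting_reflection s P Q = mat 1"
    by (simp add: R_def)
  have RP: "R ** P = inverse s *\<^sub>R (Q ** P)"
    using c' by (simp add: R matrix_distribs BP)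
  have PB: "Q ** P ** B = (s * (1 + s)) *\<^sub>R Q + (1 + s) *\<^sub>R (Q ** P)"
  proof -
    have 1: "Q ** P ** P = Q ** P" by (simp add: matrix_mul_assoc [symmetric] idem)
    have 2: "Q ** P ** Q ** P = s\<^sup>2 *\<^sub>R (Q ** P)" by (simp add: PQP matrix_distribs)
    have "Q ** P ** B = Q ** P + s\<^sup>2 *\<^sub>R Q + inverse s *\<^sub>R (s\<^sup>2 *\<^sub>R (Q ** P) + s\<^sup>2 *\<^sub>R Q)"
      by (simp only: B_def matrix_distribs matrix_mul_assoc 1 2 PQP)
    then show ?thesis
      by (simp add: scaleR_add_right scaleR_add_left c distrib_left power2_eq_square [symmetric] add_ac)
  qed
  then have "Q ** P ** B = (1 + s) *\<^sub>R (s *\<^sub>R Q + Q ** P)"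
    by (simp add: scaleR_add_right mult.commute)
  then have "inverse (1 + s) *\<^sub>R (Q ** P ** B) = s *\<^sub>R Q + Q ** P" using c'(1) by simp
  moreover have "R ** P ** R = inverse s *\<^sub>R (inverse (1 + s) *\<^sub>R (Q ** P ** B) - Q ** P)"
    unfolding RP by (simp only: R matrix_distribs matrix_mul_rid scaleR_diff_right
        scaleR_left_commute [of "inverse s" "inverse (1 + s)"])
  ultimately have "R ** P ** R = Q" using s by simp
  then show "bisecting_reflection s P Q ** P ** bisecting_reflection s P Q = Q"
    by (simp add: R_def)
qed

text \<open>Equality of lines is equality of their projections, and two conjugates of
  \<open>third_line\<close> agree exactly when the quotient of the conjugating matrices commutes
  with it.\<close>

lemma line_of_eq_iff:
  assumes "A \<in> carrier Sp3" "B \<in> carrier Sp3"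
  shows "line_of A = line_of B \<longleftrightarrow> dag A ** B \<in> Sp2_Sp1"
proof -
  interpret unitary_group "carrier Sp3" by (rule unitary_group_Sp3)
  have "line_of A = line_of B \<longleftrightarrow> A ** third_line ** dag A = B ** third_line ** dag B"
    using assms line_projection_inj [of "line_of A" "line_of B"] by (auto simp: carrier_Sp3 line_projection_line_of)
  also have "\<dots> \<longleftrightarrow> third_line ** (dag A ** B) = (dag A ** B) ** third_line"
  proof
    assume e: "A ** third_line ** dag A = B ** third_line ** dag B"
    have "third_line ** (dag A ** B) = dag A ** (A ** third_line ** dag A) ** B"
      by (simp add: matrix_mul_assoc left_inverse assms)
    also have "\<dots> = dag A ** B ** third_line ** (dag B ** B)"
      unfolding e by (simp add: matrix_mul_assoc)
    finally show "third_line ** (dag A ** B) = (dag A ** B) ** third_line"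
      by (simp add: left_inverse assms)
  next
    assume e: "third_line ** (dag A ** B) = (dag A ** B) ** third_line"
    have "A ** third_line ** dag A = A ** (third_line ** (dag A ** B)) ** dag B"
      by (simp add: matrix_mul_assoc [symmetric] right_inverse assms)
    also have "\<dots> = (A ** dag A) ** B ** third_line ** dag B"
      unfolding e by (simp add: matrix_mul_assoc)
    finally show "A ** third_line ** dag A = B ** third_line ** dag B"
      by (simp add: right_inverse assms)
  qed
  also have "\<dots> \<longleftrightarrow> dag A ** B \<in> Sp2_Sp1"
    using mult dag assms by (simp add: Sp2_Sp1_iff)
  finally show ?thesis .
qed

text \<open>On the lines that are not orthogonal to the line of \<open>A0\<close>, the bisecting
  reflection moves that line to the given one; composed with \<open>A0\<close> it is a smooth lift
  to Sp(3).\<close>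

lemma line_of_local_section:
  assumes A0: "A0 \<in> carrier Sp3"
  shows "\<exists>W s. line_of A0 \<in> W \<and> smooth_map W s \<and>
    (\<forall>y\<in>W \<inter> HP2_model. s y \<in> carrier Sp3 \<and> line_of (s y) = y)"
proof -
  interpret unitary_group "carrier Sp3" by (rule unitary_group_Sp3)
  define P where "P = A0 ** third_line ** dag A0"
  \<comment> \<open>On the model this is the squared cosine between the two lines; written through
    \<open>line_projection\<close> it is smooth on the whole ambient space.\<close>
  define p where "p y = Re ((dag A0 ** line_projection y ** A0) $ Inl 3 $ Inl 3)" for y
  define W where "W = {y. 0 < p y}"
  define s where "s y = bisecting_reflection (sqrt (p y)) P (line_projection y) ** A0" for y
  have sp: "smooth_map UNIV p"
    unfolding p_def by (intro smooth_intros smooth_map_line_projection open_UNIV)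
  have "open W"
    unfolding W_def using open_Collect_less [of "\<lambda>y. 0" p] smooth_map_imp_continuous_on [OF sp] by simp
  then have "smooth_map W p" "smooth_map W line_projection"
    using sp smooth_map_line_projection smooth_map_subset by blast+
  then have "smooth_map W s"
    unfolding s_def bisecting_reflection_def
    by (intro smooth_intros) (use \<open>open W\<close> in \<open>auto simp: W_def dest: real_sqrt_gt_zero\<close>)
  moreover have overlap: "p (line_of A) = overlap (dag A0 ** A)" if "A \<in> carrier Sp3" for A
  proof -
    have "dag A0 ** line_projection (line_of A) ** A0 = (dag A0 ** A) ** third_line ** dag (dag A0 ** A)"
      using that by (simp add: carrier_Sp3 dag_mult matrix_mul_assoc flip: line_projection_line_of)
    then show ?thesis
      using that A0 by (simp add: p_def third_line_compression carrier_Sp3 quaternionic_intros)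
  qed
  moreover have "overlap (mat 1) = 1" by (simp add: overlap_def mat_def)
  then have "line_of A0 \<in> W"
    using overlap [OF A0] A0 by (simp add: W_def left_inverse)
  moreover have "s y \<in> carrier Sp3 \<and> line_of (s y) = y" if y: "y \<in> W \<inter> HP2_model" for y
  proof -
    obtain A where A: "A \<in> carrier Sp3" "line_of A = y" using y line_of_surj by blast
    define Q where "Q = A ** third_line ** dag A"
    define C where "C = dag A0 ** A"
    have Q: "line_projection y = Q"
      using A by (simp add: Q_def carrier_Sp3 line_projection_line_of)
    have qC: "quaternionic C" using A A0 by (simp add: C_def carrier_Sp3 quaternionic_intros)
    have pos: "0 < p y" using y by (simp add: W_def)
    have ov: "overlap C = p y" using overlap [OF A(1)] A by (simp add: C_def)
    have qP: "quaternionic P" "quaternionic Q"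
      using A A0 by (simp_all add: P_def Q_def carrier_Sp3 quaternionic_intros quaternionic_third_line)
    have hP: "dag P = P" "dag Q = Q"
      by (simp_all add: P_def Q_def dag_mult dag_third_line matrix_mul_assoc)
    have idem: "P ** P = P" "Q ** Q = Q"
      unfolding P_def Q_def
      by (simp_all add: matrix_mul_assoc [symmetric] cancel A A0)
         (simp_all add: matrix_mul_assoc third_line_idem)
    have "P ** Q ** P = A0 ** (third_line ** C ** third_line ** dag C ** third_line) ** dag A0"
      by (simp add: P_def Q_def C_def dag_mult matrix_mul_assoc)
    also have "\<dots> = p y *\<^sub>R P"
      unfolding third_line_compression [OF qC] ov by (simp add: P_def matrix_distribs)
    finally have PQP: "P ** Q ** P = (sqrt (p y))\<^sup>2 *\<^sub>R P" using pos by simp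
    have "Q ** P ** Q = A ** (third_line ** dag C ** third_line ** C ** third_line) ** dag A"
      by (simp add: P_def Q_def C_def dag_mult matrix_mul_assoc)
    also have "\<dots> = p y *\<^sub>R Q"
      unfolding third_line_compression [OF qC] ov by (simp add: Q_def matrix_distribs)
    finally have QPQ: "Q ** P ** Q = (sqrt (p y))\<^sup>2 *\<^sub>R Q" using pos by simp
    define R where "R = bisecting_reflection (sqrt (p y)) P Q"
    have R: "R ** R = mat 1" "R ** P ** R = Q"
      unfolding R_def using pos by (auto intro!: bisecting_reflection idem PQP QPQ)
    have hR: "dag R = R"
      by (simp add: R_def bisecting_reflection_def dag_add dag_diff dag_scaleR dag_mult hP add_ac)
    have "quaternionic R"
      unfolding R_def bisecting_reflection_def by (intro quaternionic_intros qP)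
    then have R_in: "R \<in> carrier Sp3" by (simp add: carrier_Sp3 unitary_iff hR R)
    have sy: "s y = R ** A0" by (simp add: s_def Q R_def)
    then have s_in: "s y \<in> carrier Sp3" using R_in A0 mult by simp
    have "s y ** third_line ** dag (s y) = R ** P ** R"
      by (simp add: sy P_def dag_mult hR matrix_mul_assoc)
    then have "line_projection (line_of (s y)) = line_projection y"
      using s_in by (simp add: carrier_Sp3 R Q flip: line_projection_line_of)
    then show ?thesis using s_in line_projection_inj by blast
  qed
  ultimately show ?thesis by blast
qed

section \<open>HP(2) and its action in the Euclidean model\<close>

lemma HP2_model_diffeomorphism:
  obtains \<psi> where "diffeomorphism HP2 (euclidean_subset HP2_model) \<psi>"
    "\<And>A. A \<in> carrier Sp3 \<Longrightarrow> \<psi> (A <#\<^bsub>Sp3\<^esub> Sp2_Sp1) = line_of A"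
proof -
  note result = that
  interpret unitary_subgroup "carrier Sp3" Sp2_Sp1 by (rule unitary_subgroup_Sp2_Sp1)
  show thesis
  proof (rule homogeneous_space_model [of line_of HP2_model, unfolded matrix_group_carrier_Sp3])
    show "smooth_map UNIV line_of"
      unfolding line_of_def by (intro smooth_intros open_UNIV)
    show "dag A ** B \<in> Sp2_Sp1" if "A \<in> carrier Sp3" "B \<in> carrier Sp3" "line_of A = line_of B" for A B
      using that line_of_eq_iff by blast
    show "line_of (A ** B) = line_of A" if "A \<in> carrier Sp3" "B \<in> Sp2_Sp1" for A B
      using that mult subset sub.dag line_of_eq_iff [of "A ** B" A]
      by (auto simp: dag_mult matrix_mul_assoc [symmetric] left_inverse)
    show "\<exists>W s. y \<in> W \<and> smooth_map W s \<and> (\<forall>y'\<in>W \<inter> HP2_model. s y' \<in> carrier Sp3 \<and> line_of (s y') = y')"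
      if "y \<in> HP2_model" for y
      using line_of_surj [OF that] line_of_local_section by blast
    show thesis if "diffeomorphism (homogeneous_space Sp3 Sp2_Sp1) (euclidean_subset HP2_model) \<psi>"
      "\<And>A. A \<in> carrier Sp3 \<Longrightarrow> \<psi> (A <#\<^bsub>Sp3\<^esub> Sp2_Sp1) = line_of A" for \<psi>
      using that result unfolding HP2_def by blast
  qed (rule line_of_in_HP2_model)
qed

lemma points_HP2: "points HP2 = (\<lambda>A. A <#\<^bsub>Sp3\<^esub> Sp2_Sp1) ` carrier Sp3"
  by (simp add: HP2_def homogeneous_space_def)

lemma HP2_action_l_coset:
  assumes "g \<in> carrier SU3" "A \<in> carrier Sp3"
  shows "HP2_action g (A <#\<^bsub>Sp3\<^esub> Sp2_Sp1) = (SU3_to_Sp3 g ** A) <#\<^bsub>Sp3\<^esub> Sp2_Sp1"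
proof -
  interpret unitary_group "carrier Sp3" by (rule unitary_group_Sp3)
  have "A <#\<^bsub>Sp3\<^esub> Sp2_Sp1 \<in> points HP2" using assms by (simp add: points_HP2)
  then show ?thesis
    using coset_action_l_coset [of "SU3_to_Sp3 g" A Sp2_Sp1]
    by (simp add: HP2_action_def matrix_group_carrier_Sp3)
qed

lemma HP2_action_in_points:
  assumes "g \<in> carrier SU3" "x \<in> points HP2"
  shows "HP2_action g x \<in> points HP2"
  using assms SU3_to_Sp3 unitary_group.mult [OF unitary_group_Sp3]
  by (auto simp: points_HP2 HP2_action_l_coset)

lemma HP2_equivariant_model:
  obtains \<psi> where "equivariant_diffeomorphism SU3 HP2 HP2_action (euclidean_subset HP2_model) act \<psi>"
proof -
  obtain \<psi> where \<psi>: "diffeomorphism HP2 (euclidean_subset HP2_model) \<psi>"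
    "\<And>A. A \<in> carrier Sp3 \<Longrightarrow> \<psi> (A <#\<^bsub>Sp3\<^esub> Sp2_Sp1) = line_of A"
    using HP2_model_diffeomorphism by blast
  have "\<psi> (HP2_action g x) = act g (\<psi> x)" if g: "g \<in> carrier SU3" and x: "x \<in> points HP2" for g x
  proof -
    obtain A where A: "A \<in> carrier Sp3" "x = A <#\<^bsub>Sp3\<^esub> Sp2_Sp1" using x by (auto simp: points_HP2)
    then have "SU3_to_Sp3 g ** A \<in> carrier Sp3"
      using SU3_to_Sp3 [OF g] unitary_group.mult [OF unitary_group_Sp3] by blast
    then show ?thesis
      using \<psi>(2) A g by (simp add: HP2_action_l_coset line_of_SU3_to_Sp3)
  qed
  then show thesis
    using \<psi>(1) by (intro that [of \<psi>]) (simp add: equivariant_diffeomorphism_def)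
qed

lemma group_action_HP2: "group_action SU3 (points HP2) HP2_action"
proof -
  have mult: "HP2_action (g ** h) x = HP2_action g (HP2_action h x)"
    if "g \<in> carrier SU3" "h \<in> carrier SU3" "x \<in> points HP2" for g h x
    using that SU3_to_Sp3 SU3.mult unitary_group.mult [OF unitary_group_Sp3]
    by (auto simp: points_HP2 HP2_action_l_coset SU3_to_Sp3_mult matrix_mul_assoc)
  have one: "HP2_action (mat 1) x = x" if "x \<in> points HP2" for x
    using that SU3.one by (auto simp: points_HP2 HP2_action_l_coset SU3_to_Sp3_one)
  have bij: "HP2_action g \<in> Bij (points HP2)" if g: "g \<in> carrier SU3" for g
  proof -
    have d: "dag g \<in> carrier SU3" by (rule SU3.dag [OF g])
    have "bij_betw (HP2_action g) (points HP2) (points HP2)"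
      by (rule bij_betw_byWitness [where f' = "HP2_action (dag g)"])
         (use g d HP2_action_in_points in \<open>auto simp: mult [symmetric] SU3.left_inverse SU3.right_inverse one\<close>)
    \<comment> \<open>\<open>BijGroup\<close> consists of extensional maps, which is met because
      \<open>HP2_action g\<close> is restricted to the points.\<close>
    moreover have "HP2_action g \<in> extensional (points HP2)" by (simp add: HP2_action_def)
    ultimately show ?thesis by (simp add: Bij_def)
  qed
  show ?thesis
    unfolding group_action_def group_hom_def group_hom_axioms_def
  proof (intro conjI homI)
    show "group SU3" by (rule SU3.group)
    show "group (BijGroup (points HP2))" by (rule group_BijGroup)
    fix g h assume g: "g \<in> carrier SU3" and h: "h \<in> carrier SU3"
    show "HP2_action g \<in> carrier (BijGroup (points HP2))" using bij g by (simp add: BijGroup_def)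
    have "HP2_action (g ** h) = compose (points HP2) (HP2_action g) (HP2_action h)"
    proof
      show "HP2_action (g ** h) x = compose (points HP2) (HP2_action g) (HP2_action h) x" for x
        using g h mult by (cases "x \<in> points HP2") (simp_all add: compose_def HP2_action_def)
    qed
    then show "HP2_action (g \<otimes>\<^bsub>SU3\<^esub> h) = HP2_action g \<otimes>\<^bsub>BijGroup (points HP2)\<^esub> HP2_action h"
      using bij g h by (simp add: BijGroup_def SU3_def matrix_group_def)
  qed
qed

section \<open>Orbits and isotropy groups\<close>

definition isotropy :: "(complex^3^3) \<times> (complex^3) \<Rightarrow> (complex^3^3) set" where
  "isotropy y = {g \<in> carrier SU3. act g y = y}"

lemma unitary_subgroup_isotropy: "unitary_subgroup (carrier SU3) (isotropy y)"
proof -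
  have "unitary_group (isotropy y)"
    by unfold_locales
       (auto simp: isotropy_def SU3.unitary SU3.one SU3.mult SU3.dag act_mult act_eq_iff)
  then show ?thesis
    by (intro unitary_subgroup.intro SU3.unitary_group_axioms unitary_subgroup_axioms.intro)
       (auto simp: isotropy_def)
qed

lemma matrix_group_carrier_SU3: "matrix_group (carrier SU3) = SU3"
  by (simp add: SU3_def matrix_group_def)

text \<open>The fibres of the orbit map are the cosets of the isotropy group, so local smooth
  sections of it are all that remains to be supplied.\<close>

lemma isotropy_model:
  assumes "\<And>y. y \<in> (\<lambda>g. act g y0) ` carrier SU3 \<Longrightarrow> \<exists>W s. y \<in> W \<and> smooth_map W s \<and>
      (\<forall>y'\<in>W \<inter> (\<lambda>g. act g y0) ` carrier SU3. s y' \<in> carrier SU3 \<and> act (s y') y0 = y')"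
  shows "\<exists>\<psi>. equivariant_diffeomorphism SU3 (homogeneous_space SU3 (isotropy y0)) (coset_action SU3)
    (euclidean_subset ((\<lambda>g. act g y0) ` carrier SU3)) act \<psi>"
proof -
  interpret unitary_subgroup "carrier SU3" "isotropy y0" by (rule unitary_subgroup_isotropy)
  show ?thesis
  proof (rule homogeneous_space_equivariant_model [of "\<lambda>g. act g y0" "(\<lambda>g. act g y0) ` carrier SU3" act,
        unfolded matrix_group_carrier_SU3])
    show "smooth_map UNIV (\<lambda>g. act g y0)" by (intro smooth_intros open_UNIV)
    show "dag g ** g' \<in> isotropy y0" if "g \<in> carrier SU3" "g' \<in> carrier SU3" "act g y0 = act g' y0" for g g'
      using that SU3.mult SU3.dag act_cancel(1) [of g y0] by (auto simp: isotropy_def act_mult)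
    show "\<exists>W s. y \<in> W \<and> smooth_map W s \<and>
      (\<forall>y'\<in>W \<inter> (\<lambda>g. act g y0) ` carrier SU3. s y' \<in> carrier SU3 \<and> act (s y') y0 = y')"
      if "y \<in> (\<lambda>g. act g y0) ` carrier SU3" for y
      using assms [OF that] .
  qed (auto simp: isotropy_def act_mult)
qed

lemma isotropy_act:
  assumes "h \<in> carrier SU3"
  shows "isotropy (act h y) = (\<lambda>g. h ** g ** dag h) ` isotropy y"
proof (intro equalityI subsetI)
  fix g assume g: "g \<in> isotropy (act h y)"
  then have "act (dag h ** g ** h) y = y"
    using assms by (simp add: isotropy_def act_mult act_cancel)
  then have "dag h ** g ** h \<in> isotropy y"
    using g assms SU3.mult SU3.dag by (simp add: isotropy_def)
  moreover have "g = h ** (dag h ** g ** h) ** dag h"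
    using assms by (simp add: matrix_mul_assoc SU3.right_inverse) (simp add: matrix_mul_assoc [symmetric] SU3.right_inverse)
  ultimately show "g \<in> (\<lambda>g. h ** g ** dag h) ` isotropy y" by blast
next
  fix g assume "g \<in> (\<lambda>g. h ** g ** dag h) ` isotropy y"
  then show "g \<in> isotropy (act h y)"
    using assms SU3.mult SU3.dag by (auto simp: isotropy_def act_mult act_cancel)
qed

lemma hdot_scale: "hdot (c *s z) (c *s z) = c * cnj c * hdot z z"
  by (simp add: hdot_def sum_distrib_left mult_ac)

text \<open>Since \<open>t\<close> has modulus one, \<open>unit_vec j\<close> is also an eigenvector
  of the inverse \<open>dag g\<close>; this clears the row as well as the column.\<close>

lemma unitary_eigenvector:
  fixes g :: "complex^3^3"
  assumes g: "unitary g" and e: "g *v unit_vec j = t *s unit_vec j"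
  shows "g $ j $ j = t" "t * cnj t = 1" "i \<noteq> j \<Longrightarrow> g $ i $ j = 0" "i \<noteq> j \<Longrightarrow> g $ j $ i = 0"
proof -
  have col: "(M *v unit_vec j) $ i = M $ i $ j" for M :: "complex^3^3" and i
    by (simp add: matrix_vector_mult_def axis_def if_distrib [of "\<lambda>x. _ * x"] cong: if_cong)
  have "g $ i $ j = t * unit_vec j $ i" for i
    using col [of g i] by (simp only: e vector_smult_component)
  then show "g $ j $ j = t" "i \<noteq> j \<Longrightarrow> g $ i $ j = 0"
    by (simp_all add: axis_def)
  have "norm (g *v unit_vec j) = 1" using norm_unitary [OF g] by (simp add: norm_axis_1)
  then have "hdot (g *v unit_vec j) (g *v unit_vec j) = 1" by (simp add: hdot_self)
  then show t: "t * cnj t = 1"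
    unfolding e hdot_scale by simp
  have "dag g *v (g *v unit_vec j) = unit_vec j"
    using g by (simp add: matrix_vector_mul_assoc unitary_iff)
  then have "t *s (dag g *v unit_vec j) = unit_vec j"
    by (simp add: e vec.scale)
  then have "t * (dag g *v unit_vec j) $ i = unit_vec j $ i" by (metis vector_smult_component)
  then have "t * cnj (g $ j $ i) = unit_vec j $ i" by (simp add: col)
  moreover have "t \<noteq> 0" using t by auto
  ultimately show "i \<noteq> j \<Longrightarrow> g $ j $ i = 0" by (simp add: axis_def)
qed

lemma outer_unit_vec_eq:
  assumes "outer z z = outer (unit_vec j) (unit_vec j)"
  shows "z = z $ j *s unit_vec j"
proof -
  have "outer z z $ i $ i = outer (unit_vec j) (unit_vec j) $ i $ i" for i using assms by simp
  then have "z $ i = 0" if "i \<noteq> j" for i using that by (auto simp: axis_def split: if_splits) (metis mult_eq_0_iff complex_cnj_zero_iff)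
  then show ?thesis by (auto simp: vec_eq_iff axis_def)
qed

lemma outer_phase: "c * cnj c = 1 \<Longrightarrow> outer (c *s z) (c *s z) = outer z z"
  by (simp add: vec_eq_iff mult_ac)

section \<open>Isotropy groups of the normal forms\<close>

lemma U2_iff:
  "g \<in> U2 \<longleftrightarrow> g \<in> carrier SU3 \<and> g $ 1 $ 3 = 0 \<and> g $ 2 $ 3 = 0 \<and> g $ 3 $ 1 = 0 \<and> g $ 3 $ 2 = 0"
proof
  assume "g \<in> U2"
  then obtain A where A: "g = U2_to_SU3 A" "unitary A" by (auto simp: U2_def)
  have "det (dag A) * det A = 1" using A(2) by (simp add: unitary_iff flip: det_mul)
  moreover have "det (dag A) = cnj (det A)" by (simp add: det_2 mult_ac)
  ultimately have d: "cnj (det A) * det A = 1" by simp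
  then have d': "det A \<noteq> 0" by auto
  have "det g = (A$1$1 * A$2$2 - A$1$2 * A$2$1) * inverse (det A)"
    by (simp add: A(1) U2_to_SU3_def det_3 algebra_simps)
  then have "det g = 1" using d' by (simp flip: det_2)
  moreover have "dag A ** A = mat 1" using A(2) by (simp add: unitary_iff)
  then have "unitary g"
    using d d' by (simp add: unitary_iff A(1) U2_to_SU3_def vec_eq_iff forall_3 forall_2 matrix_matrix_mult_def
        sum_3 sum_2 mat_def field_simps)
  ultimately show "g \<in> carrier SU3 \<and> g $ 1 $ 3 = 0 \<and> g $ 2 $ 3 = 0 \<and> g $ 3 $ 1 = 0 \<and> g $ 3 $ 2 = 0"
    by (simp add: carrier_SU3 A(1) U2_to_SU3_def)
next
  assume g: "g \<in> carrier SU3 \<and> g $ 1 $ 3 = 0 \<and> g $ 2 $ 3 = 0 \<and> g $ 3 $ 1 = 0 \<and> g $ 3 $ 2 = 0"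
  define A :: "complex^2^2" where "A = vector [vector [g$1$1, g$1$2], vector [g$2$1, g$2$2]]"
  have "dag g ** g = mat 1" using g SU3.left_inverse by blast
  then have "unitary A"
    using g by (simp add: unitary_iff A_def vec_eq_iff forall_3 forall_2 matrix_matrix_mult_def sum_3 sum_2 mat_def)
  moreover have z: "g$1$3 = 0" "g$2$3 = 0" "g$3$1 = 0" "g$3$2 = 0" "det g = 1"
    using g by (auto simp: carrier_SU3)
  have "det A * g$3$3 = det g"
    by (simp add: det_3 z(1-4) det_2 A_def algebra_simps)
  then have "det A * g$3$3 = 1" by (simp add: z)
  then have "g$3$3 = inverse (det A)" by (metis inverse_unique)
  then have "g = U2_to_SU3 A"
    using g by (simp add: U2_to_SU3_def vec_eq_iff forall_3 A_def)
  ultimately show "g \<in> U2" by (auto simp: U2_def)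
qed

lemma SU2_iff: "g \<in> SU2 \<longleftrightarrow> g \<in> U2 \<and> g $ 3 $ 3 = 1"
proof -
  have "U2_to_SU3 A $ 3 $ 3 = inverse (det A)" for A by (simp add: U2_to_SU3_def)
  then show ?thesis
    unfolding SU2_def U2_def by (auto simp: inverse_eq_1_iff)
qed

text \<open>Preserving the projection onto \<open>unit_vec 3\<close> means preserving its line. This
  is the form in which \<open>U2\<close> appears as isotropy group of
  \<open>normal_form 0\<close>.\<close>

lemma U2_eq: "U2 = {g \<in> carrier SU3. outer (g *v unit_vec 3) (g *v unit_vec 3) = outer (unit_vec 3) (unit_vec 3)}"
proof (intro equalityI subsetI)
  fix g assume g: "g \<in> {g \<in> carrier SU3. outer (g *v unit_vec 3) (g *v unit_vec 3) = outer (unit_vec 3) (unit_vec 3)}"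
  then have "g *v unit_vec 3 = (g *v unit_vec 3) $ 3 *s unit_vec 3" by (intro outer_unit_vec_eq) simp
  from unitary_eigenvector [OF _ this] show "g \<in> U2"
    using g SU3.unitary by (simp add: U2_iff)
next
  fix g assume g: "g \<in> U2"
  then have e: "g *v unit_vec 3 = g$3$3 *s unit_vec 3"
    by (simp add: U2_iff vec_eq_iff forall_3 matrix_vector_mult_def sum_3 axis_def)
  have "g$3$3 * cnj (g$3$3) = 1"
    using g SU3.unitary by (intro unitary_eigenvector [OF _ e]) (simp add: U2_iff)
  then show "g \<in> {g \<in> carrier SU3. outer (g *v unit_vec 3) (g *v unit_vec 3) = outer (unit_vec 3) (unit_vec 3)}"
    using g by (simp add: U2_iff outer_phase e)
qed

lemma SU2_eq: "SU2 = {g \<in> carrier SU3. g *v unit_vec 3 = unit_vec 3}"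
proof (intro equalityI subsetI)
  fix g assume g: "g \<in> {g \<in> carrier SU3. g *v unit_vec 3 = unit_vec 3}"
  then have "g *v unit_vec 3 = 1 *s unit_vec 3" by simp
  from unitary_eigenvector [OF _ this] show "g \<in> SU2"
    using g SU3.unitary by (simp add: SU2_iff U2_iff)
next
  fix g assume "g \<in> SU2"
  then show "g \<in> {g \<in> carrier SU3. g *v unit_vec 3 = unit_vec 3}"
    by (simp add: SU2_iff U2_iff vec_eq_iff forall_3 matrix_vector_mult_def sum_3 axis_def)
qed

lemma isotropy_normal_form_0: "isotropy (normal_form 0) = U2"
  by (auto simp: isotropy_def U2_eq normal_form_def act_def outer_conjugate)

definition diag3 :: "complex \<Rightarrow> complex \<Rightarrow> complex \<Rightarrow> complex^3^3" where
  "diag3 a b c = vector [vector [a, 0, 0], vector [0, b, 0], vector [0, 0, c]]"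

lemma U1_1_0: "U1 1 0 = {diag3 (cnj t) 1 t | t. cmod t = 1}"
proof -
  have "U1 1 0 = {diag3 (cnj (cis \<theta>)) 1 (cis \<theta>) | \<theta>. True}"
    unfolding U1_def diag3_def by (auto simp: cis_cnj) (metis minus_minus)+
  also have "\<dots> = {diag3 (cnj t) 1 t | t. cmod t = 1}"
    by (metis (no_types, opaque_lifting) norm_cis complex_norm_eq_1_exp cis_conv_exp)
  finally show ?thesis .
qed

text \<open>The circle multiplies the eigenvectors by phases and fixes \<open>unit_vec 2\<close>.
  That a single subgroup fixes all normal forms makes the intermediate orbits principal.\<close>

lemma U1_1_0_subset_isotropy: "U1 1 0 \<subseteq> isotropy (normal_form r)"
proof
  fix g assume "g \<in> U1 1 0"
  then obtain t where t: "g = diag3 (cnj t) 1 t" "cmod t = 1" unfolding U1_1_0 by blast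
  have tt: "t * cnj t = 1" using t(2) by (simp add: complex_norm_square [symmetric])
  then have tt': "cnj t * t = 1" by (simp add: mult.commute)
  have "g \<in> carrier SU3"
    using tt tt' by (simp add: carrier_SU3 t(1) unitary_iff det_3 diag3_def vec_eq_iff forall_3 matrix_matrix_mult_def sum_3 mat_def)
  moreover have "g *v unit_vec 1 = cnj t *s unit_vec 1" "g *v unit_vec 2 = unit_vec 2" "g *v unit_vec 3 = t *s unit_vec 3"
    by (simp_all add: t(1) diag3_def vec_eq_iff forall_3 matrix_vector_mult_def sum_3 axis_def)
 ultimately show "g \<in> isotropy (normal_form r)"
    using tt tt' by (simp add: outer_phase isotropy_def act_def normal_form_def matrix_distribs outer_conjugate matrix_vector_scaleR_right)
qed

text \<open>An isotropy element fixes \<open>unit_vec 2\<close> because w is nonzero, and preserves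
  the line of \<open>unit_vec 3\<close> because the top eigenvalue is simple; so it is diagonal, and
  the determinant relates its two remaining phases.\<close>

lemma isotropy_normal_form:
  assumes r: "0 < r" "r < 1 / 2"
  shows "isotropy (normal_form r) = U1 1 0"
proof (intro equalityI subsetI)
  fix g assume g: "g \<in> isotropy (normal_form r)"
  then have g': "unitary g" "det g = 1" "g \<in> carrier SU3" by (auto simp: isotropy_def carrier_SU3)
  have "g *v (r *\<^sub>R unit_vec 2) = r *\<^sub>R unit_vec 2"
    using g by (simp add: isotropy_def act_def normal_form_def)
  then have 2: "g *v unit_vec 2 = 1 *s unit_vec 2"
    using r by (simp add: matrix_vector_scaleR_right)
  have "outer (g *v unit_vec 3) (g *v unit_vec 3) = outer (unit_vec 3) (unit_vec 3)"
    using g top_projection_act_normal_form [OF g'(3), of r] top_projection_normal_form [of r] r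
    by (simp add: isotropy_def)
  then have 3: "g *v unit_vec 3 = (g *v unit_vec 3) $ 3 *s unit_vec 3" by (rule outer_unit_vec_eq)
  define t where "t = (g *v unit_vec 3) $ 3"
  note e2 = unitary_eigenvector [OF g'(1) 2] and e3 = unitary_eigenvector [OF g'(1) 3 [folded t_def]]
  have "g$1$1 * t = 1" using g'(2) e2 e3 by (simp add: det_3)
  then have "g$1$1 = cnj t" using e3(2) by (metis mult.commute mult.left_commute mult.right_neutral)
  then have "g = diag3 (cnj t) 1 t"
    using e2 e3 by (simp add: diag3_def vec_eq_iff forall_3)
  moreover have "cmod t = 1" using e3(2) by (metis complex_mod_mult_cnj norm_one power2_eq_1_iff norm_ge_zero neg_0_le_iff_le not_one_le_zero)
  ultimately show "g \<in> U1 1 0" unfolding U1_1_0 by blast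
qed (use U1_1_0_subset_isotropy in blast)

text \<open>The cyclic permutation matrix e_1 to e_2 to e_3 to e_1. Conjugation by it shifts
  diagonal entries and turns \<open>U1 1 0\<close> into \<open>U1 1 (-1)\<close>.\<close>

definition cyc :: "complex^3^3" where
  "cyc = frame (unit_vec 2) (unit_vec 1)"

lemma cyc: "cyc \<in> carrier SU3"
  unfolding cyc_def by (rule frame_SU3) simp_all

lemma cyc_unit_vec: "cyc *v unit_vec 1 = unit_vec 2" "cyc *v unit_vec 2 = unit_vec 3" "cyc *v unit_vec 3 = unit_vec 1"
  by (simp_all add: cyc_def)

lemma isotropy_cyc_normal_form:
  assumes r: "0 < r" "r < 1 / 2"
  shows "isotropy (act cyc (normal_form r)) = U1 1 (-1)"
proof -
  have "cyc ** diag3 a b c ** dag cyc = diag3 c a b" for a b c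
    by (simp add: cyc_def frame_def diag3_def vec_eq_iff forall_3 matrix_matrix_mult_def sum_3 axis_def)
  then have "isotropy (act cyc (normal_form r)) = {diag3 t (cnj t) 1 | t. cmod t = 1}"
    unfolding isotropy_act [OF cyc] isotropy_normal_form [OF r] U1_1_0 by (auto simp: image_iff) metis+
  also have "\<dots> = {diag3 (cis \<theta>) (cnj (cis \<theta>)) 1 | \<theta>. True}"
    by (metis (no_types, opaque_lifting) norm_cis complex_norm_eq_1_exp cis_conv_exp)
  also have "\<dots> = U1 1 (-1)"
    by (simp add: U1_def diag3_def cis_cnj)
  finally show ?thesis .
qed

section \<open>Points of the orbit S^5 and local sections\<close>

definition S5_point :: "complex^3 \<Rightarrow> (complex^3^3) \<times> (complex^3)" where
  "S5_point w = ((1 / 2) *\<^sub>R (mat 1 - outer w w), (1 / 2) *\<^sub>R w)"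

lemma act_S5_point: "g \<in> carrier SU3 \<Longrightarrow> act g (S5_point w) = S5_point (g *v w)"
  by (simp add: act_def S5_point_def matrix_distribs outer_conjugate matrix_vector_scaleR_right SU3.right_inverse)

lemma sum_outer_frame:
  assumes "g \<in> carrier SU3"
  shows "outer (g *v unit_vec 1) (g *v unit_vec 1) + outer (g *v unit_vec 2) (g *v unit_vec 2) +
    outer (g *v unit_vec 3) (g *v unit_vec 3) = mat 1"
proof -
  have "outer (unit_vec 1) (unit_vec 1) + outer (unit_vec 2) (unit_vec 2) + outer (unit_vec 3) (unit_vec 3) = mat 1"
    by (simp add: vec_eq_iff forall_3 axis_def mat_def)
  then have "g ** (outer (unit_vec 1) (unit_vec 1) + outer (unit_vec 2) (unit_vec 2) + outer (unit_vec 3) (unit_vec 3)) ** dag g = mat 1"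
    using assms by (simp add: SU3.right_inverse)
  then show ?thesis by (simp add: matrix_distribs outer_conjugate)
qed

lemma normal_form_half: "normal_form (1 / 2) = S5_point (unit_vec 2)"
proof -
  have "outer (unit_vec 3) (unit_vec 3) + outer (unit_vec 1) (unit_vec 1) = mat 1 - outer (unit_vec 2) (unit_vec 2)"
    using sum_outer_frame [OF SU3.one] by (simp add: algebra_simps)
  then show ?thesis
    by (simp add: normal_form_def S5_point_def flip: scaleR_add_right)
qed

lemma isotropy_S5_point: "isotropy (S5_point (unit_vec 3)) = SU2"
  unfolding SU2_eq isotropy_def using act_S5_point by (auto simp: S5_point_def)

lemma third_column_section:
  assumes "c0 \<noteq> 0"
  shows "\<exists>W s. c0 \<in> W \<and> smooth_map W s \<and>
    (\<forall>c\<in>W. c \<noteq> 0 \<and> s c \<in> carrier SU3 \<and> s c *v unit_vec 3 = normalize_vec c)"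
proof -
  obtain b where b: "ccross c0 b \<noteq> 0" using exists_ccross_nonzero [OF assms] by blast
  define W where "W = {c. ccross c b \<noteq> 0}"
  define s where "s c = frame (normalize_vec (ccross c b)) (normalize_vec c)" for c
  have "smooth_map UNIV (\<lambda>c. ccross c b)" by (intro smooth_intros open_UNIV)
  then have W: "open W"
    unfolding W_def by (intro open_Collect_neq smooth_map_imp_continuous_on continuous_on_const)
  have nz: "c \<noteq> 0" if "c \<in> W" for c
    using that by (auto simp: W_def ccross_def vec_eq_iff forall_3)
  have "smooth_map W s"
    unfolding s_def by (intro smooth_intros W; (erule nz | simp add: W_def))
  moreover have "s c \<in> carrier SU3" if "c \<in> W" for c
    unfolding s_def by (rule frame_normalize_SU3) (use that nz [OF that] in \<open>simp_all add: W_def\<close>)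
  moreover have "s c *v unit_vec 3 = normalize_vec c" for c by (simp add: s_def)
  moreover have "c0 \<in> W" using b by (simp add: W_def)
  ultimately show ?thesis
    using nz by blast
qed

text \<open>Projecting \<open>e\<close> to the line of \<open>z\<close> gives a multiple of
  \<open>z\<close>; normalizing leaves only a phase, which \<open>outer\<close> forgets.\<close>

lemma outer_normalize_vec:
  assumes "hdot z z = 1" "outer z z *v e \<noteq> 0"
  shows "outer (normalize_vec (outer z z *v e)) (normalize_vec (outer z z *v e)) = outer z z"
proof -
  define t where "t = hdot z e"
  have v: "outer z z *v e = t *s z" by (simp add: outer_mult_vec t_def)
  define n where "n = norm (t *s z)"
  have nn: "t * cnj t = complex_of_real n * complex_of_real n"
    using hdot_scale [of t z] assms(1) by (simp add: hdot_self n_def power2_eq_square)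
  have "n \<noteq> 0" using assms(2) v by (simp add: n_def)
  then have "inverse (of_real n) * inverse (of_real n) * (t * cnj t) = 1"
    unfolding nn by (simp add: field_simps)
  then have "(inverse (of_real n) * t) * cnj (inverse (of_real n) * t) = 1" by (simp add: mult_ac)
  moreover have "normalize_vec (outer z z *v e) = (inverse (of_real n) * t) *s z"
    by (simp add: v normalize_vec_def n_def vec_eq_iff scaleR_conv_of_real [where 'a = complex] mult_ac)
  ultimately show ?thesis by (simp only: outer_phase)
qed

text \<open>
  Away from the orbit \<open>|w| = 1/2\<close> the larger eigenvalue of \<open>P\<close> is simple, so that its eigenline
  depends smoothly on \<open>(P, w)\<close>.
\<close>

lemma top_eigenvector:
  assumes y0: "y0 \<in> HP2_model" "norm (snd y0) < 1 / 2"
  shows "\<exists>W f. y0 \<in> W \<and> smooth_map W f \<and> (\<forall>y\<in>W. norm (snd y) < 1 / 2) \<and>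
    (\<forall>y\<in>W. f y \<noteq> 0) \<and> (\<forall>y\<in>W \<inter> HP2_model. outer (normalize_vec (f y)) (normalize_vec (f y)) = top_projection y)"
proof -
  have top: "\<exists>z. hdot z z = 1 \<and> top_projection y = outer z z" if y: "y \<in> HP2_model" "norm (snd y) < 1 / 2" for y
  proof -
    obtain g where g: "g \<in> carrier SU3" "y = act g (normal_form (norm (snd y)))"
      using HP2_model_normal_form_norm [OF y(1)] by blast
    then have "top_projection y = outer (g *v unit_vec 3) (g *v unit_vec 3)"
      using y by (metis norm_ge_zero top_projection_act_normal_form)
    moreover have "hdot (g *v unit_vec 3) (g *v unit_vec 3) = 1"
      by (simp add: hdot_unitary SU3.unitary g(1))
    ultimately show ?thesis by blast
  qed
  obtain z where z: "hdot z z = 1" "top_projection y0 = outer z z" using top y0 by blast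
  define V where "V = {y :: (complex^3^3) \<times> (complex^3). norm (snd y) < 1 / 2}"
  \<comment> \<open>An eigenvector at \<open>y0\<close>, projected to the moving eigenline; it stays
    nonzero near \<open>y0\<close>.\<close>
  define f where "f y = top_projection y *v z" for y
  have oV: "open V" unfolding V_def by (intro open_Collect_less continuous_intros)
  have sV: "smooth_map V f"
    unfolding f_def by (intro smooth_intros smooth_map_top_projection oV) (auto simp: V_def)
  define W where "W = V \<inter> f -` (- {0})"
  have "open W"
    unfolding W_def using smooth_map_imp_continuous_on [OF sV] oV
    by (intro continuous_open_preimage) (auto simp: open_Compl)
  then have "smooth_map W f" using sV smooth_map_subset by (auto simp: W_def)
  moreover have "f y0 = z" by (simp add: f_def z outer_mult_vec)
  then have "y0 \<in> W" using z y0 by (auto simp: W_def V_def hdot_def)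
  moreover have "outer (normalize_vec (f y)) (normalize_vec (f y)) = top_projection y" if "y \<in> W \<inter> HP2_model" for y
  proof -
    have "y \<in> HP2_model" "norm (snd y) < 1 / 2" using that by (auto simp: W_def V_def)
    then obtain x where x: "hdot x x = 1" "top_projection y = outer x x" using top by blast
    then show ?thesis using outer_normalize_vec [OF x(1), of z] that by (simp add: f_def W_def)
  qed
  ultimately show ?thesis by (intro exI [of _ W] exI [of _ f]) (auto simp: W_def V_def)
qed

text \<open>The smooth eigenvector is completed to a frame. The orbit CP(2), the space
  \<open>CP2\<close> and the disc bundle over it take their sections from here.\<close>

lemma top_section:
  assumes y0: "y0 \<in> HP2_model" "norm (snd y0) < 1 / 2"
  shows "\<exists>W s. y0 \<in> W \<and> smooth_map W s \<and> (\<forall>y\<in>W. norm (snd y) < 1 / 2) \<and>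
    (\<forall>y\<in>W \<inter> HP2_model. s y \<in> carrier SU3 \<and> outer (s y *v unit_vec 3) (s y *v unit_vec 3) = top_projection y)"
proof -
  obtain W f where f: "y0 \<in> W" "smooth_map W f" "\<forall>y\<in>W. norm (snd y) < 1 / 2" "\<forall>y\<in>W. f y \<noteq> 0"
    "\<forall>y\<in>W \<inter> HP2_model. outer (normalize_vec (f y)) (normalize_vec (f y)) = top_projection y"
    using top_eigenvector [OF assms] by blast
  obtain W' s where s: "f y0 \<in> W'" "smooth_map W' s"
    "\<forall>c\<in>W'. c \<noteq> 0 \<and> s c \<in> carrier SU3 \<and> s c *v unit_vec 3 = normalize_vec c"
    using third_column_section f by metis
  have "open (W \<inter> f -` W')"
    using smooth_map_imp_continuous_on [OF f(2)] smooth_map_open [OF f(2)] smooth_map_open [OF s(2)]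
    by (intro continuous_open_preimage)
  then have "smooth_map (W \<inter> f -` W') (\<lambda>y. s (f y))"
    using f(2) s(2) smooth_map_subset by (intro smooth_map_compose [OF s(2)]) auto
  then show ?thesis
    using f s by (intro exI [of _ "W \<inter> f -` W'"] exI [of _ "\<lambda>y. s (f y)"]) auto
qed

section \<open>Principal orbits as Aloff-Wallach spaces\<close>

lemma ccross_ccross: "ccross z (ccross u v) = hdot z v *s u - hdot z u *s v"
  by (simp add: vec_eq_iff forall_3 hdot_def sum_3 algebra_simps)

text \<open>
  A point \<open>(P, w)\<close> is determined by \<open>|w|\<close>, the direction of \<open>w\<close> and the top eigenline of \<open>P\<close>.
\<close>

lemma act_frame_normal_form:
  assumes g: "g \<in> carrier SU3" and cc: "hdot c c = 1"
    and c: "outer c c = outer (g *v unit_vec 3) (g *v unit_vec 3)"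
  defines "h \<equiv> frame (ccross (g *v unit_vec 2) c) c"
  shows "h \<in> carrier SU3" "act h (normal_form r) = act g (normal_form r)"
proof -
  define b where "b = g *v unit_vec 2"
  have bb: "hdot b b = 1" using hdot_unitary SU3.unitary g by (simp add: b_def)
  have "outer c c *v b = hdot c b *s c" by (rule outer_mult_vec)
  moreover have "outer c c *v b = 0"
    unfolding c outer_mult_vec b_def hdot_unitary [OF SU3.unitary [OF g]] by simp
  ultimately have "hdot c b *s c = 0" by simp
  moreover have "c \<noteq> 0" using cc by (auto simp: hdot_def)
  ultimately have cb: "hdot c b = 0" by (auto simp: vec_eq_iff)
  have h: "h = frame (ccross b c) c" by (simp add: h_def b_def)
  have bc: "hdot b c = 0" using cb hdot_commute [of b c] by simp
  show h_in: "h \<in> carrier SU3"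
    unfolding h by (rule frame_SU3) (use hdot_ccross_self [of b c] bb cc bc in simp_all)
  have cols: "h *v unit_vec 2 = b" "h *v unit_vec 3 = c"
    by (simp_all add: h ccross_ccross cc cb)
  \<comment> \<open>The first columns of \<open>h\<close> and \<open>g\<close> may differ by a
    phase, but their projections agree: each is the identity minus the projections onto the other
    two columns.\<close>
  have "outer (h *v unit_vec 1) (h *v unit_vec 1) = mat 1 - outer b b - outer c c"
    using sum_outer_frame [OF h_in] by (simp add: cols algebra_simps)
  also have "\<dots> = outer (g *v unit_vec 1) (g *v unit_vec 1)"
    using sum_outer_frame [OF g] by (simp add: c b_def algebra_simps)
  finally show "act h (normal_form r) = act g (normal_form r)"
    using c by (simp add: act_def normal_form_def matrix_distribs outer_conjugate cols b_def
        matrix_vector_scaleR_right)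
qed

text \<open>The direction of w gives the second column and a smooth top eigenvector the third. The
  latter is correct only up to a phase, which \<open>act_frame_normal_form\<close> shows to be
  harmless.\<close>

lemma principal_section:
  assumes r: "0 < r" "r < 1 / 2" and y0: "y0 \<in> (\<lambda>g. act g (normal_form r)) ` carrier SU3"
  shows "\<exists>W s. y0 \<in> W \<and> smooth_map W s \<and> (\<forall>y\<in>W \<inter> (\<lambda>g. act g (normal_form r)) ` carrier SU3.
     s y \<in> carrier SU3 \<and> act (s y) (normal_form r) = y)"
proof -
  have orbit: "(\<lambda>g. act g (normal_form r)) ` carrier SU3 = {y \<in> HP2_model. norm (snd y) = r}"
    using r by (intro normal_form_orbit) auto
  obtain W f where f: "y0 \<in> W" "smooth_map W f" "\<forall>y\<in>W. f y \<noteq> 0"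
    "\<forall>y\<in>W \<inter> HP2_model. outer (normalize_vec (f y)) (normalize_vec (f y)) = top_projection y"
    using top_eigenvector [of y0] y0 r unfolding orbit by blast
  define W' where "W' = W \<inter> {y. snd y \<noteq> 0}"
  define s where "s y = frame (ccross (normalize_vec (snd y)) (normalize_vec (f y))) (normalize_vec (f y))" for y
  have "open {y :: (complex^3^3) \<times> (complex^3). snd y \<noteq> 0}" by (intro open_Collect_neq continuous_intros)
  then have oW': "open W'" using smooth_map_open [OF f(2)] by (simp add: W'_def open_Int)
  then have "smooth_map W' f" using f(2) smooth_map_subset by (auto simp: W'_def)
  then have "smooth_map W' s"
    unfolding s_def by (intro smooth_intros oW') (use f(3) in \<open>auto simp: W'_def\<close>)
  moreover have "y0 \<in> W'" using f(1) y0 r unfolding orbit by (auto simp: W'_def)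
  moreover have "s y \<in> carrier SU3 \<and> act (s y) (normal_form r) = y"
    if y: "y \<in> W' \<inter> (\<lambda>g. act g (normal_form r)) ` carrier SU3" for y
  proof -
    obtain g where g: "g \<in> carrier SU3" "y = act g (normal_form r)" using y by blast
    have yr: "norm (snd y) = r" "y \<in> HP2_model" using y unfolding orbit by auto
    define b c where "b = normalize_vec (snd y)" and "c = normalize_vec (f y)"
    have "snd y = r *\<^sub>R (g *v unit_vec 2)" by (simp add: g act_def normal_form_def matrix_vector_scaleR_right)
    then have b: "b = g *v unit_vec 2" "snd y = r *\<^sub>R b" using r yr by (simp_all add: b_def normalize_vec_def)
    have cc: "hdot c c = 1" using f(3) y by (simp add: c_def W'_def hdot_normalize_vec)
    have c: "outer c c = outer (g *v unit_vec 3) (g *v unit_vec 3)"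
      using f(4) y yr top_projection_act_normal_form [OF g(1), of r] r g by (auto simp: c_def W'_def)
    have "s y = frame (ccross (g *v unit_vec 2) c) c"
      unfolding s_def b_def [symmetric] c_def [symmetric] b(1) ..
    then show ?thesis using act_frame_normal_form [OF g(1) cc c] g(2) by simp
  qed
  ultimately show ?thesis by blast
qed

text \<open>One orbit with two base points, \<open>normal_form r\<close> and
  \<open>act cyc (normal_form r)\<close>, whose isotropy groups are \<open>U1 1 0\<close> and
  \<open>U1 1 (-1)\<close>. Sections for the second are those for the first times
  \<open>dag cyc\<close>.\<close>

lemma Aloff_Wallach_model:
  assumes r: "0 < r" "r < 1 / 2"
  shows "\<exists>\<psi>. equivariant_diffeomorphism SU3 (Aloff_Wallach 1 0) (coset_action SU3)
      (euclidean_subset {y \<in> HP2_model. norm (snd y) = r}) act \<psi>"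
    "\<exists>\<psi>. equivariant_diffeomorphism SU3 (Aloff_Wallach 1 (-1)) (coset_action SU3)
      (euclidean_subset {y \<in> HP2_model. norm (snd y) = r}) act \<psi>"
proof -
  have orbit: "(\<lambda>g. act g (normal_form r)) ` carrier SU3 = {y \<in> HP2_model. norm (snd y) = r}"
    using r by (intro normal_form_orbit) auto
  show "\<exists>\<psi>. equivariant_diffeomorphism SU3 (Aloff_Wallach 1 0) (coset_action SU3)
      (euclidean_subset {y \<in> HP2_model. norm (snd y) = r}) act \<psi>"
    using isotropy_model [OF principal_section [OF r]]
    unfolding isotropy_normal_form [OF r] orbit Aloff_Wallach_def .
  have "(\<lambda>g. act g (act cyc (normal_form r))) ` carrier SU3 = (\<lambda>g. act g (normal_form r)) ` carrier SU3"
  proof (intro equalityI subsetI)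
    fix y assume "y \<in> (\<lambda>g. act g (normal_form r)) ` carrier SU3"
    then obtain g where g: "g \<in> carrier SU3" "y = act g (normal_form r)" by blast
    then have "y = act (g ** dag cyc) (act cyc (normal_form r))"
      by (simp add: act_mult act_cancel cyc)
    then show "y \<in> (\<lambda>g. act g (act cyc (normal_form r))) ` carrier SU3"
      using g SU3.mult SU3.dag cyc by blast
  next
    fix y assume "y \<in> (\<lambda>g. act g (act cyc (normal_form r))) ` carrier SU3"
    then obtain g where "g \<in> carrier SU3" "y = act (g ** cyc) (normal_form r)" by (auto simp: act_mult)
    then show "y \<in> (\<lambda>g. act g (normal_form r)) ` carrier SU3" using SU3.mult cyc by blast
  qed
  note orbit' = this
  have "\<exists>W s. y \<in> W \<and> smooth_map W s \<and> (\<forall>y'\<in>W \<inter> (\<lambda>g. act g (act cyc (normal_form r))) ` carrier SU3.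
      s y' \<in> carrier SU3 \<and> act (s y') (act cyc (normal_form r)) = y')"
    if y: "y \<in> (\<lambda>g. act g (act cyc (normal_form r))) ` carrier SU3" for y
  proof -
    obtain W s where W: "y \<in> W" "smooth_map W s" "\<forall>y\<in>W \<inter> (\<lambda>g. act g (normal_form r)) ` carrier SU3.
        s y \<in> carrier SU3 \<and> act (s y) (normal_form r) = y"
      using principal_section [OF r y [unfolded orbit']] by blast
    have "smooth_map W (\<lambda>y. s y ** dag cyc)"
      by (intro smooth_intros W smooth_map_open [OF W(2)])
    then show ?thesis
      using W(1,3) unfolding orbit'
      by (intro exI [of _ W] exI [of _ "\<lambda>y. s y ** dag cyc"])
         (simp add: act_mult act_cancel cyc SU3.mult SU3.dag)
  qed
  from isotropy_model [OF this]
  show "\<exists>\<psi>. equivariant_diffeomorphism SU3 (Aloff_Wallach 1 (-1)) (coset_action SU3)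
      (euclidean_subset {y \<in> HP2_model. norm (snd y) = r}) act \<psi>"
    unfolding isotropy_cyc_normal_form [OF r] orbit' orbit Aloff_Wallach_def .
qed

section \<open>The orbit CP(2)\<close>

lemma fst_act_normal_form_0:
  "g \<in> carrier SU3 \<Longrightarrow> act g (normal_form 0) = (outer (g *v unit_vec 3) (g *v unit_vec 3), 0)"
  by (simp add: act_def normal_form_def outer_conjugate)

lemma CP2_orbit_model:
  "\<exists>\<psi>. equivariant_diffeomorphism SU3 (homogeneous_space SU3 U2) (coset_action SU3)
      (euclidean_subset {y \<in> HP2_model. norm (snd y) = 0}) act \<psi>"
proof -
  have orbit: "(\<lambda>g. act g (normal_form 0)) ` carrier SU3 = {y \<in> HP2_model. norm (snd y) = 0}"
    by (intro normal_form_orbit) auto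
  have "\<exists>W s. y0 \<in> W \<and> smooth_map W s \<and> (\<forall>y\<in>W \<inter> (\<lambda>g. act g (normal_form 0)) ` carrier SU3.
     s y \<in> carrier SU3 \<and> act (s y) (normal_form 0) = y)"
    if "y0 \<in> (\<lambda>g. act g (normal_form 0)) ` carrier SU3" for y0
  proof -
    have "y0 \<in> HP2_model" "norm (snd y0) < 1 / 2" using that unfolding orbit by auto
    then obtain W s where W: "y0 \<in> W" "smooth_map W s" "\<forall>y\<in>W \<inter> HP2_model. s y \<in> carrier SU3 \<and>
        outer (s y *v unit_vec 3) (s y *v unit_vec 3) = top_projection y"
      using top_section by blast
    have "s y \<in> carrier SU3 \<and> act (s y) (normal_form 0) = y"
      if y: "y \<in> W \<inter> (\<lambda>g. act g (normal_form 0)) ` carrier SU3" for y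
    proof -
      obtain g where g: "g \<in> carrier SU3" "y = act g (normal_form 0)" using y by blast
      have "y \<in> HP2_model" using y unfolding orbit by auto
      then have s: "s y \<in> carrier SU3" "outer (s y *v unit_vec 3) (s y *v unit_vec 3) = top_projection y"
        using W y by auto
      then show ?thesis
        using top_projection_act_normal_form [OF g(1), of 0] g by (simp add: fst_act_normal_form_0)
    qed
    then show ?thesis using W by blast
  qed
  from isotropy_model [OF this] show ?thesis
    unfolding isotropy_normal_form_0 orbit .
qed

lemma CP2_action_line: "CP2_action g {c *s z | c. True} = {c *s (g *v z) | c. True}"
proof -
  have "CP2_action g {c *s z | c. True} = {g *v (c *s z) | c. True}" by (auto simp: CP2_action_def)
  then show ?thesis by (simp add: vec.scale)
qed

text \<open>A complex line is encoded by its orthogonal projection, paired with w = 0. All unit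
  vectors on the line give the same projection, so one may be chosen, and the top eigenvector
  provides local sections to the sphere.\<close>

lemma CP2_model:
  "\<exists>\<psi>. equivariant_diffeomorphism SU3 CP2 CP2_action
      (euclidean_subset {y \<in> HP2_model. norm (snd y) = 0}) act \<psi>"
proof -
  let ?Y = "{y \<in> HP2_model. norm (snd y) = 0}"
  let ?line = "\<lambda>z :: complex^3. {c *s z | c. True}"
  let ?\<psi> = "\<lambda>L. (outer (SOME z. z \<in> L \<inter> sphere 0 1) (SOME z. z \<in> L \<inter> sphere 0 1), 0 :: complex^3)"
  have sphere: "z \<in> sphere 0 1 \<longleftrightarrow> hdot z z = 1" for z
  proof -
    have "hdot z z = 1 \<longleftrightarrow> (norm z)\<^sup>2 = 1"
      unfolding hdot_self by (metis of_real_1 of_real_eq_iff)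
    then show ?thesis by (simp add: power2_eq_1_iff) (metis norm_ge_zero neg_0_le_iff_le not_one_le_zero)
  qed
  have orbit: "(\<lambda>g. act g (normal_form 0)) ` carrier SU3 = ?Y"
    by (intro normal_form_orbit) auto
  have Y: "?Y = (\<lambda>z. (outer z z, 0)) ` sphere 0 1"
  proof (intro equalityI subsetI)
    fix y assume "y \<in> ?Y"
    then obtain g where g: "g \<in> carrier SU3" "y = act g (normal_form 0)" unfolding orbit [symmetric] by blast
    then have "g *v unit_vec 3 \<in> sphere 0 1" unfolding sphere by (simp add: hdot_unitary SU3.unitary)
    then show "y \<in> (\<lambda>z. (outer z z, 0)) ` sphere 0 1" using g by (auto simp: fst_act_normal_form_0)
  next
    fix y assume "y \<in> (\<lambda>z. (outer z z, 0 :: complex^3)) ` sphere 0 1"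
    then obtain z where z: "z \<in> sphere 0 1" "y = (outer z z, 0)" by blast
    then obtain g where "g \<in> carrier SU3" "g *v unit_vec 3 = z" using exists_SU3_third_column sphere by blast
    then show "y \<in> ?Y" using z unfolding orbit [symmetric] by (force simp: fst_act_normal_form_0)
  qed
  have outer_eq: "outer (c *s z) (c *s z) = outer z z" if "c *s z \<in> sphere 0 1" "z \<in> sphere 0 1" for c z
  proof -
    have "c * cnj c = 1" using that unfolding sphere hdot_scale by simp
    then show ?thesis by (rule outer_phase)
  qed
  have \<psi>: "?\<psi> (?line z) = (outer z z, 0)" if z: "z \<in> sphere 0 1" for z
  proof -
    have "1 *s z \<in> ?line z" by blast
    then have "z \<in> ?line z \<inter> sphere 0 1" using z by simp
    then have "(SOME z'. z' \<in> ?line z \<inter> sphere 0 1) \<in> ?line z \<inter> sphere 0 1" by (rule someI)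
    then show ?thesis using outer_eq z by auto
  qed
  have diffeo: "diffeomorphism CP2 (euclidean_subset ?Y) ?\<psi>"
    unfolding CP2_def S5_def
  proof (rule diffeomorphism_euclidean_quotient [where \<Phi> = "\<lambda>z. (outer z z, 0)" and D = UNIV])
    show "smooth_map UNIV (\<lambda>z. (outer z z, 0 :: complex^3))" by (intro smooth_intros open_UNIV)
    show "?line z = ?line z'" if "z \<in> sphere 0 1" "z' \<in> sphere 0 1" "(outer z z, 0 :: complex^3) = (outer z' z', 0)" for z z'
    proof -
      have sub: "?line x \<subseteq> ?line x'" if "x \<in> sphere 0 1" "outer x x = outer x' x'" for x x'
      proof -
        have "x = outer x x *v x" using that(1) unfolding sphere by (simp add: outer_mult_vec)
        also have "\<dots> = hdot x' x *s x'" by (simp add: that(2) outer_mult_vec)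
        finally obtain d where "x = d *s x'" by blast
        then show ?thesis by (auto simp: vector_smult_assoc)
      qed
      show ?thesis using that sub [of z z'] sub [of z' z] by auto
    qed
    fix y0 assume "y0 \<in> ?Y"
    then have "y0 \<in> HP2_model" "norm (snd y0) < 1 / 2" by auto
    then obtain W s where W: "y0 \<in> W" "smooth_map W s" "\<forall>y\<in>W \<inter> HP2_model. s y \<in> carrier SU3 \<and>
        outer (s y *v unit_vec 3) (s y *v unit_vec 3) = top_projection y"
      using top_section by blast
    have "smooth_map W (\<lambda>y. s y *v unit_vec 3)"
      by (intro smooth_intros W smooth_map_open [OF W(2)])
    moreover have "s y *v unit_vec 3 \<in> sphere 0 1 \<and> (outer (s y *v unit_vec 3) (s y *v unit_vec 3), 0) = y"
      if y: "y \<in> W \<inter> ?Y" for y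
    proof -
      obtain g where g: "g \<in> carrier SU3" "y = act g (normal_form 0)" using y unfolding orbit [symmetric] by blast
      have s: "s y \<in> carrier SU3" "outer (s y *v unit_vec 3) (s y *v unit_vec 3) = top_projection y" using y W by auto
      then show ?thesis
        unfolding sphere using top_projection_act_normal_form [OF g(1), of 0] g
        by (simp add: fst_act_normal_form_0 hdot_unitary SU3.unitary)
    qed
    ultimately show "\<exists>W s. y0 \<in> W \<and> smooth_map W s \<and>
        (\<forall>y\<in>W \<inter> ?Y. s y \<in> sphere 0 1 \<and> (outer (s y) (s y), 0) = y)"
      using W(1) by blast
  qed (use \<psi> Y in auto)
  have "?\<psi> (CP2_action g L) = act g (?\<psi> L)" if g: "g \<in> carrier SU3" and "L \<in> points CP2" for g L
  proof -
    obtain z where z: "z \<in> sphere 0 1" "L = ?line z" using \<open>L \<in> points CP2\<close> by (auto simp: CP2_def S5_def)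
    have "CP2_action g L = ?line (g *v z)" unfolding z(2) by (rule CP2_action_line)
    moreover have "g *v z \<in> sphere 0 1" using z(1) g unfolding sphere by (simp add: hdot_unitary SU3.unitary)
    ultimately show ?thesis
      using \<psi> z by (simp only:) (simp add: act_def outer_conjugate)
  qed
  then show ?thesis using diffeo unfolding equivariant_diffeomorphism_def by blast
qed

section \<open>The orbit S^5 and SU(3)/SU(2)\<close>

lemma S5_model:
  "equivariant_diffeomorphism SU3 S5 S5_action (euclidean_subset {y \<in> HP2_model. norm (snd y) = 1 / 2}) act S5_point"
proof -
  have orbit: "(\<lambda>g. act g (normal_form (1 / 2))) ` carrier SU3 = {y \<in> HP2_model. norm (snd y) = 1 / 2}"
    by (intro normal_form_orbit) auto
  have image: "{y \<in> HP2_model. norm (snd y) = 1 / 2} = S5_point ` sphere 0 1"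
    unfolding orbit [symmetric]
  proof (intro equalityI subsetI)
    fix y assume "y \<in> (\<lambda>g. act g (normal_form (1 / 2))) ` carrier SU3"
    then obtain g where g: "g \<in> carrier SU3" "y = S5_point (g *v unit_vec 2)"
      by (auto simp: normal_form_half act_S5_point)
    then have "g *v unit_vec 2 \<in> sphere 0 1" using norm_unitary SU3.unitary by (simp add: norm_axis_1)
    then show "y \<in> S5_point ` sphere 0 1" using g by blast
  next
    fix y assume "y \<in> S5_point ` sphere 0 1"
    then obtain w where w: "norm w = 1" "y = S5_point w" by auto
    then obtain g where g: "g \<in> carrier SU3" "g *v unit_vec 3 = w"
      using exists_SU3_third_column [of w] by (auto simp: hdot_self)
    \<comment> \<open>\<open>cyc\<close> moves \<open>unit_vec 2\<close>, the direction of w in the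
      normal form, to \<open>unit_vec 3\<close>.\<close>
    then have "y = act (g ** cyc) (normal_form (1 / 2))"
      using w by (simp add: act_mult normal_form_half act_S5_point cyc cyc_unit_vec)
    then show "y \<in> (\<lambda>g. act g (normal_form (1 / 2))) ` carrier SU3" using g SU3.mult cyc by blast
  qed
  have "diffeomorphism (euclidean_subset (sphere 0 1)) (euclidean_subset (S5_point ` sphere 0 1)) S5_point"
  proof (rule diffeomorphism_euclidean)
    show "smooth_map UNIV S5_point" unfolding S5_point_def by (intro smooth_intros open_UNIV)
    show "smooth_map UNIV (\<lambda>y :: (complex^3^3) \<times> (complex^3). 2 *\<^sub>R snd y)" by (intro smooth_intros open_UNIV)
  qed (auto simp: S5_point_def)
  then show ?thesis
    unfolding image equivariant_diffeomorphism_def by (simp add: S5_def act_S5_point S5_action_def)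
qed

lemma SU3_SU2_model:
  "\<exists>\<psi>. equivariant_diffeomorphism SU3 (homogeneous_space SU3 SU2) (coset_action SU3) S5 S5_action \<psi>"
proof -
  interpret unitary_subgroup "carrier SU3" SU2
    using unitary_subgroup_isotropy [of "S5_point (unit_vec 3)"] by (simp add: isotropy_S5_point)
  show ?thesis
    unfolding S5_def
  proof (rule homogeneous_space_equivariant_model [of "\<lambda>g. g *v unit_vec 3" "sphere 0 1" S5_action,
        unfolded matrix_group_carrier_SU3])
    show "smooth_map UNIV (\<lambda>g :: complex^3^3. g *v unit_vec 3)" by (intro smooth_intros open_UNIV)
    show "g *v unit_vec 3 \<in> sphere 0 1" if "g \<in> carrier SU3" for g
      using that norm_unitary SU3.unitary by (simp add: norm_axis_1)
    show "dag g ** g' \<in> SU2"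
      if "g \<in> carrier SU3" "g' \<in> carrier SU3" "g *v unit_vec 3 = g' *v unit_vec 3" for g g'
      using that SU3.mult SU3.dag SU3.left_inverse
      by (simp add: SU2_eq matrix_vector_mul_assoc [symmetric])
         (simp add: matrix_vector_mul_assoc SU3.left_inverse flip: that(3))
    show "(g ** h) *v unit_vec 3 = g *v unit_vec 3" if "h \<in> SU2" for g h
      using that by (simp add: SU2_eq matrix_vector_mul_assoc [symmetric])
    show "\<exists>W s. w \<in> W \<and> smooth_map W s \<and> (\<forall>y'\<in>W \<inter> sphere 0 1. s y' \<in> carrier SU3 \<and> s y' *v unit_vec 3 = y')"
      if "w \<in> sphere 0 1" for w
    proof -
      have "w \<noteq> 0" using that by auto
      from third_column_section [OF this] obtain W s where W: "w \<in> W" "smooth_map W s"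
        "\<forall>c\<in>W. c \<noteq> 0 \<and> s c \<in> carrier SU3 \<and> s c *v unit_vec 3 = normalize_vec c"
        by blast
      then show ?thesis by (intro exI [of _ W] exI [of _ s]) (simp add: normalize_vec_def)
    qed
  qed (auto simp: S5_action_def matrix_vector_mul_assoc)
qed

section \<open>Charts\<close>

text \<open>By homogeneity one chart is enough: the group transports it to every point, provided
  that its domain meets every orbit in \<open>Y\<close>.\<close>

lemma smooth_manifold_homogeneous:
  fixes \<psi> :: "'a \<Rightarrow> (complex^3^3) \<times> (complex^3)"
  assumes M: "determined_by_values M" "diffeomorphism M (euclidean_subset Y) \<psi>"
    and dim: "DIM('c::euclidean_space) = DIM('e::euclidean_space)"
    and chart: "smooth_map D (c :: _ \<Rightarrow> 'c)" "smooth_map V d"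
      "\<And>y. y \<in> D \<inter> Y \<Longrightarrow> c y \<in> V \<and> d (c y) = y" "\<And>v. v \<in> V \<Longrightarrow> d v \<in> D \<inter> Y \<and> c (d v) = v"
    and invariant: "\<And>g y. g \<in> carrier SU3 \<Longrightarrow> y \<in> Y \<Longrightarrow> act g y \<in> Y"
    and moves: "\<And>y. y \<in> Y \<Longrightarrow> \<exists>g\<in>carrier SU3. act g y \<in> D"
  shows "smooth_manifold TYPE('e) M"
proof (rule smooth_manifold_euclidean_model [OF M dim])
  fix y assume "y \<in> Y"
  then obtain g where g: "g \<in> carrier SU3" "act g y \<in> D" using moves by blast
  have g': "dag g \<in> carrier SU3" by (rule SU3.dag [OF g(1)])
  have s: "smooth_map UNIV (act g)" "smooth_map UNIV (act (dag g))" by (intro smooth_intros open_UNIV)+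
  have "open (act g -` D)"
    using s(1) chart(1) smooth_map_imp_continuous_on smooth_map_open open_vimage by blast
  then have "smooth_map (act g -` D) (\<lambda>y. c (act g y))"
    using s(1) smooth_map_subset by (intro smooth_map_compose [OF chart(1)]) auto
  moreover have "smooth_map V (\<lambda>v. act (dag g) (d v))"
    by (intro smooth_intros chart(2) smooth_map_open [OF chart(2)])
  moreover have "c (act g x) \<in> V \<and> act (dag g) (d (c (act g x))) = x" if "x \<in> act g -` D \<inter> Y" for x
    using that chart(3) [of "act g x"] invariant g by (simp add: act_cancel)
  moreover have "act (dag g) (d v) \<in> act g -` D \<inter> Y \<and> c (act g (act (dag g) (d v))) = v" if "v \<in> V" for v
    using chart(4) [OF that] invariant g g' by (simp add: act_cancel)
  ultimately show "\<exists>D V (c :: _ \<Rightarrow> 'c) d. y \<in> D \<and> smooth_map D c \<and> smooth_map V d \<and>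
      (\<forall>y'\<in>D \<inter> Y. c y' \<in> V \<and> d (c y') = y') \<and> (\<forall>v\<in>V. d v \<in> D \<inter> Y \<and> c (d v) = v)"
    using g(2) by (intro exI [of _ "act g -` D"] exI [of _ V] exI [of _ "\<lambda>y. c (act g y)"]
        exI [of _ "\<lambda>v. act (dag g) (d v)"]) auto
qed

section \<open>Affine charts of HP(2) and CP(2)\<close>

lemma line_point_scaleR: "line_point (c *\<^sub>R z) (c *\<^sub>R u) = c\<^sup>2 *\<^sub>R line_point z u"
  by (simp add: line_point_def outer_scaleR ccross_scaleR power2_eq_square scaleR_add_right)

definition affine_domain :: "((complex^3^3) \<times> (complex^3)) set" where
  "affine_domain = {y. fst y $ 3 $ 3 \<noteq> 0}"

text \<open>Quaternionic affine coordinates. For a representative with u_3 = 0 and z_3 real they are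
  z_1/z_3, z_2/z_3, u_1/z_3 and u_2/z_3.\<close>

definition affine_chart :: "(complex^3^3) \<times> (complex^3) \<Rightarrow> (complex \<times> complex) \<times> (complex \<times> complex)" where
  "affine_chart y = ((fst y $ 1 $ 3 / fst y $ 3 $ 3, fst y $ 2 $ 3 / fst y $ 3 $ 3),
     (cnj (snd y $ 2) / fst y $ 3 $ 3, - cnj (snd y $ 1) / fst y $ 3 $ 3))"

definition affine_point :: "(complex \<times> complex) \<times> (complex \<times> complex) \<Rightarrow> (complex^3^3) \<times> (complex^3)" where
  "affine_point v = (let z = vector [fst (fst v), snd (fst v), 1]; u = vector [fst (snd v), snd (snd v), 0]
     in inverse ((norm z)\<^sup>2 + (norm u)\<^sup>2) *\<^sub>R line_point z u)"

lemma open_affine_domain: "open affine_domain"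
proof -
  have "smooth_map UNIV (\<lambda>y :: (complex^3^3) \<times> (complex^3). fst y $ 3 $ 3)" by (intro smooth_intros open_UNIV)
  then show ?thesis
    unfolding affine_domain_def
    by (intro open_Collect_neq smooth_map_imp_continuous_on continuous_on_const)
qed

lemma smooth_map_affine_chart: "smooth_map affine_domain affine_chart"
  unfolding affine_chart_def by (intro smooth_intros open_affine_domain) (auto simp: affine_domain_def)

lemma smooth_map_affine_point: "smooth_map UNIV affine_point"
proof -
  have "(vector [a, b, 1] :: complex^3) \<noteq> 0" for a b by (simp add: vec_eq_iff forall_3)
  then have "(norm (vector [a, b, 1] :: complex^3))\<^sup>2 + (norm u)\<^sup>2 \<noteq> 0" for a b and u :: "complex^3"
    by (simp add: sum_power2_eq_zero_iff)
  note nonzero = this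
  show ?thesis
    unfolding affine_point_def Let_def by (intro smooth_intros open_UNIV; rule nonzero)
qed

lemma affine_point:
  shows "affine_point v \<in> affine_domain \<inter> HP2_model" "affine_chart (affine_point v) = v"
    "snd v = 0 \<Longrightarrow> snd (affine_point v) = 0"
proof -
  define z :: "complex^3" where "z = vector [fst (fst v), snd (fst v), 1]"
  define u :: "complex^3" where "u = vector [fst (snd v), snd (snd v), 0]"
  define n where "n = inverse ((norm z)\<^sup>2 + (norm u)\<^sup>2)"
  have "z \<noteq> 0" by (simp add: z_def vec_eq_iff forall_3)
  then have pos: "(norm z)\<^sup>2 + (norm u)\<^sup>2 > 0" by (simp add: add_pos_nonneg)
  then have n: "n > 0" by (simp add: n_def)
  have p: "affine_point v = n *\<^sub>R line_point z u" by (simp add: affine_point_def z_def u_def n_def Let_def)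
  also have "\<dots> = line_point (sqrt n *\<^sub>R z) (sqrt n *\<^sub>R u)" using n by (simp add: line_point_scaleR)
  finally have p': "affine_point v = line_point (sqrt n *\<^sub>R z) (sqrt n *\<^sub>R u)" .
  have "hdot (sqrt n *\<^sub>R z) (sqrt n *\<^sub>R z) + hdot (sqrt n *\<^sub>R u) (sqrt n *\<^sub>R u) =
      of_real (n * ((norm z)\<^sup>2 + (norm u)\<^sup>2))"
  proof -
    have "(complex_of_real (sqrt n))\<^sup>2 = of_real n" using n by (simp flip: of_real_power)
    then show ?thesis by (simp add: hdot_self power_mult_distrib distrib_left)
  qed
  also have "n * ((norm z)\<^sup>2 + (norm u)\<^sup>2) = 1" unfolding n_def by (intro left_inverse) (use pos in linarith)
  finally have "hdot (sqrt n *\<^sub>R z) (sqrt n *\<^sub>R z) + hdot (sqrt n *\<^sub>R u) (sqrt n *\<^sub>R u) = 1"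
    by (simp only: of_real_1)
  then have "affine_point v \<in> HP2_model"
    unfolding HP2_model_def p' by blast
  moreover have "affine_point v \<in> affine_domain"
    unfolding p using n by (simp add: affine_domain_def line_point_def z_def u_def)
  ultimately show "affine_point v \<in> affine_domain \<inter> HP2_model" by simp
  show "affine_chart (affine_point v) = v"
    unfolding p using n
    by (simp add: affine_chart_def line_point_def z_def u_def prod_eq_iff scaleR_conv_of_real [where 'a = complex])
  show "snd (affine_point v) = 0" if "snd v = 0"
    unfolding p using that by (simp add: line_point_def u_def vec_eq_iff forall_3)
qed

lemma affine_point_chart:
  assumes "y \<in> affine_domain \<inter> HP2_model"
  shows "affine_point (affine_chart y) = y"
proof -
  obtain z0 u0 where y0: "y = line_point z0 u0" "hdot z0 z0 + hdot u0 u0 = 1"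
    using assms by (auto simp: HP2_model_def)
  define N where "N = sqrt ((cmod (z0$3))\<^sup>2 + (cmod (u0$3))\<^sup>2)"
  have "(complex_of_real N)\<^sup>2 = of_real ((cmod (z0$3))\<^sup>2 + (cmod (u0$3))\<^sup>2)"
    by (simp add: N_def add_nonneg_nonneg flip: of_real_power)
  then have N2: "complex_of_real N * complex_of_real N = z0$3 * cnj (z0$3) + u0$3 * cnj (u0$3)"
    by (simp only: power2_eq_square [of "complex_of_real N"] of_real_add complex_norm_square)
  then have "complex_of_real N * complex_of_real N \<noteq> 0"
    using assms by (simp add: affine_domain_def y0(1) line_point_def)
  then have N: "N \<noteq> 0" by simp
  \<comment> \<open>This element of SU(2) makes the third coordinate of \<open>u\<close> vanish and
    that of \<open>z\<close> equal to \<open>N\<close>, the modulus of the third quaternionic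
    coordinate.\<close>
  define \<alpha> \<beta> where "\<alpha> = cnj (z0$3) / N" and "\<beta> = cnj (u0$3) / N"
  define z u where "z = \<alpha> *s z0 + \<beta> *s u0" and "u = - cnj \<beta> *s z0 + cnj \<alpha> *s u0"
  have "\<alpha> * cnj \<alpha> + \<beta> * cnj \<beta> = (z0$3 * cnj (z0$3) + u0$3 * cnj (u0$3)) / (complex_of_real N * complex_of_real N)"
    by (simp add: \<alpha>_def \<beta>_def add_divide_distrib mult.commute)
  also have "\<dots> = 1" using N by (simp flip: N2)
  finally have y: "y = line_point z u"
    unfolding z_def u_def y0 by (rule line_point_rotate [symmetric])
  have "z$3 = (z0$3 * cnj (z0$3) + u0$3 * cnj (u0$3)) / N"
    by (simp add: z_def \<alpha>_def \<beta>_def add_divide_distrib mult.commute)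
  then have z3: "z$3 = N" using N by (simp flip: N2)
  have u3: "u$3 = 0" by (simp add: u_def \<alpha>_def \<beta>_def mult.commute)
  have "hdot z z + hdot u u = 1" using y0 y by (simp add: line_point_trace)
  then have "complex_of_real ((norm z)\<^sup>2 + (norm u)\<^sup>2) = of_real 1" by (simp add: hdot_self)
  then have n: "(norm z)\<^sup>2 + (norm u)\<^sup>2 = 1" using of_real_eq_iff by blast
  define z' u' where "z' = inverse N *\<^sub>R z" and "u' = inverse N *\<^sub>R u"
  have chart: "affine_chart y = ((z'$1, z'$2), (u'$1, u'$2))"
    using N by (simp add: affine_chart_def y line_point_def z3 u3 z'_def u'_def
        scaleR_conv_of_real [where 'a = complex] field_simps)
  have "vector [z'$1, z'$2, 1] = z'" "vector [u'$1, u'$2, 0] = u'"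
    using N by (simp_all add: vec_eq_iff forall_3 z'_def u'_def z3 u3 scaleR_conv_of_real [where 'a = complex])
  then have "affine_point (affine_chart y) = inverse ((norm z')\<^sup>2 + (norm u')\<^sup>2) *\<^sub>R line_point z' u'"
    by (simp add: chart affine_point_def Let_def)
  also have "(norm z')\<^sup>2 + (norm u')\<^sup>2 = (inverse N)\<^sup>2"
    using n by (simp add: z'_def u'_def power_mult_distrib power_inverse flip: distrib_left)
  also have "line_point z' u' = (inverse N)\<^sup>2 *\<^sub>R y"
    by (simp add: z'_def u'_def line_point_scaleR y)
  finally show ?thesis using N by simp
qed

lemma normal_form_affine_domain:
  assumes "0 \<le> r" "r \<le> 1 / 2"
  shows "normal_form r \<in> affine_domain"
  using top_eigenvalue(2) [OF assms] by (simp add: affine_domain_def normal_form_def axis_def)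

lemma HP2_model_move:
  assumes "y \<in> HP2_model"
  shows "\<exists>g\<in>carrier SU3. act g y = normal_form (norm (snd y))"
proof -
  obtain g where g: "g \<in> carrier SU3" "y = act g (normal_form (norm (snd y)))"
    using HP2_model_normal_form_norm [OF assms] by blast
  then have "act (dag g) y = normal_form (norm (snd y))" by (metis act_cancel(1))
  then show ?thesis using SU3.dag [OF g(1)] by blast
qed

lemma norm_snd_le_half: "y \<in> HP2_model \<Longrightarrow> norm (snd y) \<le> 1 / 2"
  using HP2_model_normal_form_norm by blast

text \<open>The affine domain meets every orbit: at a normal form the entry (3, 3) of P is the top
  eigenvalue, which is at least 1/2.\<close>

lemma smooth_manifold_HP2_model:
  assumes "determined_by_values M" "diffeomorphism M (euclidean_subset HP2_model) \<psi>"
  shows "smooth_manifold TYPE((real^7) \<times> real) M"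
proof (rule smooth_manifold_homogeneous [OF assms _ smooth_map_affine_chart smooth_map_affine_point])
  show "\<exists>g\<in>carrier SU3. act g y \<in> affine_domain" if "y \<in> HP2_model" for y
    using HP2_model_move [OF that] normal_form_affine_domain norm_snd_le_half [OF that] by (metis norm_ge_zero)
qed (use affine_point affine_point_chart act_HP2_model in auto)

text \<open>On w = 0 the second pair of affine coordinates vanishes, which leaves the two complex
  coordinates of the complex projective plane.\<close>

lemma smooth_manifold_CP2_orbit:
  assumes "determined_by_values M" "diffeomorphism M (euclidean_subset {y \<in> HP2_model. norm (snd y) = 0}) \<psi>"
  shows "smooth_manifold TYPE(real^4) M"
proof (rule smooth_manifold_homogeneous [OF assms])
  show "smooth_map affine_domain (\<lambda>y. fst (affine_chart y))"
    by (intro smooth_intros smooth_map_affine_chart)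
  show "smooth_map UNIV (\<lambda>v. affine_point (v, 0))"
    by (rule smooth_map_compose [OF smooth_map_affine_point]) (auto intro!: smooth_intros)
  show "fst (affine_chart y) \<in> UNIV \<and> affine_point (fst (affine_chart y), 0) = y"
    if "y \<in> affine_domain \<inter> {y \<in> HP2_model. norm (snd y) = 0}" for y
  proof -
    have "snd (affine_chart y) = 0" using that by (simp add: affine_chart_def zero_prod_def)
    then have "(fst (affine_chart y), 0) = affine_chart y" by (simp add: prod_eq_iff zero_prod_def)
    then show ?thesis using that affine_point_chart by simp
  qed
  show "affine_point (v, 0) \<in> affine_domain \<inter> {y \<in> HP2_model. norm (snd y) = 0} \<and>
      fst (affine_chart (affine_point (v, 0))) = v" for v
    using affine_point [of "(v, 0)"] by (simp add: zero_prod_def)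
  show "\<exists>g\<in>carrier SU3. act g y \<in> affine_domain" if "y \<in> {y \<in> HP2_model. norm (snd y) = 0}" for y
    using HP2_model_move [of y] normal_form_affine_domain [of 0] that by (auto intro!: bexI)
qed (auto simp: act_HP2_model norm_snd_act act_def [of _ "(_, _)"])

section \<open>Charts of S^5 and of the principal orbits\<close>

lemma norm_vec_3: "(norm (b :: complex^3))\<^sup>2 = (cmod (b$1))\<^sup>2 + (cmod (b$2))\<^sup>2 + (cmod (b$3))\<^sup>2"
  by (simp add: norm_vec_def L2_set_def sum_3 add_nonneg_nonneg)

text \<open>Inverse of the graph chart of an open hemisphere: the real part of the third coordinate
  is recovered from the unit norm.\<close>

definition sphere_lift :: "complex \<Rightarrow> complex \<Rightarrow> real \<Rightarrow> complex^3" where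
  "sphere_lift x y t = vector [x, y, Complex (sqrt (1 - (cmod x)\<^sup>2 - (cmod y)\<^sup>2 - t\<^sup>2)) t]"

lemma sphere_lift:
  assumes "(cmod x)\<^sup>2 + (cmod y)\<^sup>2 + t\<^sup>2 < 1"
  shows "norm (sphere_lift x y t) = 1" "Re (sphere_lift x y t $ 3) > 0"
proof -
  have "(norm (sphere_lift x y t))\<^sup>2 = 1"
    unfolding norm_vec_3 using assms by (simp add: sphere_lift_def cmod_power2)
  then show "norm (sphere_lift x y t) = 1" by (metis norm_ge_zero one_power2 power2_eq_imp_eq zero_le_one)
  show "Re (sphere_lift x y t $ 3) > 0" using assms by (simp add: sphere_lift_def)
qed

lemma sphere_lift_coordinates:
  assumes "norm b = 1" "Re (b$3) > 0"
  shows "(cmod (b$1))\<^sup>2 + (cmod (b$2))\<^sup>2 + (Im (b$3))\<^sup>2 < 1" "sphere_lift (b$1) (b$2) (Im (b$3)) = b"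
proof -
  have n: "(Re (b$3))\<^sup>2 = 1 - (cmod (b$1))\<^sup>2 - (cmod (b$2))\<^sup>2 - (Im (b$3))\<^sup>2"
    using norm_vec_3 [of b] assms(1) cmod_power2 [of "b$3"] by simp
  have "(Re (b$3))\<^sup>2 > 0" using assms(2) by simp
  then show "(cmod (b$1))\<^sup>2 + (cmod (b$2))\<^sup>2 + (Im (b$3))\<^sup>2 < 1" using n by linarith
  show "sphere_lift (b$1) (b$2) (Im (b$3)) = b"
    unfolding sphere_lift_def n [symmetric] using assms(2) by (simp add: vec_eq_iff forall_3 complex_eq_iff)
qed

lemma smooth_map_sphere_lift [smooth_intros]:
  assumes "smooth_map W x" "smooth_map W y" "smooth_map W t"
    and "\<And>v. v \<in> W \<Longrightarrow> (cmod (x v))\<^sup>2 + (cmod (y v))\<^sup>2 + (t v)\<^sup>2 < 1"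
  shows "smooth_map W (\<lambda>v. sphere_lift (x v) (y v) (t v))"
  unfolding sphere_lift_def power2_eq_square [of "t _"]
  by (intro smooth_intros assms smooth_map_open [OF assms(1)])
     (use assms(4) in \<open>force simp: power2_eq_square\<close>)

lemma smooth_manifold_S5_orbit:
  assumes "determined_by_values M" "diffeomorphism M (euclidean_subset {y \<in> HP2_model. norm (snd y) = 1 / 2}) \<psi>"
  shows "smooth_manifold TYPE(real^5) M"
proof -
  let ?Y = "{y \<in> HP2_model. norm (snd y) = 1 / 2}"
  define D where "D = {y :: (complex^3^3) \<times> (complex^3). 0 < Re (snd y $ 3)}"
  define V where "V = {v :: (complex \<times> complex) \<times> real. (cmod (fst (fst v)))\<^sup>2 + (cmod (snd (fst v)))\<^sup>2 + (snd v)\<^sup>2 < 1}"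
  define c where "c y = ((2 * snd y $ 1, 2 * snd y $ 2), 2 * Im (snd y $ 3))" for y :: "(complex^3^3) \<times> (complex^3)"
  define d where "d v = S5_point (sphere_lift (fst (fst v)) (snd (fst v)) (snd v))" for v
  have image: "?Y = S5_point ` sphere 0 1"
    using diffeomorphism_image [of S5 "euclidean_subset ?Y" S5_point] S5_model
    by (simp add: equivariant_diffeomorphism_def S5_def)
  have oD: "open D" unfolding D_def by (intro open_Collect_less continuous_intros)
  have oV: "open V" unfolding V_def by (intro open_Collect_less continuous_intros)
  show ?thesis
  proof (rule smooth_manifold_homogeneous [OF assms])
    show "smooth_map D c" unfolding c_def by (intro smooth_intros oD)
    show "smooth_map V d" unfolding d_def S5_point_def by (intro smooth_intros oV) (auto simp: V_def)
    show "c y \<in> V \<and> d (c y) = y" if y: "y \<in> D \<inter> ?Y" for y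
    proof -
      obtain w where w: "norm w = 1" "y = S5_point w" using y unfolding image by auto
      have pos: "Re (w$3) > 0" using y w by (simp add: D_def S5_point_def)
      have "c y = ((w$1, w$2), Im (w$3))" by (simp add: c_def w S5_point_def scaleR_conv_of_real [where 'a = complex])
      then show ?thesis using sphere_lift_coordinates [OF w(1) pos] w(2) by (simp add: V_def d_def)
    qed
    show "d v \<in> D \<inter> ?Y \<and> c (d v) = v" if v: "v \<in> V" for v
    proof -
      have l: "norm (sphere_lift (fst (fst v)) (snd (fst v)) (snd v)) = 1"
        "Re (sphere_lift (fst (fst v)) (snd (fst v)) (snd v) $ 3) > 0"
        using sphere_lift v by (auto simp: V_def)
      have "c (d v) = v"
        by (simp add: c_def d_def S5_point_def sphere_lift_def scaleR_conv_of_real [where 'a = complex] prod_eq_iff)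
      then show ?thesis using l unfolding image by (auto simp: d_def D_def S5_point_def)
    qed
    show "\<exists>g\<in>carrier SU3. act g y \<in> D" if y: "y \<in> ?Y" for y
    proof -
      have "norm (snd y) = 1 / 2" "y \<in> HP2_model" using y by auto
      then have "\<exists>g\<in>carrier SU3. act g y = normal_form (1 / 2)" using HP2_model_move [of y] by metis
      then obtain g where g: "g \<in> carrier SU3" "act g y = normal_form (1 / 2)" by blast
      have "act (cyc ** g) y = S5_point (unit_vec 3)"
        by (simp add: act_mult g normal_form_half act_S5_point cyc cyc_unit_vec)
      then show ?thesis
        using SU3.mult [OF cyc g(1)] by (intro bexI [of _ "cyc ** g"]) (auto simp: D_def S5_point_def)
    qed
  qed (auto simp: act_HP2_model norm_snd_act)
qed

text \<open>The orbit fibres over the sphere of directions of w, and the fibre is the projective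
  line of eigenlines orthogonal to w. The chart uses hemisphere coordinates of w/r and the affine
  coordinate e_2/e_1 of the eigenline, 5 + 2 real coordinates.\<close>

lemma smooth_manifold_principal_orbit:
  assumes r: "0 < r" "r < 1 / 2"
    and M: "determined_by_values M" "diffeomorphism M (euclidean_subset {y \<in> HP2_model. norm (snd y) = r}) \<psi>"
  shows "smooth_manifold TYPE(real^7) M"
proof -
  let ?Y = "{y \<in> HP2_model. norm (snd y) = r}"
  have orbit: "?Y = (\<lambda>g. act g (normal_form r)) ` carrier SU3"
    using r by (intro normal_form_orbit [symmetric]) auto
  define D0 where "D0 = {y :: (complex^3^3) \<times> (complex^3). norm (snd y) < 1 / 2 \<and> 0 < Re (snd y $ 3)}"
  define D where "D = D0 \<inter> {y. top_projection y $ 1 $ 1 \<noteq> 0}"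
  define V where "V = {v :: (complex \<times> complex) \<times> (real \<times> complex).
     (cmod (fst (fst v)))\<^sup>2 + (cmod (snd (fst v)))\<^sup>2 + (fst (snd v))\<^sup>2 < 1}"
  define c where "c y = ((snd y $ 1 / r, snd y $ 2 / r),
     (Im (snd y $ 3) / r, top_projection y $ 2 $ 1 / top_projection y $ 1 $ 1))" for y
  define b where "b v = sphere_lift (fst (fst v)) (snd (fst v)) (fst (snd v))"
    for v :: "(complex \<times> complex) \<times> (real \<times> complex)"
  \<comment> \<open>The eigenvector with first coordinate 1; its third coordinate solves
    \<open>hdot (b v) (a v) = 0\<close>.\<close>
  define a :: "(complex \<times> complex) \<times> (real \<times> complex) \<Rightarrow> complex^3" where
    "a v = vector [1, snd (snd v), - (cnj (b v $ 1) + cnj (b v $ 2) * snd (snd v)) / cnj (b v $ 3)]" for v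
  define d where "d v = act (frame (ccross (b v) (normalize_vec (a v))) (normalize_vec (a v))) (normal_form r)" for v
  have oV: "open V" unfolding V_def by (intro open_Collect_less continuous_intros)
  have oD0: "open D0" unfolding D0_def by (intro open_Collect_conj open_Collect_less continuous_intros)
  have sD0: "smooth_map D0 top_projection"
    by (intro smooth_map_top_projection oD0) (simp add: D0_def)
  have "smooth_map D0 (\<lambda>y. top_projection y $ 1 $ 1)" by (intro smooth_intros sD0)
  from continuous_open_preimage [OF smooth_map_imp_continuous_on [OF this] oD0, of "- {0}"]
  have oD: "open D" by (simp add: D_def vimage_def open_Compl Collect_neg_eq)
  have bv: "norm (b v) = 1" "Re (b v $ 3) > 0" if "v \<in> V" for v
    using sphere_lift that by (auto simp: V_def b_def)
  have b3: "b v $ 3 \<noteq> 0" if "v \<in> V" for v using bv [OF that] by auto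
  have a0: "a v \<noteq> 0" for v by (simp add: a_def vec_eq_iff forall_3)
  have ba: "hdot (b v) (a v) = 0" if "v \<in> V" for v
    using b3 [OF that] by (simp add: hdot_def sum_3 a_def)
  show ?thesis
  proof (rule smooth_manifold_homogeneous [OF M])
    show "smooth_map D c"
      unfolding c_def using smooth_map_subset [OF sD0 oD] r
      by (intro smooth_intros oD) (auto simp: D_def)
    have sb: "smooth_map V b" unfolding b_def by (intro smooth_intros oV) (auto simp: V_def)
    have "smooth_map V a" unfolding a_def by (intro smooth_intros oV sb) (use b3 in auto)
    then show "smooth_map V d" unfolding d_def by (intro smooth_intros oV sb) (use a0 in auto)
    show "c y \<in> V \<and> d (c y) = y" if y: "y \<in> D \<inter> ?Y" for y
    proof -
      obtain g where g: "g \<in> carrier SU3" "y = act g (normal_form r)" using y unfolding orbit by blast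
      define w e where "w = g *v unit_vec 2" and "e = g *v unit_vec 3"
      have sy: "snd y = r *\<^sub>R w" by (simp add: g act_def normal_form_def w_def matrix_vector_scaleR_right)
      have top: "top_projection y = outer e e"
        using top_projection_act_normal_form [OF g(1), of r] r g by (simp add: e_def)
      have we: "norm w = 1" "hdot e e = 1" "hdot w e = 0"
        using g(1) by (simp_all add: w_def e_def norm_unitary hdot_unitary SU3.unitary norm_axis_1)
      have w3: "Re (w$3) > 0" using y r by (simp add: D_def D0_def sy zero_less_mult_iff)
      have e1: "e$1 \<noteq> 0" using y by (simp add: D_def top)
      have cy: "c y = ((w$1, w$2), (Im (w$3), e$2 / e$1))"
        using r e1 by (simp add: c_def sy top scaleR_conv_of_real [where 'a = complex])
      have b: "b (c y) = w" using sphere_lift_coordinates(2) [OF we(1) w3] by (simp add: b_def cy)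
      have "cnj (w$3) \<noteq> 0" using w3 by auto
      moreover have "cnj (w$3) * e$3 = - (cnj (w$1) * e$1 + cnj (w$2) * e$2)"
        using we(3) by (simp add: hdot_def sum_3 eq_neg_iff_add_eq_0 algebra_simps)
      ultimately have "e$3 = - (cnj (w$1) * e$1 + cnj (w$2) * e$2) / cnj (w$3)"
        by (simp add: nonzero_eq_divide_eq mult.commute)
      then have "a (c y) = inverse (e$1) *s e"
        using e1 by (simp add: vec_eq_iff forall_3 a_def b) (simp add: cy field_simps)
      also have "inverse (e$1) *s e = outer e e *v (inverse (e$1) *s e)"
        using we(2) by (simp add: outer_mult_vec vec.scale)
      finally have ae: "a (c y) = outer e e *v (inverse (e$1) *s e)" .
      have n: "outer (normalize_vec (a (c y))) (normalize_vec (a (c y))) = outer e e"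
        unfolding ae by (rule outer_normalize_vec) (use we a0 [of "c y"] ae in auto)
      have "d (c y) = act g (normal_form r)"
        unfolding d_def b w_def
        by (rule act_frame_normal_form(2) [OF g(1) hdot_normalize_vec [OF a0] n [unfolded e_def]])
      then have "d (c y) = y" using g(2) by simp
      moreover have "c y \<in> V" using sphere_lift_coordinates(1) [OF we(1) w3] by (simp add: V_def cy)
      ultimately show ?thesis by blast
    qed
    show "d v \<in> D \<inter> ?Y \<and> c (d v) = v" if v: "v \<in> V" for v
    proof -
      define n where "n = normalize_vec (a v)"
      have n: "hdot n n = 1" using hdot_normalize_vec [OF a0] by (simp add: n_def)
      have bn: "hdot (b v) n = 0" using ba [OF v] by (simp add: n_def normalize_vec_def)
      have bb: "hdot (b v) (b v) = 1" using bv [OF v] by (simp add: hdot_self)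
      define g where "g = frame (ccross (b v) n) n"
      have g: "g \<in> carrier SU3"
        unfolding g_def by (rule frame_SU3) (use hdot_ccross_self [of "b v" n] bn bb n in simp_all)
      have nb: "hdot n (b v) = 0" using bn hdot_commute [of n "b v"] by simp
      have cols: "g *v unit_vec 2 = b v" "g *v unit_vec 3 = n"
        by (simp_all add: g_def ccross_ccross n nb)
      have dv: "d v = act g (normal_form r)" by (simp add: d_def g_def n_def)
      have sd: "snd (d v) = r *\<^sub>R b v" by (simp add: dv act_def normal_form_def matrix_vector_scaleR_right cols)
      have top: "top_projection (d v) = outer n n"
        using top_projection_act_normal_form [OF g, of r] r by (simp add: dv cols)
      have n1: "n$1 \<noteq> 0" "n$2 / n$1 = snd (snd v)"
        using a0 [of v] by (simp_all add: n_def normalize_vec_def a_def scaleR_conv_of_real [where 'a = complex])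
      have "d v \<in> ?Y" unfolding orbit using g dv by blast
      moreover have "d v \<in> D"
        using r bv [OF v] n1 by (simp add: D_def D0_def sd top)
      moreover have "c (d v) = v"
        using r n1 by (simp add: c_def sd top scaleR_conv_of_real [where 'a = complex] prod_eq_iff b_def sphere_lift_def)
      ultimately show ?thesis by blast
    qed
    show "\<exists>g\<in>carrier SU3. act g y \<in> D" if y: "y \<in> ?Y" for y
    proof -
      have "\<exists>g\<in>carrier SU3. act g y = normal_form r" using HP2_model_move [of y] y by simp
      then obtain g where g: "g \<in> carrier SU3" "act g y = normal_form r" by blast
      \<comment> \<open>\<open>cyc\<close> sends the direction \<open>unit_vec 2\<close> of w to
        \<open>unit_vec 3\<close> and the eigenvector \<open>unit_vec 3\<close> to
        \<open>unit_vec 1\<close>, which lies in the domain of the chart.\<close>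
      have e: "act (cyc ** g) y = act cyc (normal_form r)" by (simp add: act_mult g)
      have "snd (act cyc (normal_form r)) = r *\<^sub>R unit_vec 3"
        by (simp add: act_def normal_form_def matrix_vector_scaleR_right cyc_unit_vec)
      moreover have "top_projection (act cyc (normal_form r)) = outer (unit_vec 1) (unit_vec 1)"
        using top_projection_act_normal_form [OF cyc, of r] r by (simp add: cyc_unit_vec)
      ultimately have "act (cyc ** g) y \<in> D"
        unfolding e D_def D0_def using r by (simp add: norm_axis_1)
      then show ?thesis using SU3.mult [OF cyc g(1)] by blast
    qed
  qed (auto simp: act_HP2_model norm_snd_act)
qed

section \<open>Disc bundles\<close>

lemma SU3_simps: "g \<otimes>\<^bsub>SU3\<^esub> h = g ** h"
  by (simp add: SU3_def matrix_group_def)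

text \<open>That the identity acts trivially is not part of
  \<open>orthogonal_representation\<close>; it follows because \<open>\<rho> (mat 1)\<close> is
  idempotent and injective.\<close>

lemma orthogonal_representation_SU3D:
  assumes "orthogonal_representation SU3 K \<rho>" "unitary_subgroup (carrier SU3) K"
  shows "k \<in> K \<Longrightarrow> l \<in> K \<Longrightarrow> \<rho> (k ** l) v = \<rho> k (\<rho> l v)" "k \<in> K \<Longrightarrow> norm (\<rho> k v) = norm v"
    "\<rho> (mat 1) v = v"
proof -
  interpret unitary_subgroup "carrier SU3" K by fact
  show hom: "\<rho> (k ** l) v = \<rho> k (\<rho> l v)" if "k \<in> K" "l \<in> K" for k l v
    using assms(1) that by (simp add: orthogonal_representation_def SU3_simps)
  show "k \<in> K \<Longrightarrow> norm (\<rho> k v) = norm v"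
    using assms(1) by (simp add: orthogonal_representation_def orthogonal_transformation)
  have "\<rho> (mat 1) (\<rho> (mat 1) v) = \<rho> (mat 1) v"
    using hom [OF sub.one sub.one] by simp
  moreover have "inj (\<rho> (mat 1))"
    using assms(1) sub.one by (simp add: orthogonal_representation_def orthogonal_transformation_inj)
  ultimately show "\<rho> (mat 1) v = v" by (simp add: inj_eq)
qed

lemma bundle_class_SU3:
  assumes "unitary_subgroup (carrier SU3) K"
  shows "bundle_class SU3 K \<rho> (g, v) = {(g ** k, \<rho> (dag k) v) | k. k \<in> K}"
proof -
  interpret unitary_subgroup "carrier SU3" K by fact
  have "inv\<^bsub>SU3\<^esub> k = dag k" if "k \<in> K" for k using that subset SU3.inv by blast
  then show ?thesis by (auto simp: bundle_class_def SU3_simps)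
qed

lemma bundle_class_SU3_eq:
  assumes K: "unitary_subgroup (carrier SU3) K" and \<rho>: "orthogonal_representation SU3 K \<rho>" and k: "k \<in> K"
  shows "bundle_class SU3 K \<rho> (g ** k, \<rho> (dag k) v) = bundle_class SU3 K \<rho> (g, v)"
proof -
  interpret unitary_subgroup "carrier SU3" K by fact
  note rep = orthogonal_representation_SU3D [OF \<rho> K]
  show ?thesis
    unfolding bundle_class_SU3 [OF K]
  proof (intro equalityI subsetI)
    fix p assume "p \<in> {(g ** k ** l, \<rho> (dag l) (\<rho> (dag k) v)) | l. l \<in> K}"
    then obtain l where l: "l \<in> K" "p = (g ** k ** l, \<rho> (dag l) (\<rho> (dag k) v))" by blast
    then have "p = (g ** (k ** l), \<rho> (dag (k ** l)) v)"
      using k by (simp add: rep sub.dag dag_mult matrix_mul_assoc)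
    then show "p \<in> {(g ** k, \<rho> (dag k) v) | k. k \<in> K}" using sub.mult k l(1) by blast
  next
    fix p assume "p \<in> {(g ** k, \<rho> (dag k) v) | k. k \<in> K}"
    then obtain l where l: "l \<in> K" "p = (g ** l, \<rho> (dag l) v)" by blast
    have "\<rho> (dag (dag k ** l)) (\<rho> (dag k) v) = \<rho> (dag l ** k ** dag k) v"
      using k l(1) by (simp add: rep sub.dag sub.mult dag_mult)
    then have "p = (g ** k ** (dag k ** l), \<rho> (dag (dag k ** l)) (\<rho> (dag k) v))"
      using k l by (simp add: matrix_mul_assoc [symmetric] sub.cancel sub.right_inverse)
    then show "p \<in> {(g ** k ** l, \<rho> (dag l) (\<rho> (dag k) v)) | l. l \<in> K}"
      using sub.mult sub.dag k l(1) by blast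
  qed
qed

lemma bundle_action_bundle_class:
  assumes "unitary_subgroup (carrier SU3) K"
  shows "bundle_action SU3 h (bundle_class SU3 K \<rho> (g, v)) = bundle_class SU3 K \<rho> (h ** g, v)"
  by (simp add: bundle_class_SU3 [OF assms] bundle_action_def SU3_simps Setcompr_eq_image image_image matrix_mul_assoc)

text \<open>
  A slice representation: \<open>N\<close> maps the closed unit disc of the representation \<open>\<rho>\<close> of \<open>K\<close>
  equivariantly to a slice of the action of \<open>SU(3)\<close>.
\<close>

lemma disc_bundle_model:
  fixes N :: "'v::euclidean_space \<Rightarrow> (complex^3^3) \<times> (complex^3)"
  assumes K: "unitary_subgroup (carrier SU3) K" and \<rho>: "orthogonal_representation SU3 K \<rho>"
    and smooth: "smooth_map D N" "cball 0 1 \<subseteq> D"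
    and equivariant: "\<And>k v. k \<in> K \<Longrightarrow> v \<in> cball 0 1 \<Longrightarrow> act k (N v) = N (\<rho> k v)"
    and slice: "\<And>g v v'. g \<in> carrier SU3 \<Longrightarrow> v \<in> cball 0 1 \<Longrightarrow> v' \<in> cball 0 1 \<Longrightarrow> act g (N v) = N v' \<Longrightarrow> g \<in> K"
    and inj: "inj_on N (cball 0 1)"
    and into: "\<And>g v. g \<in> carrier SU3 \<Longrightarrow> v \<in> cball 0 1 \<Longrightarrow> act g (N v) \<in> Y"
    and sections: "\<And>y. y \<in> Y \<Longrightarrow> \<exists>W s t. y \<in> W \<and> smooth_map W s \<and> smooth_map W t \<and>
      (\<forall>y'\<in>W \<inter> Y. s y' \<in> carrier SU3 \<and> t y' \<in> cball 0 1 \<and> act (s y') (N (t y')) = y')"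
  obtains i where
    "equivariant_diffeomorphism SU3 (disc_bundle SU3 K \<rho>) (bundle_action SU3) (euclidean_subset Y) act i"
    "\<And>g v. g \<in> carrier SU3 \<Longrightarrow> v \<in> cball 0 1 \<Longrightarrow> i (bundle_class SU3 K \<rho> (g, v)) = act g (N v)"
proof
  interpret unitary_subgroup "carrier SU3" K by fact
  note rep = orthogonal_representation_SU3D [OF \<rho> K]
  let ?\<Phi> = "\<lambda>p. act (fst p) (N (snd p))"
  let ?i = "\<lambda>C. ?\<Phi> (SOME p. p \<in> C)"
  show i: "?i (bundle_class SU3 K \<rho> (g, v)) = act g (N v)" if "g \<in> carrier SU3" "v \<in> cball 0 1" for g v
  proof -
    have "(g ** mat 1, \<rho> (dag (mat 1)) v) \<in> bundle_class SU3 K \<rho> (g, v)"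
      unfolding bundle_class_SU3 [OF K] using sub.one by blast
    then have "(SOME p. p \<in> bundle_class SU3 K \<rho> (g, v)) \<in> bundle_class SU3 K \<rho> (g, v)"
      by (rule someI)
    then obtain k where k: "k \<in> K" "(SOME p. p \<in> bundle_class SU3 K \<rho> (g, v)) = (g ** k, \<rho> (dag k) v)"
      unfolding bundle_class_SU3 [OF K] by blast
    have "act (g ** k) (N (\<rho> (dag k) v)) = act (g ** k) (act (dag k) (N v))"
      using k(1) that sub.dag by (simp add: equivariant)
    also have "\<dots> = act g (N v)"
      using k(1) subset by (auto simp: act_mult act_cancel)
    finally show ?thesis by (simp add: k(2))
  qed
  have "diffeomorphism (disc_bundle SU3 K \<rho>) (euclidean_subset Y) ?i"
    unfolding disc_bundle_def
  proof (rule diffeomorphism_euclidean_quotient [where \<Phi> = ?\<Phi> and D = "UNIV \<times> D"])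
    have o: "open (UNIV \<times> D)" using smooth_map_open [OF smooth(1)] by (simp add: open_Times)
    have "smooth_map (UNIV \<times> D) (\<lambda>p. N (snd p))"
      by (rule smooth_map_compose [OF smooth(1)]) (auto intro!: smooth_intros o)
    then show "smooth_map (UNIV \<times> D) ?\<Phi>" by (intro smooth_intros o)
    show "bundle_class SU3 K \<rho> p = bundle_class SU3 K \<rho> p'"
      if p: "p \<in> carrier SU3 \<times> cball 0 1" "p' \<in> carrier SU3 \<times> cball 0 1" "?\<Phi> p = ?\<Phi> p'" for p p'
    proof -
      obtain g v g' v' where pp: "p = (g, v)" "p' = (g', v')" by (metis surj_pair)
      then have g: "g \<in> carrier SU3" "v \<in> cball 0 1" "g' \<in> carrier SU3" "v' \<in> cball 0 1" using p by auto
      \<comment> \<open>This element moves one slice point to another, so \<open>slice\<close> puts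
        it in \<open>K\<close>; equivariance and injectivity of \<open>N\<close> then identify the
        vectors.\<close>
      define k where "k = dag g' ** g"
      have k_in: "k \<in> carrier SU3" using g SU3.mult SU3.dag by (simp add: k_def)
      have "act k (N v) = N v'"
        using p(3) g by (simp add: k_def act_mult pp act_cancel)
      then have k: "k \<in> K" "N (\<rho> k v) = N v'"
        using slice [OF k_in g(2,4)] equivariant g by auto
      then have "\<rho> k v = v'"
        using g inj rep(2) by (auto simp: inj_on_def)
      then have "v = \<rho> (dag k) v'"
        using rep(1) [OF sub.dag [OF k(1)] k(1)] rep(3) k(1) by (simp add: sub.left_inverse) (metis sub.left_inverse)
      moreover have "g = g' ** k" using g by (simp add: k_def SU3.cancel)
      ultimately show ?thesis using bundle_class_SU3_eq [OF K \<rho> k(1), of g' v'] by (simp add: pp)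
    qed
    fix y assume "y \<in> Y"
    then obtain W s t where W: "y \<in> W" "smooth_map W s" "smooth_map W t"
      "\<forall>y'\<in>W \<inter> Y. s y' \<in> carrier SU3 \<and> t y' \<in> cball 0 1 \<and> act (s y') (N (t y')) = y'"
      using sections by blast
    then show "\<exists>W s. y \<in> W \<and> smooth_map W s \<and> (\<forall>y'\<in>W \<inter> Y. s y' \<in> carrier SU3 \<times> cball 0 1 \<and> ?\<Phi> (s y') = y')"
      by (intro exI [of _ W] exI [of _ "\<lambda>y. (s y, t y)"]) (auto intro: smooth_map_Pair)
  qed (use smooth(2) i into in auto)
  moreover have "?i (bundle_action SU3 g C) = act g (?i C)"
    if g: "g \<in> carrier SU3" and C: "C \<in> points (disc_bundle SU3 K \<rho>)" for g C
  proof -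
    obtain h v where "h \<in> carrier SU3" "v \<in> cball 0 1" "C = bundle_class SU3 K \<rho> (h, v)"
      using C by (auto simp: disc_bundle_def)
    then show ?thesis
      using g SU3.mult i by (simp only: bundle_action_bundle_class [OF K]) (simp add: act_mult)
  qed
  ultimately show "equivariant_diffeomorphism SU3 (disc_bundle SU3 K \<rho>) (bundle_action SU3)
      (euclidean_subset Y) act ?i"
    by (simp add: equivariant_diffeomorphism_def)
qed

subsection \<open>The disc bundle over the complex projective plane\<close>

definition plane_vec :: "complex \<times> complex \<Rightarrow> complex^3" where
  "plane_vec u = vector [fst u, snd u, 0]"

text \<open>The twist by \<open>k$3$3\<close> comes from the slice: k multiplies the vector z along
  e_3 by this phase, and an element of SU(2) moves the phase from z to u.\<close>

definition U2_rep :: "complex^3^3 \<Rightarrow> complex \<times> complex \<Rightarrow> complex \<times> complex" where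
  "U2_rep k u = (k$3$3 * (k *v plane_vec u) $ 1, k$3$3 * (k *v plane_vec u) $ 2)"

definition CP2_slice :: "complex \<times> complex \<Rightarrow> (complex^3^3) \<times> (complex^3)" where
  "CP2_slice u = line_point (sqrt (1 - (norm u)\<^sup>2) *\<^sub>R unit_vec 3) (plane_vec u)"

lemma plane_vec_inj: "plane_vec u = plane_vec u' \<Longrightarrow> u = u'"
  by (simp add: plane_vec_def vec_eq_iff forall_3 prod_eq_iff)

lemma norm_plane_vec: "norm (plane_vec u) = norm u"
proof -
  have "(norm (plane_vec u))\<^sup>2 = (norm u)\<^sup>2"
    by (simp add: norm_vec_3 plane_vec_def norm_prod_def)
  then show ?thesis by simp
qed

lemma hdot_plane_vec: "hdot (unit_vec 3) (plane_vec u) = 0"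
  by (simp add: hdot_def sum_3 plane_vec_def axis_def)

lemma U2_unit_vec:
  assumes "k \<in> U2"
  shows "k *v unit_vec 3 = k$3$3 *s unit_vec 3" "k$3$3 * cnj (k$3$3) = 1"
proof -
  show e: "k *v unit_vec 3 = k$3$3 *s unit_vec 3"
    using assms by (simp add: U2_iff vec_eq_iff forall_3 matrix_vector_mult_def sum_3 axis_def)
  show "k$3$3 * cnj (k$3$3) = 1"
    using assms SU3.unitary by (intro unitary_eigenvector [OF _ e]) (simp add: U2_iff)
qed

lemma plane_vec_U2_rep: "k \<in> U2 \<Longrightarrow> plane_vec (U2_rep k u) = k$3$3 *s (k *v plane_vec u)"
  by (simp add: U2_iff plane_vec_def U2_rep_def vec_eq_iff forall_3 matrix_vector_mult_def sum_3)

lemma scaleR_scale: "r *\<^sub>R (c *s (z :: complex^3)) = c *s (r *\<^sub>R z)"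
  by (simp add: vec_eq_iff scaleR_conv_of_real [where 'a = complex] mult_ac)

lemma of_real_sqrt_square: "0 \<le> x \<Longrightarrow> complex_of_real (sqrt x) * complex_of_real (sqrt x) = complex_of_real x"
  by (simp flip: of_real_mult)

lemma norm_scale: "norm (c *s (z :: complex^3)) = cmod c * norm z"
proof -
  have "(norm (c *s z))\<^sup>2 = (cmod c * norm z)\<^sup>2"
    by (simp add: norm_vec_3 norm_mult power_mult_distrib distrib_left)
  then show ?thesis by simp
qed

lemma norm_U2_rep:
  assumes "k \<in> U2"
  shows "norm (U2_rep k u) = norm u"
proof -
  have "(cmod (k$3$3))\<^sup>2 = 1"
    using U2_unit_vec(2) [OF assms] by (metis complex_norm_square of_real_eq_1_iff)
  then have "cmod (k$3$3) = 1" by (metis norm_ge_zero one_power2 power2_eq_imp_eq zero_le_one)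
  moreover have "unitary k" using assms SU3.unitary by (simp add: U2_iff)
  ultimately show ?thesis
    by (simp add: norm_plane_vec [symmetric] plane_vec_U2_rep [OF assms] norm_scale norm_unitary)
qed

lemma unitary_subgroup_U2: "unitary_subgroup (carrier SU3) U2"
  using unitary_subgroup_isotropy [of "normal_form 0"] by (simp add: isotropy_normal_form_0)

lemma U2_rep_mult:
  assumes "k \<in> U2" "l \<in> U2"
  shows "U2_rep (k ** l) u = U2_rep k (U2_rep l u)"
proof (rule plane_vec_inj)
  interpret unitary_subgroup "carrier SU3" U2 by (rule unitary_subgroup_U2)
  have "(k ** l)$3$3 = k$3$3 * l$3$3"
    using assms by (simp add: U2_iff matrix_matrix_mult_def sum_3)
  then show "plane_vec (U2_rep (k ** l) u) = plane_vec (U2_rep k (U2_rep l u))"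
    using assms by (simp add: plane_vec_U2_rep sub.mult matrix_vector_mul_assoc [symmetric] vec.scale)
qed

lemma linear_U2_rep: "linear (U2_rep k)"
  by (rule linearI)
     (simp_all add: U2_rep_def plane_vec_def matrix_vector_mult_def sum_3 scaleR_conv_of_real [where 'a = complex] algebra_simps)

lemma line_point_phase:
  assumes "c * cnj c = 1"
  shows "line_point (c *s z) u = line_point z (c *s u)"
  using line_point_rotate [of "cnj c" 0 "c *s z" u] assms
  by (simp add: vector_smult_assoc mult.commute)

lemma act_CP2_slice:
  assumes "k \<in> U2"
  shows "act k (CP2_slice u) = CP2_slice (U2_rep k u)"
proof -
  have "act k (CP2_slice u) = line_point (k$3$3 *s (sqrt (1 - (norm u)\<^sup>2) *\<^sub>R unit_vec 3)) (k *v plane_vec u)"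
    using assms by (simp add: CP2_slice_def act_line_point U2_iff matrix_vector_scaleR_right U2_unit_vec [OF assms] scaleR_scale)
  then show ?thesis
    unfolding line_point_phase [OF U2_unit_vec(2) [OF assms]]
    by (simp add: CP2_slice_def norm_U2_rep assms plane_vec_U2_rep)
qed

lemma CP2_slice_nth:
  "fst (CP2_slice u) $ 3 $ 3 = complex_of_real (sqrt (1 - (norm u)\<^sup>2)) * complex_of_real (sqrt (1 - (norm u)\<^sup>2))"
  "snd (CP2_slice u) = sqrt (1 - (norm u)\<^sup>2) *\<^sub>R vector [- cnj (snd u), cnj (fst u), 0]"
  by (simp_all add: CP2_slice_def line_point_def plane_vec_def axis_def vec_eq_iff forall_3
      scaleR_conv_of_real [where 'a = complex] algebra_simps)

lemma norm_power2_le: "norm u \<le> 1 \<Longrightarrow> (norm u)\<^sup>2 \<le> 1"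
  using power_mono [of "norm u" 1 2] by simp

lemma CP2_slice_in_HP2_model:
  assumes "norm u \<le> 1"
  shows "CP2_slice u \<in> HP2_model"
proof -
  have "hdot (sqrt (1 - (norm u)\<^sup>2) *\<^sub>R unit_vec 3) (sqrt (1 - (norm u)\<^sup>2) *\<^sub>R unit_vec 3) =
      complex_of_real (1 - (norm u)\<^sup>2)"
    using of_real_sqrt_square [of "1 - (norm u)\<^sup>2"] norm_power2_le [OF assms] by simp
  moreover have "hdot (plane_vec u) (plane_vec u) = complex_of_real ((norm u)\<^sup>2)"
    by (simp only: hdot_self norm_plane_vec)
  ultimately have "hdot (sqrt (1 - (norm u)\<^sup>2) *\<^sub>R unit_vec 3) (sqrt (1 - (norm u)\<^sup>2) *\<^sub>R unit_vec 3) +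
      hdot (plane_vec u) (plane_vec u) = 1"
    by (simp only:) simp
  then show ?thesis unfolding HP2_model_def CP2_slice_def by blast
qed

lemma norm_snd_CP2_slice:
  assumes "norm u \<le> 1"
  shows "norm (snd (CP2_slice u)) = sqrt (1 - (norm u)\<^sup>2) * norm u"
  using norm_power2_le [OF assms]
  by (simp add: CP2_slice_def line_point_def norm_ccross hdot_plane_vec norm_plane_vec norm_axis_1)

text \<open>The bound makes the vector along \<open>unit_vec 3\<close> at least as long as the other
  one, as the normal form requires.\<close>

lemma CP2_slice_real:
  assumes "0 \<le> s" "2 * s\<^sup>2 \<le> 1"
  shows "CP2_slice (of_real s, 0) = normal_form (sqrt (1 - s\<^sup>2) * s)"
proof -
  have "sqrt (s\<^sup>2) \<le> sqrt (1 - s\<^sup>2)" using assms by (intro real_sqrt_le_mono) simp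
  moreover have "plane_vec (of_real s, 0) = s *\<^sub>R unit_vec 1"
    by (simp add: plane_vec_def vec_eq_iff forall_3 axis_def scaleR_conv_of_real [where 'a = complex])
  ultimately show ?thesis
    using assms by (simp add: CP2_slice_def norm_Pair line_point_normal_form)
qed

text \<open>For 2 |u|^2 < 1 the eigenvalue 1 - |u|^2 of e_3 exceeds the other one, |u|^2. A frame
  that fixes e_3 reduces the claim to a real multiple of e_1.\<close>

lemma top_projection_CP2_slice:
  assumes "2 * (norm u)\<^sup>2 < 1"
  shows "top_projection (CP2_slice u) = outer (unit_vec 3) (unit_vec 3)"
proof -
  obtain a where a: "hdot a a = 1" "hdot (unit_vec 3) a = 0" "plane_vec u = norm u *\<^sub>R a"
  proof (cases "plane_vec u = 0")
    case True
    then show ?thesis using that [of "unit_vec 1"] norm_plane_vec [of u] by simp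
  next
    case False
    then show ?thesis
      using that [of "normalize_vec (plane_vec u)"] hdot_plane_vec [of u]
      by (simp add: hdot_normalize_vec) (simp add: normalize_vec_def norm_plane_vec [symmetric])
  qed
  have k: "frame a (unit_vec 3) \<in> carrier SU3" using a by (intro frame_SU3) simp_all
  have "CP2_slice u = act (frame a (unit_vec 3)) (CP2_slice (of_real (norm u), 0))"
  proof -
    have "plane_vec (of_real (norm u), 0) = norm u *\<^sub>R unit_vec 1"
      by (simp add: plane_vec_def vec_eq_iff forall_3 axis_def scaleR_conv_of_real [where 'a = complex])
    then show ?thesis
      by (simp add: CP2_slice_def act_line_point [OF k] norm_Pair matrix_vector_scaleR_right a(3))
  qed
  also have "\<dots> = act (frame a (unit_vec 3)) (normal_form (sqrt (1 - (norm u)\<^sup>2) * norm u))"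
    using assms by (simp add: CP2_slice_real)
  finally have e: "CP2_slice u = act (frame a (unit_vec 3)) (normal_form (sqrt (1 - (norm u)\<^sup>2) * norm u))" .
  define x where "x = (norm u)\<^sup>2"
  \<comment> \<open>This square is 1 - 4 x (1 - x), so its positivity keeps |w| strictly below
    1/2.\<close>
  have "0 < (1 - 2 * x)\<^sup>2" using assms by (simp add: x_def)
  then have "(1 - x) * x < (1 / 2)\<^sup>2" by (simp add: power2_eq_square algebra_simps)
  moreover have "(sqrt (1 - (norm u)\<^sup>2) * norm u)\<^sup>2 = (1 - x) * x"
    using assms by (simp add: power_mult_distrib x_def)
  ultimately have "(sqrt (1 - (norm u)\<^sup>2) * norm u)\<^sup>2 < (1 / 2)\<^sup>2" by simp
  then have "sqrt (1 - (norm u)\<^sup>2) * norm u < 1 / 2" by (rule power2_less_imp_less) simp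
  moreover have "0 \<le> sqrt (1 - (norm u)\<^sup>2) * norm u" using assms by simp
  ultimately show ?thesis
    unfolding e top_projection_act_normal_form [OF k \<open>0 \<le> sqrt (1 - (norm u)\<^sup>2) * norm u\<close> \<open>_ < 1 / 2\<close>] by simp
qed

lemma CP2_slice_inj:
  assumes "CP2_slice u = CP2_slice u'" "norm u < 1" "norm u' < 1"
  shows "u = u'"
proof -
  have n: "(norm u)\<^sup>2 < 1" "(norm u')\<^sup>2 < 1" using assms by (simp_all add: power_less_one_iff)
  have "complex_of_real (1 - (norm u)\<^sup>2) = of_real (1 - (norm u')\<^sup>2)"
    using CP2_slice_nth(1) [of u] CP2_slice_nth(1) [of u'] n assms(1)
    by (simp add: of_real_sqrt_square del: of_real_diff)
  then have e: "1 - (norm u')\<^sup>2 = 1 - (norm u)\<^sup>2" using of_real_eq_iff by metis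
  have "sqrt (1 - (norm u)\<^sup>2) *\<^sub>R (vector [- cnj (snd u), cnj (fst u), 0] :: complex^3) =
      sqrt (1 - (norm u)\<^sup>2) *\<^sub>R vector [- cnj (snd u'), cnj (fst u'), 0]"
    using arg_cong [OF assms(1), of snd] unfolding CP2_slice_nth(2) e .
  moreover have "sqrt (1 - (norm u)\<^sup>2) \<noteq> 0" using n by simp
  ultimately have "(vector [- cnj (snd u), cnj (fst u), 0] :: complex^3) = vector [- cnj (snd u'), cnj (fst u'), 0]"
    unfolding scaleR_cancel_left by blast
  then show ?thesis by (simp add: vec_eq_iff forall_3 prod_eq_iff)
qed

text \<open>Both slice points have the line of e_3 as top eigenline, so \<open>g\<close> preserves
  this line.\<close>

lemma U2_iff_top_projection:
  assumes "g \<in> carrier SU3" "2 * (norm u)\<^sup>2 < 1" "2 * (norm u')\<^sup>2 < 1" "act g (CP2_slice u) = CP2_slice u'"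
  shows "g \<in> U2"
  using top_projection_act [OF assms(1), of "CP2_slice u"] assms
  by (simp add: U2_eq top_projection_CP2_slice outer_conjugate)

text \<open>On the slice w is sqrt l times (- cnj u_2, cnj u_1, 0), where l = 1 - |u|^2 is the top
  eigenvalue; so u can be read off from w.\<close>

definition CP2_slice_coordinates :: "(complex^3^3) \<times> (complex^3) \<Rightarrow> complex \<times> complex" where
  "CP2_slice_coordinates y = inverse (sqrt (top_eigenvalue (norm (snd y)))) *\<^sub>R (cnj (snd y $ 2), - cnj (snd y $ 1))"

text \<open>Let \<open>h\<close> diagonalize y. As \<open>g\<close> and \<open>h\<close> give the
  same top eigenline, they differ by an element of U(2), and U(2) preserves the slice.\<close>

lemma CP2_slice_coordinates:
  assumes y: "y \<in> HP2_model" "norm (snd y) < 1 / 2" and g: "g \<in> carrier SU3"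
    and top: "outer (g *v unit_vec 3) (g *v unit_vec 3) = top_projection y"
  defines "u \<equiv> CP2_slice_coordinates (act (dag g) y)"
  shows "act g (CP2_slice u) = y" "(norm u)\<^sup>2 = 1 - top_eigenvalue (norm (snd y))"
proof -
  define r where "r = norm (snd y)"
  have r: "0 \<le> r" "r < 1 / 2" "r \<le> 1 / 2" using y by (simp_all add: r_def)
  obtain h where h: "h \<in> carrier SU3" "y = act h (normal_form r)"
    using HP2_model_normal_form_norm [OF y(1)] unfolding r_def by blast
  define l where "l = top_eigenvalue r"
  have l: "1 / 2 < l" "l \<le> 1" "l * (1 - l) = r\<^sup>2"
    using top_eigenvalue [OF r(1,3)] top_eigenvalue_strict [OF r(1,2)] by (simp_all add: l_def)
  define s where "s = sqrt (1 - l)"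
  have s: "0 \<le> s" "2 * s\<^sup>2 < 1" "1 - s\<^sup>2 = l" using l by (simp_all add: s_def)
  have "sqrt l * s = sqrt (r\<^sup>2)" by (simp add: l(3) [symmetric] real_sqrt_mult s_def)
  then have nf: "normal_form r = CP2_slice (of_real s, 0)"
    using s r by (simp add: CP2_slice_real)
  define k where "k = dag g ** h"
  have k_in: "k \<in> carrier SU3" using g h SU3.mult SU3.dag by (simp add: k_def)
  have "outer (k *v unit_vec 3) (k *v unit_vec 3) = dag g ** outer (h *v unit_vec 3) (h *v unit_vec 3) ** dag (dag g)"
    by (simp only: outer_conjugate k_def matrix_vector_mul_assoc)
  also have "outer (h *v unit_vec 3) (h *v unit_vec 3) = outer (g *v unit_vec 3) (g *v unit_vec 3)"
    using top top_projection_act_normal_form [OF h(1) r(1,2)] h(2) by simp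
  also have "dag g ** outer (g *v unit_vec 3) (g *v unit_vec 3) ** dag (dag g) = outer (unit_vec 3) (unit_vec 3)"
    using g by (simp only: outer_conjugate matrix_vector_mul_assoc SU3.left_inverse) simp
  finally have k: "k \<in> U2" using k_in by (simp add: U2_eq)
  define u' where "u' = U2_rep k (of_real s, 0)"
  have "act (dag g) y = act k (normal_form r)" using h(2) by (simp add: k_def act_mult)
  then have y': "act (dag g) y = CP2_slice u'" unfolding nf act_CP2_slice [OF k] u'_def .
  have nu: "norm u' = s" using s by (simp add: u'_def norm_U2_rep [OF k] norm_Pair)
  have "norm (snd (act (dag g) y)) = r" using norm_snd_act SU3.dag [OF g] by (simp add: r_def)
  then have "u = u'"
    using l s by (simp add: u_def CP2_slice_coordinates_def l_def [symmetric] y' CP2_slice_nth(2) nu prod_eq_iff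
        scaleR_conv_of_real [where 'a = complex])
  then show "act g (CP2_slice u) = y" "(norm u)\<^sup>2 = 1 - top_eigenvalue (norm (snd y))"
    using y' nu s act_cancel(2) [OF g] by (auto simp flip: y' r_def l_def)
qed

lemma CP2_disc_bundle_model:
  obtains \<rho> :: "complex^3^3 \<Rightarrow> real^4 \<Rightarrow> real^4" and i where
    "orthogonal_representation SU3 U2 \<rho>"
    "equivariant_diffeomorphism SU3 (disc_bundle SU3 U2 \<rho>) (bundle_action SU3)
       (euclidean_subset {y \<in> HP2_model. norm (snd y) \<le> 2 / 5}) act i"
    "\<And>g v. g \<in> carrier SU3 \<Longrightarrow> v \<in> cball 0 1 \<Longrightarrow> norm (snd (i (bundle_class SU3 U2 \<rho> (g, v)))) = 2 / 5 \<longleftrightarrow> norm v = 1"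
    "\<And>g v. g \<in> carrier SU3 \<Longrightarrow> v \<in> cball 0 1 \<Longrightarrow> norm (snd (i (bundle_class SU3 U2 \<rho> (g, v)))) = 0 \<longleftrightarrow> v = 0"
proof -
  note result = that
  let ?Y = "{y \<in> HP2_model. norm (snd y) \<le> 2 / 5}"
  \<comment> \<open>An isometry moves the representation from pairs of complex numbers to
    \<open>real^4\<close>.\<close>
  have "DIM(real^4) = DIM(complex \<times> complex)" by simp
  then obtain f :: "real^4 \<Rightarrow> complex \<times> complex" and f' where f: "linear f" "linear f'"
      "\<And>x. norm (f x) = norm x" "\<And>y. norm (f' y) = norm y" "\<And>x. f' (f x) = x" "\<And>y. f (f' y) = y"
    by (rule isomorphisms_UNIV_UNIV) blast
  have bl: "bounded_linear f" "bounded_linear f'" using f(1,2) linear_conv_bounded_linear by blast+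
  define \<rho> where "\<rho> k v = f' (U2_rep k (f v))" for k v
  \<comment> \<open>At |w| = 2/5 the smaller eigenvalue |u|^2 is 1/5, so the unit disc is scaled to
    radius 1/sqrt 5. This is below 1/sqrt 2, where the eigenvalues would meet.\<close>
  define \<epsilon> :: real where "\<epsilon> = inverse (sqrt 5)"
  have \<epsilon>: "\<epsilon>\<^sup>2 = 1 / 5" "\<epsilon> > 0" by (simp_all add: \<epsilon>_def power_inverse)
  define N where "N v = CP2_slice (\<epsilon> *\<^sub>R f v)" for v
  have rep: "orthogonal_representation SU3 U2 \<rho>"
    unfolding orthogonal_representation_def
  proof (intro conjI ballI allI)
    fix k assume k: "k \<in> U2"
    have "linear (\<rho> k)"
      unfolding \<rho>_def using linear_compose [OF linear_compose [OF f(1) linear_U2_rep] f(2)] by (simp add: o_def)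
    then show "orthogonal_transformation (\<rho> k)"
      by (simp add: orthogonal_transformation \<rho>_def f norm_U2_rep k)
    show "\<rho> (k \<otimes>\<^bsub>SU3\<^esub> l) = \<rho> k \<circ> \<rho> l" if "l \<in> U2" for l
      using k that by (auto simp: \<rho>_def SU3_simps U2_rep_mult f)
  next
    fix v
    have "smooth_map UNIV (\<lambda>k. \<rho> k v)"
      unfolding \<rho>_def U2_rep_def by (intro smooth_map_linear [OF bl(2)] smooth_intros open_UNIV)
    then show "continuous_on U2 (\<lambda>k. \<rho> k v)"
      using smooth_map_imp_continuous_on continuous_on_subset by blast
  qed
  have small: "(norm (\<epsilon> *\<^sub>R f v))\<^sup>2 = (norm v)\<^sup>2 / 5" for v
    by (simp add: f power_mult_distrib \<epsilon>)
  have disc: "(norm (\<epsilon> *\<^sub>R f v))\<^sup>2 \<le> 1 / 5" if "v \<in> cball 0 1" for v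
    unfolding small using norm_power2_le [of v] that by simp
  have less1: "norm (\<epsilon> *\<^sub>R f v) < 1" if "v \<in> cball 0 1" for v
    using disc [OF that] by (rule_tac power2_less_imp_less) simp_all
  have nN: "(norm (snd (N v)))\<^sup>2 = (1 - (norm v)\<^sup>2 / 5) * ((norm v)\<^sup>2 / 5)" if "v \<in> cball 0 1" for v
  proof -
    have "norm (snd (N v)) = sqrt (1 - (norm (\<epsilon> *\<^sub>R f v))\<^sup>2) * norm (\<epsilon> *\<^sub>R f v)"
      unfolding N_def by (rule norm_snd_CP2_slice) (use less1 [OF that] in simp)
    moreover have "0 \<le> 1 - (norm (\<epsilon> *\<^sub>R f v))\<^sup>2" using disc [OF that] by linarith
    ultimately show ?thesis by (simp only: power_mult_distrib real_sqrt_pow2 small)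
  qed
  have le: "norm (snd (N v)) \<le> 2 / 5 \<and> (norm (snd (N v)) = 2 / 5 \<longleftrightarrow> norm v = 1) \<and>
      (norm (snd (N v)) = 0 \<longleftrightarrow> v = 0)" if v: "v \<in> cball 0 1" for v
  proof -
    define x where "x = (norm v)\<^sup>2 / 5"
    have x: "0 \<le> x" "x \<le> 1 / 5" using disc [OF v] small [of v] by (simp_all add: x_def)
    \<comment> \<open>With x = |u|^2 one has |w|^2 = (1 - x) x; the equation |w| = 2/5 has the roots
      1/5 and 4/5, and only 1/5 occurs in the disc.\<close>
    have f1: "(2 / 5)\<^sup>2 - (1 - x) * x = (4 / 5 - x) * (1 / 5 - x)" by (simp add: power2_eq_square field_simps)
    have p0: "0 \<le> (4 / 5 - x) * (1 / 5 - x)" using x by (intro mult_nonneg_nonneg) auto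
    have nx: "(norm (snd (N v)))\<^sup>2 = (1 - x) * x" unfolding nN [OF v] x_def ..
    have "(norm (snd (N v)))\<^sup>2 \<le> (2 / 5)\<^sup>2" unfolding nx using p0 f1 by linarith
    then have 1: "norm (snd (N v)) \<le> 2 / 5" by (rule power2_le_imp_le) simp
    have "norm (snd (N v)) = 2 / 5 \<longleftrightarrow> (norm (snd (N v)))\<^sup>2 = (2 / 5)\<^sup>2"
      by (metis norm_ge_zero power2_eq_imp_eq zero_le_divide_iff zero_le_numeral)
    also have "\<dots> \<longleftrightarrow> (4 / 5 - x) * (1 / 5 - x) = 0" unfolding nx f1 [symmetric] by auto
    also have "\<dots> \<longleftrightarrow> x = 1 / 5" using x by auto
    also have "\<dots> \<longleftrightarrow> norm v = 1" by (simp add: x_def power2_eq_1_iff) (metis norm_ge_zero not_one_le_zero neg_0_le_iff_le)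
    finally have 2: "norm (snd (N v)) = 2 / 5 \<longleftrightarrow> norm v = 1" .
    have "norm (snd (N v)) = 0 \<longleftrightarrow> (norm (snd (N v)))\<^sup>2 = 0" by simp
    also have "\<dots> \<longleftrightarrow> (1 - x) * x = 0" unfolding nx ..
    also have "\<dots> \<longleftrightarrow> v = 0" using x by (auto simp: x_def)
    finally show ?thesis using 1 2 by blast
  qed
  have "\<exists>i. equivariant_diffeomorphism SU3 (disc_bundle SU3 U2 \<rho>) (bundle_action SU3) (euclidean_subset ?Y) act i \<and>
     (\<forall>g v. g \<in> carrier SU3 \<longrightarrow> v \<in> cball 0 1 \<longrightarrow> i (bundle_class SU3 U2 \<rho> (g, v)) = act g (N v))"
  proof (rule disc_bundle_model [OF unitary_subgroup_U2 rep, of "{v. (norm (\<epsilon> *\<^sub>R f v))\<^sup>2 < 1}" N ?Y])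
    have sf: "smooth_map UNIV (\<lambda>v. \<epsilon> *\<^sub>R f v)"
      by (intro smooth_intros smooth_map_linear [OF bl(1)] open_UNIV)
    have "open {v. (norm (\<epsilon> *\<^sub>R f v))\<^sup>2 < 1}"
      by (intro open_Collect_less smooth_map_imp_continuous_on smooth_map_norm_power2 sf smooth_map_const open_UNIV)
    then have smooth_scaled: "smooth_map {v. (norm (\<epsilon> *\<^sub>R f v))\<^sup>2 < 1} (\<lambda>v. \<epsilon> *\<^sub>R f v)"
      using sf smooth_map_subset by blast
    have "smooth_map {u. (norm u)\<^sup>2 < 1} CP2_slice"
    proof -
      have "open {u :: complex \<times> complex. (norm u)\<^sup>2 < 1}" by (intro open_Collect_less continuous_intros)
      then show ?thesis
        unfolding CP2_slice_def plane_vec_def by (intro smooth_intros) simp_all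
    qed
    then show "smooth_map {v. (norm (\<epsilon> *\<^sub>R f v))\<^sup>2 < 1} N"
      unfolding N_def by (rule smooth_map_compose [OF _ smooth_scaled]) auto
    show "cball 0 1 \<subseteq> {v. (norm (\<epsilon> *\<^sub>R f v))\<^sup>2 < 1}" using disc by fastforce
    show "act k (N v) = N (\<rho> k v)" if "k \<in> U2" for k v
      using linear_cmul [OF linear_U2_rep] by (simp add: N_def \<rho>_def act_CP2_slice [OF that] f)
    show "g \<in> U2" if "g \<in> carrier SU3" "v \<in> cball 0 1" "v' \<in> cball 0 1" "act g (N v) = N v'" for g v v'
      by (rule U2_iff_top_projection [OF that(1) _ _ that(4) [unfolded N_def]])
         (use disc [OF that(2)] disc [OF that(3)] in linarith)+
    show "inj_on N (cball 0 1)"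
    proof (rule inj_onI)
      fix v v' assume v: "v \<in> cball 0 1" "v' \<in> cball 0 1" "N v = N v'"
      then have "\<epsilon> *\<^sub>R f v = \<epsilon> *\<^sub>R f v'" using CP2_slice_inj less1 unfolding N_def by blast
      then have "f v = f v'" using \<epsilon> by simp
      then show "v = v'" using f(5) by metis
    qed
    show "act g (N v) \<in> ?Y" if g: "g \<in> carrier SU3" and v: "v \<in> cball 0 1" for g v
    proof -
      have "N v \<in> HP2_model" using less1 [OF v] unfolding N_def by (intro CP2_slice_in_HP2_model) simp
      then show ?thesis using act_HP2_model [OF g] norm_snd_act [OF g] le [OF v] by simp
    qed
    fix y0 assume y0: "y0 \<in> ?Y"
    then have "y0 \<in> HP2_model" "norm (snd y0) < 1 / 2" by auto
    then obtain W s where W: "y0 \<in> W" "smooth_map W s" "\<forall>y\<in>W. norm (snd y) < 1 / 2"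
      "\<forall>y\<in>W \<inter> HP2_model. s y \<in> carrier SU3 \<and> outer (s y *v unit_vec 3) (s y *v unit_vec 3) = top_projection y"
      using top_section by blast
    \<comment> \<open>The slice coordinate of \<open>act (dag (s y)) y\<close>, rescaled to the unit
      disc; the norm of w may be taken at \<open>y\<close> because the action preserves it.\<close>
    define t where "t y = f' (inverse \<epsilon> *\<^sub>R (inverse (sqrt (top_eigenvalue (norm (snd y)))) *\<^sub>R
        (cnj ((dag (s y) *v snd y) $ 2), - cnj ((dag (s y) *v snd y) $ 1))))" for y
    have oW: "open W" by (rule smooth_map_open [OF W(2)])
    have pos: "1 - 4 * (norm (snd y))\<^sup>2 > 0" if "y \<in> W" for y
    proof -
      have "(norm (snd y))\<^sup>2 < (1/2)\<^sup>2" using W(3) that by (intro power_strict_mono) auto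
      then show ?thesis by (simp add: power2_eq_square)
    qed
    have pos': "0 < (1 + sqrt (1 - 4 * (norm (snd y))\<^sup>2)) / 2" if "y \<in> W" for y
      using pos [OF that] by (simp add: add_pos_nonneg)
    have "smooth_map W (\<lambda>y. top_eigenvalue (norm (snd y)))"
      unfolding top_eigenvalue_def by (intro smooth_intros oW; (erule pos | simp))
    moreover have "0 < top_eigenvalue (norm (snd y))" if "y \<in> W" for y
      using pos' [OF that] by (simp add: top_eigenvalue_def)
    ultimately have "smooth_map W (\<lambda>y. inverse (sqrt (top_eigenvalue (norm (snd y)))))"
      by (intro smooth_intros) (auto simp: less_le)
    then have "smooth_map W t"
      unfolding t_def by (intro smooth_map_linear [OF bl(2)] smooth_map_scaleR smooth_map_Pair smooth_map_const
        smooth_map_cnj smooth_map_minus smooth_map_vec_nth smooth_map_matrix_vector_mult smooth_map_dag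
        smooth_map_snd smooth_map_id oW W(2))
    moreover have "s y \<in> carrier SU3 \<and> t y \<in> cball 0 1 \<and> act (s y) (N (t y)) = y" if y: "y \<in> W \<inter> ?Y" for y
    proof -
      define u where "u = CP2_slice_coordinates (act (dag (s y)) y)"
      have sy: "s y \<in> carrier SU3" "outer (s y *v unit_vec 3) (s y *v unit_vec 3) = top_projection y"
        "y \<in> HP2_model" "norm (snd y) < 1 / 2"
        using y W by auto
      note u = CP2_slice_coordinates [OF sy(3,4,1,2), folded u_def]
      have "norm (snd (act (dag (s y)) y)) = norm (snd y)" using norm_snd_act SU3.dag [OF sy(1)] by blast
      then have ty: "t y = f' (inverse \<epsilon> *\<^sub>R u)"
        by (simp add: t_def u_def CP2_slice_coordinates_def) (simp add: act_def)
      have "(norm (snd y))\<^sup>2 \<le> (2 / 5)\<^sup>2" using y by (intro power_mono) auto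
      \<comment> \<open>|w| \<le> 2/5 makes the square root at least 3/5 and hence the top
        eigenvalue at least 4/5.\<close>
      then have "(3 / 5)\<^sup>2 \<le> 1 - 4 * (norm (snd y))\<^sup>2" by (simp add: power2_eq_square)
      then have "3 / 5 \<le> sqrt (1 - 4 * (norm (snd y))\<^sup>2)" by (rule real_le_rsqrt)
      then have "(norm u)\<^sup>2 \<le> \<epsilon>\<^sup>2" unfolding u(2) \<epsilon> top_eigenvalue_def by simp
      then have "norm u \<le> \<epsilon>" by (rule power2_le_imp_le) (use \<epsilon>(2) in simp)
      then have "inverse \<epsilon> * norm u \<le> inverse \<epsilon> * \<epsilon>" using \<epsilon>(2) by (intro mult_left_mono) auto
      then have "norm (t y) \<le> 1" using \<epsilon>(2) unfolding ty f(4) by simp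
      moreover have "N (t y) = CP2_slice u" using \<epsilon>(2) unfolding N_def ty f(6) by simp
      ultimately show ?thesis using u(1) sy(1) by simp
    qed
    ultimately show "\<exists>W s t. y0 \<in> W \<and> smooth_map W s \<and> smooth_map W t \<and>
      (\<forall>y'\<in>W \<inter> ?Y. s y' \<in> carrier SU3 \<and> t y' \<in> cball 0 1 \<and> act (s y') (N (t y')) = y')"
      using W(1,2) by blast
  qed blast
  then obtain i where i: "equivariant_diffeomorphism SU3 (disc_bundle SU3 U2 \<rho>) (bundle_action SU3) (euclidean_subset ?Y) act i"
    "\<And>g v. g \<in> carrier SU3 \<Longrightarrow> v \<in> cball 0 1 \<Longrightarrow> i (bundle_class SU3 U2 \<rho> (g, v)) = act g (N v)"
    by blast
  show thesis
    by (rule result [OF rep i(1)]) (use le in \<open>auto simp: i(2) norm_snd_act\<close>)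
qed

subsection \<open>The disc bundle over the sphere\<close>

definition traceless :: "complex \<times> real \<Rightarrow> complex^3^3" where
  "traceless x = vector [vector [of_real (snd x), cnj (fst x), 0], vector [fst x, - of_real (snd x), 0],
     vector [0, 0, 0]]"

text \<open>The adjoint representation of SU(2) on traceless Hermitian matrices, in the coordinates
  of \<open>traceless\<close>.\<close>

definition SU2_rep :: "complex^3^3 \<Rightarrow> complex \<times> real \<Rightarrow> complex \<times> real" where
  "SU2_rep k x = ((k ** traceless x ** dag k) $ 2 $ 1, Re ((k ** traceless x ** dag k) $ 1 $ 1))"

text \<open>P has the eigenvalues (1 + |x|)/2 and (1 - |x|)/2 on the plane orthogonal to e_3; the
  length of w is the square root of their product.\<close>

definition S5_slice :: "complex \<times> real \<Rightarrow> (complex^3^3) \<times> (complex^3)" where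
  "S5_slice x = ((1 / 2) *\<^sub>R (mat 1 - outer (unit_vec 3) (unit_vec 3) + traceless x),
     (sqrt (1 - (norm x)\<^sup>2) / 2) *\<^sub>R unit_vec 3)"

lemma traceless_inj: "traceless x = traceless y \<Longrightarrow> x = y"
  by (simp add: traceless_def vec_eq_iff forall_3 prod_eq_iff)

lemma dag_traceless: "dag (traceless x) = traceless x"
  by (simp add: traceless_def vec_eq_iff forall_3)

lemma traceless_conjugate:
  assumes k: "k \<in> SU2"
  shows "k ** traceless x ** dag k = traceless (SU2_rep k x)"
proof -
  define M where "M = k ** traceless x ** dag k"
  have z: "k$1$3 = 0" "k$2$3 = 0" "k$3$1 = 0" "k$3$2 = 0" using k by (simp_all add: SU2_iff U2_iff)
  have u: "dag k ** k = mat 1" using k SU3.left_inverse by (simp add: SU2_iff U2_iff)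
  have "dag M = M" by (simp add: M_def dag_mult dag_traceless matrix_mul_assoc)
  then have h: "cnj (M$j$i) = M$i$j" for i j by (metis dag_nth)
  \<comment> \<open>Cyclicity of the trace, written out so that only entries of
    \<open>dag k ** k\<close> occur.\<close>
  have "M$1$1 + M$2$2 = of_real (snd x) * (dag k ** k)$1$1 + cnj (fst x) * (dag k ** k)$2$1 +
      fst x * (dag k ** k)$1$2 - of_real (snd x) * (dag k ** k)$2$2"
    by (simp add: M_def matrix_matrix_mult_def sum_3 traceless_def z algebra_simps)
  then have "M$2$2 = - M$1$1" unfolding u by (simp add: mat_def eq_neg_iff_add_eq_0 add.commute)
  moreover have "M$1$3 = 0" "M$2$3 = 0" "M$3$3 = 0" "M$3$1 = 0" "M$3$2 = 0"
    by (simp_all add: M_def matrix_matrix_mult_def sum_3 traceless_def z)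
  moreover have "of_real (Re (M$1$1)) = M$1$1" using h [of 1 1] by (simp add: complex_eq_iff)
  ultimately have "M = traceless (M$2$1, Re (M$1$1))"
    using h [of 2 1] by (simp add: traceless_def vec_eq_iff forall_3)
  then show ?thesis by (simp add: M_def SU2_rep_def)
qed

lemma SU2_unit_vec: "k \<in> SU2 \<Longrightarrow> k *v unit_vec 3 = unit_vec 3" "k \<in> SU2 \<Longrightarrow> k \<in> carrier SU3"
  by (simp_all add: SU2_eq)

lemma SU2_fixes_plane:
  assumes "k \<in> SU2"
  shows "k ** (mat 1 - outer (unit_vec 3) (unit_vec 3)) ** dag k = mat 1 - outer (unit_vec 3) (unit_vec 3)"
  using SU2_unit_vec [OF assms] by (simp add: matrix_distribs outer_conjugate SU3.right_inverse)

lemma norm_prod_power2: "(norm (x :: complex \<times> real))\<^sup>2 = (cmod (fst x))\<^sup>2 + (snd x)\<^sup>2"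
  by (simp add: norm_prod_def)

text \<open>Expresses the norm through a matrix product, so that conjugation by a unitary matrix
  visibly preserves it.\<close>

lemma traceless_square: "traceless x ** traceless x = (norm x)\<^sup>2 *\<^sub>R (mat 1 - outer (unit_vec 3) (unit_vec 3))"
proof -
  have "complex_of_real ((norm x)\<^sup>2) = fst x * cnj (fst x) + of_real (snd x) * of_real (snd x)"
    unfolding norm_prod_power2 of_real_add complex_norm_square by (simp add: power2_eq_square)
  then show ?thesis
    by (simp add: traceless_def vec_eq_iff forall_3 matrix_matrix_mult_def sum_3 mat_def axis_def
        scaleR_conv_of_real [where 'a = complex] algebra_simps del: of_real_power)
qed

lemma norm_SU2_rep:
  assumes "k \<in> SU2"
  shows "norm (SU2_rep k x) = norm x"
proof -
  have "traceless (SU2_rep k x) ** traceless (SU2_rep k x) =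
      k ** traceless x ** (dag k ** k) ** traceless x ** dag k"
    by (simp add: traceless_conjugate [OF assms, symmetric] matrix_mul_assoc)
  also have "\<dots> = k ** (traceless x ** traceless x) ** dag k"
    using SU2_unit_vec [OF assms] by (simp add: SU3.left_inverse matrix_mul_assoc)
  also have "\<dots> = (norm x)\<^sup>2 *\<^sub>R (mat 1 - outer (unit_vec 3) (unit_vec 3))"
    by (simp only: traceless_square matrix_mult_scaleR_left matrix_mult_scaleR_right SU2_fixes_plane [OF assms])
  finally have "(norm (SU2_rep k x))\<^sup>2 *\<^sub>R (mat 1 - outer (unit_vec 3) (unit_vec 3)) =
      (norm x)\<^sup>2 *\<^sub>R (mat 1 - outer (unit_vec 3) (unit_vec 3))"
    by (simp only: traceless_square)
  from arg_cong [OF this, of "\<lambda>M. M $ 1 $ 1"]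
  have "(norm (SU2_rep k x))\<^sup>2 *\<^sub>R (1 :: complex) = (norm x)\<^sup>2 *\<^sub>R 1"
    unfolding vector_scaleR_component by (simp add: mat_def axis_def)
  then have "(norm (SU2_rep k x))\<^sup>2 = (norm x)\<^sup>2"
    unfolding scaleR_conv_of_real by (simp only: mult_1_right of_real_eq_iff)
  then show ?thesis by simp
qed

lemma linear_SU2_rep: "linear (SU2_rep k)"
proof -
  have "traceless (x + y) = traceless x + traceless y" "traceless (c *\<^sub>R x) = c *\<^sub>R traceless x" for x y c
    by (simp_all add: traceless_def vec_eq_iff forall_3 scaleR_conv_of_real [where 'a = complex])
  then show ?thesis
    by (intro linearI) (simp_all add: SU2_rep_def matrix_distribs)
qed

lemma unitary_subgroup_SU2: "unitary_subgroup (carrier SU3) SU2"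
  using unitary_subgroup_isotropy [of "S5_point (unit_vec 3)"] by (simp add: isotropy_S5_point)

lemma SU2_rep_mult:
  assumes "k \<in> SU2" "l \<in> SU2"
  shows "SU2_rep (k ** l) x = SU2_rep k (SU2_rep l x)"
proof (rule traceless_inj)
  interpret unitary_subgroup "carrier SU3" SU2 by (rule unitary_subgroup_SU2)
  show "traceless (SU2_rep (k ** l) x) = traceless (SU2_rep k (SU2_rep l x))"
    using assms sub.mult by (simp add: traceless_conjugate [symmetric] dag_mult matrix_mul_assoc)
qed

lemma act_S5_slice:
  assumes "k \<in> SU2"
  shows "act k (S5_slice x) = S5_slice (SU2_rep k x)"
proof -
  have "k ** (mat 1 - outer (unit_vec 3) (unit_vec 3) + traceless x) ** dag k =
      mat 1 - outer (unit_vec 3) (unit_vec 3) + traceless (SU2_rep k x)"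
    by (simp only: matrix_add_ldistrib matrix_add_rdistrib SU2_fixes_plane [OF assms] traceless_conjugate [OF assms])
  then show ?thesis
    by (simp add: act_def S5_slice_def matrix_mult_scaleR_left matrix_mult_scaleR_right norm_SU2_rep [OF assms]
        matrix_vector_scaleR_right SU2_unit_vec [OF assms])
qed

text \<open>A Cholesky factorization of the 2 by 2 block of P: \<open>z\<close> is the first column
  divided by p, the square root of the entry (1 + t)/2, and \<open>u\<close> has only a second
  coordinate, fixed by z_1 u_2 = q/2. The bound |x| < 1 makes p positive.\<close>

lemma S5_slice_in_HP2_model:
  assumes "norm x < 1"
  shows "S5_slice x \<in> HP2_model"
proof -
  obtain \<beta> t where x: "x = (\<beta>, t)" by (metis surj_pair)
  have n: "(norm x)\<^sup>2 < 1" using assms by (simp add: power_less_one_iff)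
  have nx: "(norm x)\<^sup>2 = (cmod \<beta>)\<^sup>2 + t\<^sup>2" by (simp add: norm_prod_power2 x)
  have "t\<^sup>2 < 1" using n nx zero_le_power2 [of "cmod \<beta>"] by linarith
  then have "\<bar>t\<bar> < 1" by (simp add: abs_square_less_1)
  then have t: "1 + t > 0" by linarith
  define p where "p = sqrt ((1 + t) / 2)"
  define q where "q = sqrt (1 - (norm x)\<^sup>2)"
  have p: "p \<noteq> 0" "p * p = (1 + t) / 2" using t by (simp_all add: p_def)
  have pc: "complex_of_real p * complex_of_real p = (1 + of_real t) / 2"
    using p(2) by (metis of_real_1 of_real_add of_real_divide of_real_mult of_real_numeral)
  have "q * q = 1 - (norm x)\<^sup>2" using n by (simp add: q_def)
  then have "complex_of_real (q * q) = 1 - (\<beta> * cnj \<beta> + of_real (t * t))"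
    unfolding nx by (simp only: of_real_diff of_real_add complex_norm_square of_real_1 power2_eq_square [of t])
  then have qc: "complex_of_real q * complex_of_real q = (1 - of_real t) * (1 + of_real t) - \<beta> * cnj \<beta>"
    by (simp add: algebra_simps)
  define z2 u2 where "z2 = \<beta> / (2 * of_real p)" and "u2 = of_real q / (2 * complex_of_real p)"
  define z u :: "complex^3" where "z = vector [of_real p, z2, 0]" and "u = vector [0, u2, 0]"
  have t': "1 + complex_of_real t \<noteq> 0" using t by (metis of_real_1 of_real_add of_real_eq_0_iff less_irrefl)
  have "z2 * cnj z2 + u2 * cnj u2 = (\<beta> * cnj \<beta> + of_real q * of_real q) / (4 * (of_real p * of_real p))"
    by (simp add: z2_def u2_def add_divide_distrib mult_ac)
  also have "\<dots> = ((1 - of_real t) * (1 + of_real t)) / (4 * ((1 + of_real t) / 2))"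
    unfolding qc pc by simp
  also have "4 * ((1 + complex_of_real t) / 2) = 2 * (1 + of_real t)" by simp
  also have "(1 - of_real t) * (1 + of_real t) / (2 * (1 + complex_of_real t)) = (1 - of_real t) / 2"
    using t' by (rule nonzero_mult_divide_mult_cancel_right)
  finally have e22: "z2 * cnj z2 + u2 * cnj u2 = (1 - of_real t) / 2" .
  have products: "of_real p * cnj z2 = cnj \<beta> / 2" "z2 * of_real p = \<beta> / 2" "cnj u2 = u2" "of_real p * u2 = of_real q / 2"
    using p(1) by (simp_all add: z2_def u2_def)
  have e22': "z2 * cnj z2 * 2 + u2 * u2 * 2 = 1 - of_real t"
  proof -
    have "z2 * cnj z2 * 2 + u2 * u2 * 2 = (z2 * cnj z2 + u2 * cnj u2) * 2"
      by (simp add: products(3) distrib_right)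
    also have "\<dots> = 1 - of_real t" unfolding e22 by simp
    finally show ?thesis .
  qed
  have "fst (line_point z u) = fst (S5_slice x)"
    by (simp add: line_point_def z_def u_def S5_slice_def traceless_def x vec_eq_iff forall_3 mat_def axis_def
        scaleR_conv_of_real [where 'a = complex] e22' products pc)
  moreover have "snd (line_point z u) = snd (S5_slice x)"
    by (simp add: line_point_def z_def u_def S5_slice_def vec_eq_iff forall_3 axis_def q_def [symmetric]
        scaleR_conv_of_real [where 'a = complex] products)
  ultimately have e: "S5_slice x = line_point z u" by (simp add: prod_eq_iff)
  moreover have "hdot z z + hdot u u = 1"
    unfolding line_point_trace e [symmetric]
    by (simp add: S5_slice_def sum_3 traceless_def x mat_def axis_def scaleR_conv_of_real [where 'a = complex] field_simps)
  ultimately show ?thesis unfolding HP2_model_def by blast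
qed

lemma norm_snd_S5_slice: "norm x \<le> 1 \<Longrightarrow> norm (snd (S5_slice x)) = sqrt (1 - (norm x)\<^sup>2) / 2"
  using norm_power2_le [of x] by (simp add: S5_slice_def norm_axis_1)

lemma S5_slice_inj: "S5_slice x = S5_slice x' \<Longrightarrow> x = x'"
  by (rule traceless_inj) (simp add: S5_slice_def)

text \<open>At both slice points w is a positive multiple of e_3, and \<open>g\<close> preserves its
  length; hence \<open>g\<close> fixes e_3.\<close>

lemma S5_slice_stabilizer:
  assumes g: "g \<in> carrier SU3" and x: "norm x < 1" "norm x' < 1" and e: "act g (S5_slice x) = S5_slice x'"
  shows "g \<in> SU2"
proof -
  have "norm (snd (S5_slice x)) = norm (snd (S5_slice x'))" using e norm_snd_act [OF g] by metis
  then have n: "sqrt (1 - (norm x)\<^sup>2) / 2 = sqrt (1 - (norm x')\<^sup>2) / 2" using x by (simp add: norm_snd_S5_slice)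
  have "(sqrt (1 - (norm x)\<^sup>2) / 2) *\<^sub>R (g *v unit_vec 3) = (sqrt (1 - (norm x')\<^sup>2) / 2) *\<^sub>R unit_vec 3"
    using arg_cong [OF e, of snd] by (simp add: act_def S5_slice_def matrix_vector_scaleR_right)
  moreover have "(norm x')\<^sup>2 < 1" using x(2) by (simp add: power_less_one_iff)
  then have "sqrt (1 - (norm x')\<^sup>2) / 2 \<noteq> 0" by simp
  ultimately have "g *v unit_vec 3 = unit_vec 3" unfolding n scaleR_cancel_left by blast
  then show ?thesis using g by (simp add: SU2_eq)
qed

text \<open>Both \<open>z\<close> and \<open>u\<close> are orthogonal to w, so they lie in the first
  two coordinates and P is a 2 by 2 block of trace 1. This gives the form of the slice, and the
  determinant |w|^2 of the block fixes |x|.\<close>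

lemma S5_slice_coordinates:
  assumes y: "y \<in> HP2_model" "snd y = r *\<^sub>R unit_vec 3" and r: "r > 0"
  defines "x \<equiv> (2 * fst y $ 2 $ 1, 2 * Re (fst y $ 1 $ 1) - 1)"
  shows "S5_slice x = y" "(norm x)\<^sup>2 = 1 - 4 * r\<^sup>2"
proof -
  obtain z u where zu: "y = line_point z u" "hdot z z + hdot u u = 1"
    using y(1) by (auto simp: HP2_model_def)
  have w: "ccross z u = r *\<^sub>R unit_vec 3" using y(2) by (simp add: zu line_point_def)
  have "hdot v (r *\<^sub>R unit_vec 3) = of_real r * cnj (v$3)" for v
    by (simp add: hdot_def sum_3 axis_def scaleR_conv_of_real [where 'a = complex])
  then have z3: "z$3 = 0" "u$3 = 0"
    using hdot_ccross(1) [where z = z and u = u] hdot_ccross(2) [where z = z and u = u] r unfolding w by simp_all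
  define A where "A = (cmod (z$1))\<^sup>2 + (cmod (u$1))\<^sup>2"
  have A: "z$1 * cnj (z$1) + u$1 * cnj (u$1) = of_real A"
    by (simp only: A_def of_real_add complex_norm_square)
  have trace: "z$1 * cnj (z$1) + z$2 * cnj (z$2) + (u$1 * cnj (u$1) + u$2 * cnj (u$2)) = 1"
    using zu(2) by (simp add: hdot_def sum_3 z3 mult.commute)
  then have A2: "z$2 * cnj (z$2) + u$2 * cnj (u$2) = 1 - of_real A"
    unfolding A [symmetric] by (simp add: algebra_simps)
  define \<beta> where "\<beta> = 2 * (z$2 * cnj (z$1) + u$2 * cnj (u$1))"
  have x: "x = (\<beta>, 2 * A - 1)"
    using A by (simp add: x_def zu line_point_def \<beta>_def)
  define t where "t = 2 * A - 1"
  have A_t: "of_real A = 1 / 2 + complex_of_real t / 2" by (simp add: t_def field_simps)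
  have entries: "z$1 * cnj (z$1) + u$1 * cnj (u$1) = 1 / 2 + of_real t / 2"
    "z$2 * cnj (z$2) + u$2 * cnj (u$2) = 1 / 2 - of_real t / 2"
    "z$2 * cnj (z$1) + u$2 * cnj (u$1) = \<beta> / 2" "z$1 * cnj (z$2) + u$1 * cnj (u$2) = cnj \<beta> / 2"
    unfolding A A2 A_t by (simp_all add: \<beta>_def mult.commute)
  have fst_eq: "fst (S5_slice x) = fst y"
    by (simp add: x t_def [symmetric] S5_slice_def traceless_def zu line_point_def vec_eq_iff forall_3 mat_def axis_def z3
        scaleR_conv_of_real [where 'a = complex] entries add_divide_distrib diff_divide_distrib)
  have w3: "cnj (z$1 * u$2 - z$2 * u$1) = of_real r"
    using arg_cong [OF w, of "\<lambda>v. v $ 3"] by (simp add: axis_def scaleR_conv_of_real [where 'a = complex])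
  then have w3': "z$1 * u$2 - z$2 * u$1 = of_real r" by (metis complex_cnj_cnj complex_cnj_complex_of_real)
  have "4 * (of_real r * of_real r) = 4 * ((z$1 * u$2 - z$2 * u$1) * cnj (z$1 * u$2 - z$2 * u$1))"
    by (simp only: w3' complex_cnj_complex_of_real)
  \<comment> \<open>Lagrange's identity in C^2: the squared modulus of the determinant of (z, u) is
    the determinant of the block of P.\<close>
  also have "\<dots> = 4 * (z$1 * cnj (z$1) + u$1 * cnj (u$1)) * (z$2 * cnj (z$2) + u$2 * cnj (u$2)) - \<beta> * cnj \<beta>"
    by (simp add: \<beta>_def algebra_simps)
  also have "\<dots> = of_real (4 * A * (1 - A) - (cmod \<beta>)\<^sup>2)"
    by (simp only: A A2 of_real_diff of_real_mult complex_norm_square of_real_1 of_real_numeral)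
  finally have "complex_of_real (4 * (r * r)) = of_real (4 * A * (1 - A) - (cmod \<beta>)\<^sup>2)" by simp
  then have "4 * (r * r) = 4 * A * (1 - A) - (cmod \<beta>)\<^sup>2" by (simp only: of_real_eq_iff)
  then show n: "(norm x)\<^sup>2 = 1 - 4 * r\<^sup>2"
    unfolding norm_prod_power2 by (simp add: x power2_eq_square algebra_simps)
  have e: "1 - (norm x)\<^sup>2 = (2 * r)\<^sup>2" by (simp add: n power_mult_distrib)
  have "sqrt (1 - (norm x)\<^sup>2) = 2 * r" unfolding e real_sqrt_abs using r by simp
  then have "snd (S5_slice x) = snd y" by (simp add: S5_slice_def y(2))
  then show "S5_slice x = y" using fst_eq by (simp add: prod_eq_iff)
qed

lemma S5_disc_bundle_model:
  obtains \<sigma> :: "complex^3^3 \<Rightarrow> real^3 \<Rightarrow> real^3" and i where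
    "orthogonal_representation SU3 SU2 \<sigma>"
    "equivariant_diffeomorphism SU3 (disc_bundle SU3 SU2 \<sigma>) (bundle_action SU3)
       (euclidean_subset {y \<in> HP2_model. 2 / 5 \<le> norm (snd y)}) act i"
    "\<And>g v. g \<in> carrier SU3 \<Longrightarrow> v \<in> cball 0 1 \<Longrightarrow> norm (snd (i (bundle_class SU3 SU2 \<sigma> (g, v)))) = 2 / 5 \<longleftrightarrow> norm v = 1"
    "\<And>g v. g \<in> carrier SU3 \<Longrightarrow> v \<in> cball 0 1 \<Longrightarrow> norm (snd (i (bundle_class SU3 SU2 \<sigma> (g, v)))) = 1 / 2 \<longleftrightarrow> v = 0"
proof -
  note result = that
  let ?Y = "{y \<in> HP2_model. 2 / 5 \<le> norm (snd y)}"
  have "DIM(real^3) = DIM(complex \<times> real)" by simp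
  then obtain f :: "real^3 \<Rightarrow> complex \<times> real" and f' where f: "linear f" "linear f'"
      "\<And>x. norm (f x) = norm x" "\<And>y. norm (f' y) = norm y" "\<And>x. f' (f x) = x" "\<And>y. f (f' y) = y"
    by (rule isomorphisms_UNIV_UNIV) blast
  have bl: "bounded_linear f" "bounded_linear f'" using f(1,2) linear_conv_bounded_linear by blast+
  define \<sigma> where "\<sigma> k v = f' (SU2_rep k (f v))" for k v
  \<comment> \<open>|w| = sqrt (1 - |x|^2) / 2 equals 2/5 exactly for |x| = 3/5, hence this
    radius.\<close>
  define N where "N v = S5_slice ((3 / 5) *\<^sub>R f v)" for v
  have rep: "orthogonal_representation SU3 SU2 \<sigma>"
    unfolding orthogonal_representation_def
  proof (intro conjI ballI allI)
    fix k assume k: "k \<in> SU2"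
    have "linear (\<sigma> k)"
      unfolding \<sigma>_def using linear_compose [OF linear_compose [OF f(1) linear_SU2_rep] f(2)] by (simp add: o_def)
    then show "orthogonal_transformation (\<sigma> k)"
      by (simp add: orthogonal_transformation \<sigma>_def f norm_SU2_rep k)
    show "\<sigma> (k \<otimes>\<^bsub>SU3\<^esub> l) = \<sigma> k \<circ> \<sigma> l" if "l \<in> SU2" for l
      using k that by (auto simp: \<sigma>_def SU3_simps SU2_rep_mult f)
  next
    fix v
    have "smooth_map UNIV (\<lambda>k. \<sigma> k v)"
      unfolding \<sigma>_def SU2_rep_def by (intro smooth_map_linear [OF bl(2)] smooth_intros open_UNIV)
    then show "continuous_on SU2 (\<lambda>k. \<sigma> k v)"
      using smooth_map_imp_continuous_on continuous_on_subset by blast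
  qed
  have small: "(norm ((3 / 5) *\<^sub>R f v))\<^sup>2 = 9 / 25 * (norm v)\<^sup>2" for v
    by (simp add: f power_mult_distrib power2_eq_square)
  have less1: "norm ((3 / 5) *\<^sub>R f v) < 1" if "v \<in> cball 0 1" for v
    using that by (simp add: f)
  have nN: "norm (snd (N v)) = sqrt (1 - 9 / 25 * (norm v)\<^sup>2) / 2" if "v \<in> cball 0 1" for v
    using norm_snd_S5_slice [of "(3 / 5) *\<^sub>R f v"] less1 [OF that] unfolding N_def small by simp
  have le: "2 / 5 \<le> norm (snd (N v)) \<and> (norm (snd (N v)) = 2 / 5 \<longleftrightarrow> norm v = 1) \<and>
      (norm (snd (N v)) = 1 / 2 \<longleftrightarrow> v = 0)" if v: "v \<in> cball 0 1" for v
  proof -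
    define x where "x = 1 - 9 / 25 * (norm v)\<^sup>2"
    have s45: "sqrt (16 / 25) = 4 / 5" by (rule real_sqrt_unique) (simp_all add: power2_eq_square)
    have "sqrt (16 / 25) \<le> sqrt x" using norm_power2_le [of v] v by (intro real_sqrt_le_mono) (simp add: x_def)
    moreover have "sqrt x = 4 / 5 \<longleftrightarrow> x = 16 / 25" unfolding s45 [symmetric] real_sqrt_eq_iff ..
    moreover have "x = 16 / 25 \<longleftrightarrow> (norm v)\<^sup>2 = 1" by (auto simp: x_def)
    moreover have "(norm v)\<^sup>2 = 1 \<longleftrightarrow> norm v = 1"
      by (simp add: power2_eq_1_iff) (metis norm_ge_zero not_one_le_zero neg_0_le_iff_le)
    moreover have "sqrt x = 1 \<longleftrightarrow> v = 0" by (simp add: x_def)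
    ultimately show ?thesis unfolding nN [OF v] x_def [symmetric] s45 by auto
  qed
  have "\<exists>i. equivariant_diffeomorphism SU3 (disc_bundle SU3 SU2 \<sigma>) (bundle_action SU3) (euclidean_subset ?Y) act i \<and>
     (\<forall>g v. g \<in> carrier SU3 \<longrightarrow> v \<in> cball 0 1 \<longrightarrow> i (bundle_class SU3 SU2 \<sigma> (g, v)) = act g (N v))"
  proof (rule disc_bundle_model [OF unitary_subgroup_SU2 rep, of "{v. (norm ((3 / 5) *\<^sub>R f v))\<^sup>2 < 1}" N ?Y])
    have sf: "smooth_map UNIV (\<lambda>v. (3 / 5 :: real) *\<^sub>R f v)"
      by (intro smooth_intros smooth_map_linear [OF bl(1)] open_UNIV) 
    have "open {v. (norm ((3 / 5 :: real) *\<^sub>R f v))\<^sup>2 < 1}"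
      by (intro open_Collect_less smooth_map_imp_continuous_on smooth_map_norm_power2 sf smooth_map_const open_UNIV)
    then have smooth_scaled: "smooth_map {v. (norm ((3 / 5) *\<^sub>R f v))\<^sup>2 < 1} (\<lambda>v. (3 / 5 :: real) *\<^sub>R f v)"
      using sf smooth_map_subset by blast
    have "smooth_map {x. (norm x)\<^sup>2 < 1} S5_slice"
    proof -
      have "open {x :: complex \<times> real. (norm x)\<^sup>2 < 1}" by (intro open_Collect_less continuous_intros)
      then show ?thesis
        unfolding S5_slice_def traceless_def by (intro smooth_intros) simp_all
    qed
    then show "smooth_map {v. (norm ((3 / 5) *\<^sub>R f v))\<^sup>2 < 1} N"
      unfolding N_def by (rule smooth_map_compose [OF _ smooth_scaled]) auto
    show "cball 0 1 \<subseteq> {v. (norm ((3 / 5) *\<^sub>R f v))\<^sup>2 < 1}"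
      using less1 by (auto simp: power_less_one_iff)
    show "act k (N v) = N (\<sigma> k v)" if "k \<in> SU2" for k v
      using linear_cmul [OF linear_SU2_rep] by (simp add: N_def \<sigma>_def act_S5_slice [OF that] f)
    show "g \<in> SU2" if "g \<in> carrier SU3" "v \<in> cball 0 1" "v' \<in> cball 0 1" "act g (N v) = N v'" for g v v'
      by (rule S5_slice_stabilizer [OF that(1) less1 [OF that(2)] less1 [OF that(3)] that(4) [unfolded N_def]])
    show "inj_on N (cball 0 1)"
    proof (rule inj_onI)
      fix v v' assume "N v = N v'"
      then have "(3 / 5 :: real) *\<^sub>R f v = (3 / 5) *\<^sub>R f v'" using S5_slice_inj unfolding N_def by blast
      then have "f v = f v'" by simp
      then show "v = v'" using f(5) by metis
    qed
    show "act g (N v) \<in> ?Y" if g: "g \<in> carrier SU3" and v: "v \<in> cball 0 1" for g v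
      using S5_slice_in_HP2_model [OF less1 [OF v]] act_HP2_model [OF g] norm_snd_act [OF g] le [OF v]
      by (simp add: N_def)
    fix y0 assume y0: "y0 \<in> ?Y"
    \<comment> \<open>w does not vanish on this part, so its direction provides the section; the
      eigenline, which degenerates at |w| = 1/2, is avoided.\<close>
    then have "snd y0 \<noteq> 0" by auto
    then obtain W' s' where W': "snd y0 \<in> W'" "smooth_map W' s'"
      "\<forall>c\<in>W'. c \<noteq> 0 \<and> s' c \<in> carrier SU3 \<and> s' c *v unit_vec 3 = normalize_vec c"
      using third_column_section by metis
    define W where "W = {y :: (complex^3^3) \<times> (complex^3). snd y \<in> W'}"
    define s where "s y = s' (snd y)" for y :: "(complex^3^3) \<times> (complex^3)"
    \<comment> \<open>The coordinates of \<open>S5_slice_coordinates\<close> at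
      \<open>act (dag (s y)) y\<close>, divided by the radius 3/5.\<close>
    define t where "t y = f' ((5 / 3) *\<^sub>R (2 * (dag (s y) ** fst y ** s y) $ 2 $ 1,
        2 * Re ((dag (s y) ** fst y ** s y) $ 1 $ 1) - 1))" for y
    have oW: "open W"
      using open_vimage [OF smooth_map_open [OF W'(2)] continuous_on_snd [OF continuous_on_id]]
      by (simp add: W_def vimage_def)
    have "smooth_map W s"
      unfolding s_def by (rule smooth_map_compose [OF W'(2)]) (auto simp: W_def intro!: smooth_intros oW [unfolded W_def])
    moreover from this have "smooth_map W t"
      unfolding t_def by (intro smooth_map_linear [OF bl(2)] smooth_intros oW)
    moreover have "s y \<in> carrier SU3 \<and> t y \<in> cball 0 1 \<and> act (s y) (N (t y)) = y" if y: "y \<in> W \<inter> ?Y" for y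
    proof -
      have sy: "s y \<in> carrier SU3" "s y *v unit_vec 3 = normalize_vec (snd y)" "snd y \<noteq> 0"
        using y W'(3) by (auto simp: W_def s_def)
      define r where "r = norm (snd y)"
      have r: "r > 0" "2 / 5 \<le> r" using sy(3) y by (simp_all add: r_def)
      have "snd y = r *\<^sub>R (s y *v unit_vec 3)" using sy by (simp add: r_def normalize_vec_def)
      then have "dag (s y) *v snd y = r *\<^sub>R ((dag (s y) ** s y) *v unit_vec 3)"
        by (simp add: matrix_vector_scaleR_right matrix_vector_mul_assoc)
      then have "snd (act (dag (s y)) y) = r *\<^sub>R unit_vec 3" by (simp add: act_def SU3.left_inverse sy(1))
      moreover have "act (dag (s y)) y \<in> HP2_model" using act_HP2_model SU3.dag [OF sy(1)] y by blast
      ultimately have coords: "S5_slice (2 * fst (act (dag (s y)) y) $ 2 $ 1, 2 * Re (fst (act (dag (s y)) y) $ 1 $ 1) - 1) = act (dag (s y)) y"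
        "(norm (2 * fst (act (dag (s y)) y) $ 2 $ 1, 2 * Re (fst (act (dag (s y)) y) $ 1 $ 1) - 1))\<^sup>2 = 1 - 4 * r\<^sup>2"
        using S5_slice_coordinates r(1) by blast+
      define x where "x = (2 * fst (act (dag (s y)) y) $ 2 $ 1, 2 * Re (fst (act (dag (s y)) y) $ 1 $ 1) - 1)"
      have ty: "t y = f' ((5 / 3) *\<^sub>R x)" by (simp only: t_def x_def act_def fst_conv dag_dag)
      have "(2 / 5)\<^sup>2 \<le> r\<^sup>2" using r by (intro power_mono) auto
      then have "(norm x)\<^sup>2 \<le> (3 / 5)\<^sup>2" using coords(2) unfolding x_def [symmetric] by (simp add: power2_eq_square)
      then have "norm x \<le> 3 / 5" by (rule power2_le_imp_le) simp
      then have "norm (t y) \<le> 1" unfolding ty f(4) by simp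
      moreover have "N (t y) = S5_slice x" by (simp add: N_def ty f(6))
      ultimately show ?thesis using coords(1) sy(1) act_cancel(2) [OF sy(1)] unfolding x_def [symmetric] by simp
    qed
    ultimately show "\<exists>W s t. y0 \<in> W \<and> smooth_map W s \<and> smooth_map W t \<and>
      (\<forall>y'\<in>W \<inter> ?Y. s y' \<in> carrier SU3 \<and> t y' \<in> cball 0 1 \<and> act (s y') (N (t y')) = y')"
      using W'(1) by (intro exI [of _ W] exI [of _ s] exI [of _ t]) (simp add: W_def)
  qed blast
  then obtain i where i: "equivariant_diffeomorphism SU3 (disc_bundle SU3 SU2 \<sigma>) (bundle_action SU3) (euclidean_subset ?Y) act i"
    "\<And>g v. g \<in> carrier SU3 \<Longrightarrow> v \<in> cball 0 1 \<Longrightarrow> i (bundle_class SU3 SU2 \<sigma> (g, v)) = act g (N v)"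
    by blast
  show thesis
    by (rule result [OF rep i(1)]) (use le in \<open>auto simp: i(2) norm_snd_act\<close>)
qed

section \<open>The cohomogeneity one action\<close>

text \<open>The orbits and the homogeneous spaces are compared through a common subset of the
  Euclidean model.\<close>

lemma equivariantly_diffeomorphic_common_model:
  assumes "equivariant_diffeomorphism G A a N m \<alpha>" "equivariant_diffeomorphism G B b N m \<beta>"
    and "determined_by_values B" "\<And>g x. g \<in> carrier G \<Longrightarrow> x \<in> points B \<Longrightarrow> b g x \<in> points B"
  shows "equivariant_diffeomorphism G A a B b (inv_into (points B) \<beta> \<circ> \<alpha>)"
proof -
  have "inj_on \<beta> (points B)"
    using assms(2) diffeomorphism_inj_on by (auto simp: equivariant_diffeomorphism_def)
  then have "equivariant_diffeomorphism G N m B b (inv_into (points B) \<beta>)"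
    by (intro equivariant_diffeomorphism_inverse [OF assms(2-4)]) simp_all
  then show ?thesis using assms(1) equivariant_diffeomorphism_trans by blast
qed

lemma determined_by_values_homogeneous_space: "determined_by_values (homogeneous_space G H)"
  by (simp add: homogeneous_space_def determined_by_values_smooth_quotient determined_by_values_euclidean_subset)

lemma determined_by_values_disc_bundle: "determined_by_values (disc_bundle G K \<rho>)"
  by (simp add: disc_bundle_def determined_by_values_smooth_quotient determined_by_values_euclidean_subset)

lemma determined_by_values_CP2: "determined_by_values CP2"
  by (simp add: CP2_def S5_def determined_by_values_smooth_quotient determined_by_values_euclidean_subset)

lemma coset_action_in_points:
  assumes "g \<in> carrier SU3" "C \<in> points (homogeneous_space SU3 H)"
  shows "coset_action SU3 g C \<in> points (homogeneous_space SU3 H)"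
  using assms SU3.mult by (auto simp: homogeneous_space_def SU3.coset_action_l_coset)

lemma CP2_action_in_points:
  assumes g: "g \<in> carrier SU3" and L: "L \<in> points CP2"
  shows "CP2_action g L \<in> points CP2"
proof -
  obtain z where z: "z \<in> sphere 0 1" "L = {c *s z | c. True}" using L by (auto simp: CP2_def S5_def)
  then have "g *v z \<in> sphere 0 1" using norm_unitary [OF SU3.unitary [OF g]] by simp
  then show ?thesis unfolding z(2) CP2_action_line by (auto simp: CP2_def S5_def)
qed

lemma points_disc_bundle: "points (disc_bundle SU3 K \<rho>) = bundle_class SU3 K \<rho> ` (carrier SU3 \<times> cball 0 1)"
  by (simp add: disc_bundle_def)

text \<open>Meant for the unit sphere and for {0} as \<open>V\<close>: it turns the boundary and the
  zero section into level sets of |w|.\<close>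

lemma disc_bundle_level_set:
  assumes \<alpha>: "equivariant_diffeomorphism SU3 (disc_bundle SU3 K \<rho>) (bundle_action SU3) (euclidean_subset Y) act \<alpha>"
    and V: "V \<subseteq> cball 0 1"
    and Q: "\<And>g v. g \<in> carrier SU3 \<Longrightarrow> v \<in> cball 0 1 \<Longrightarrow> Q (\<alpha> (bundle_class SU3 K \<rho> (g, v))) \<longleftrightarrow> v \<in> V"
  shows "\<alpha> ` (bundle_class SU3 K \<rho> ` (carrier SU3 \<times> V)) = {y \<in> Y. Q y}"
    "x \<in> points (disc_bundle SU3 K \<rho>) \<Longrightarrow> x \<in> bundle_class SU3 K \<rho> ` (carrier SU3 \<times> V) \<longleftrightarrow> Q (\<alpha> x)"
proof -
  have Y: "\<alpha> ` points (disc_bundle SU3 K \<rho>) = Y"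
    using \<alpha> diffeomorphism_image by (fastforce simp: equivariant_diffeomorphism_def)
  have inj: "inj_on \<alpha> (points (disc_bundle SU3 K \<rho>))"
    using \<alpha> diffeomorphism_inj_on by (auto simp: equivariant_diffeomorphism_def)
  show image: "\<alpha> ` (bundle_class SU3 K \<rho> ` (carrier SU3 \<times> V)) = {y \<in> Y. Q y}"
  proof (intro equalityI subsetI)
    fix y assume "y \<in> \<alpha> ` (bundle_class SU3 K \<rho> ` (carrier SU3 \<times> V))"
    then obtain g v where gv: "g \<in> carrier SU3" "v \<in> V" "y = \<alpha> (bundle_class SU3 K \<rho> (g, v))" by auto
    then have "v \<in> cball 0 1" using V by blast
    then show "y \<in> {y \<in> Y. Q y}"
      using gv Q unfolding Y [symmetric] points_disc_bundle by blast
  next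
    fix y assume y: "y \<in> {y \<in> Y. Q y}"
    then obtain g v where gv: "g \<in> carrier SU3" "v \<in> cball 0 1" "y = \<alpha> (bundle_class SU3 K \<rho> (g, v))"
      unfolding Y [symmetric] points_disc_bundle by auto
    then have "v \<in> V" using Q y by blast
    then show "y \<in> \<alpha> ` (bundle_class SU3 K \<rho> ` (carrier SU3 \<times> V))" using gv by blast
  qed
  assume x: "x \<in> points (disc_bundle SU3 K \<rho>)"
  have sub: "bundle_class SU3 K \<rho> ` (carrier SU3 \<times> V) \<subseteq> points (disc_bundle SU3 K \<rho>)"
    unfolding points_disc_bundle using V by blast
  have "x \<in> bundle_class SU3 K \<rho> ` (carrier SU3 \<times> V) \<longleftrightarrow> \<alpha> x \<in> \<alpha> ` (bundle_class SU3 K \<rho> ` (carrier SU3 \<times> V))"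
    using inj_on_image_mem_iff [OF inj x sub] by blast
  then show "x \<in> bundle_class SU3 K \<rho> ` (carrier SU3 \<times> V) \<longleftrightarrow> Q (\<alpha> x)"
    unfolding image using x Y by blast
qed

lemma bundle_boundary_closed:
  assumes K: "unitary_subgroup (carrier SU3) K" and "g \<in> carrier SU3" "x \<in> bundle_boundary SU3 K \<rho>"
  shows "bundle_action SU3 g x \<in> bundle_boundary SU3 K \<rho>"
  using assms(2,3) SU3.mult unfolding bundle_boundary_def
  by (auto simp: bundle_action_bundle_class [OF K])

text \<open>\<open>U1 1 0\<close> is abelian, whereas \<open>a\<close> and \<open>b\<close>, the
  quaternion units i and j of SU(2), do not commute.\<close>

lemma SU2_not_subconjugate:
  assumes h: "h \<in> carrier SU3" and K: "SU2 \<subseteq> K"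
  shows "\<not> (\<lambda>g. h ** g ** dag h) ` K \<subseteq> U1 1 0"
proof
  assume sub: "(\<lambda>g. h ** g ** dag h) ` K \<subseteq> U1 1 0"
  define a b :: "complex^3^3" where "a = diag3 \<i> (- \<i>) 1"
    and "b = vector [vector [0, 1, 0], vector [- 1, 0, 0], vector [0, 0, 1]]"
  have "a \<in> SU2" "b \<in> SU2"
    by (simp_all add: SU2_iff U2_iff carrier_SU3 unitary_iff a_def b_def diag3_def det_3 vec_eq_iff forall_3
        matrix_matrix_mult_def sum_3 mat_def)
  then have "h ** a ** dag h \<in> U1 1 0" "h ** b ** dag h \<in> U1 1 0" using sub K by blast+
  moreover have "p ** q = q ** p" if "p \<in> U1 1 0" "q \<in> U1 1 0" for p q
    using that unfolding U1_1_0
    by (auto simp: diag3_def vec_eq_iff forall_3 matrix_matrix_mult_def sum_3 mult.commute)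
  ultimately have e: "(h ** a ** dag h) ** (h ** b ** dag h) = (h ** b ** dag h) ** (h ** a ** dag h)" by blast
  have c: "(h ** p ** dag h) ** (h ** q ** dag h) = h ** (p ** q) ** dag h" for p q
    using h by (simp add: matrix_mul_assoc [symmetric] SU3.cancel)
  have "dag h ** (h ** (a ** b) ** dag h) ** h = dag h ** (h ** (b ** a) ** dag h) ** h"
    using e unfolding c by simp
  then have "a ** b = b ** a"
    using h by (simp add: matrix_mul_assoc [symmetric] SU3.cancel SU3.left_inverse)
  then have "(a ** b) $ 1 $ 2 = (b ** a) $ 1 $ 2" by simp
  then show False
    by (simp add: a_def b_def diag3_def matrix_matrix_mult_def sum_3 complex_eq_iff)
qed

text \<open>The isotropy group is conjugate to U(2) or SU(2), so it contains a conjugate of SU(2).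
  This keeps the two extreme levels from being principal.\<close>

lemma stabilizer_not_small:
  assumes y: "y \<in> HP2_model" "norm (snd y) = 0 \<or> norm (snd y) = 1 / 2"
  shows "\<not> isotropy y \<subseteq> U1 1 0"
proof -
  obtain g where g: "g \<in> carrier SU3" "y = act g (normal_form (norm (snd y)))"
    using HP2_model_normal_form_norm [OF y(1)] by blast
  show ?thesis
  proof (cases "norm (snd y) = 0")
    case True
    then have "isotropy y = (\<lambda>k. g ** k ** dag g) ` U2"
      using g isotropy_act isotropy_normal_form_0 by metis
    moreover have "SU2 \<subseteq> U2" by (auto simp: SU2_iff)
    ultimately show ?thesis using SU2_not_subconjugate [OF g(1)] by simp
  next
    case False
    then have "y = act g (S5_point (unit_vec 2))" using g(2) y(2) normal_form_half by metis
    also have "S5_point (unit_vec 2) = act (dag cyc) (S5_point (unit_vec 3))"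
      using act_eq_iff [OF cyc, of "S5_point (unit_vec 2)" "S5_point (unit_vec 3)"]
      by (simp add: act_S5_point cyc cyc_unit_vec)
    finally have "y = act (g ** dag cyc) (S5_point (unit_vec 3))" by (simp add: act_mult)
    moreover have h: "g ** dag cyc \<in> carrier SU3" using g(1) cyc SU3.mult SU3.dag by blast
    ultimately have "isotropy y = (\<lambda>k. (g ** dag cyc) ** k ** dag (g ** dag cyc)) ` SU2"
      using isotropy_act [OF h] isotropy_S5_point by metis
    then show ?thesis using SU2_not_subconjugate [OF h, of SU2] by simp
  qed
qed

theorem proposition3p2:
  shows
    "cohomogeneity_one TYPE(real^7) SU3 HP2 HP2_action \<and>
     (\<exists>S T.
        singular_orbit TYPE(real^4) TYPE(real^7) SU3 HP2 HP2_action S \<and>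
        singular_orbit TYPE(real^5) TYPE(real^7) SU3 HP2 HP2_action T \<and>
        orbits SU3 (points HP2) HP2_action =
          principal_orbits SU3 (points HP2) HP2_action \<union> {S, T} \<and>
        equivariantly_diffeomorphic SU3 (smooth_restrict HP2 S) HP2_action
          (homogeneous_space SU3 U2) (coset_action SU3) \<and>
        equivariantly_diffeomorphic SU3 (homogeneous_space SU3 U2) (coset_action SU3)
          CP2 CP2_action \<and>
        equivariantly_diffeomorphic SU3 (smooth_restrict HP2 T) HP2_action
          (homogeneous_space SU3 SU2) (coset_action SU3) \<and>
        equivariantly_diffeomorphic SU3 (homogeneous_space SU3 SU2) (coset_action SU3)
          S5 S5_action \<and>
        (\<exists>(\<rho> :: complex^3^3 \<Rightarrow> real^4 \<Rightarrow> real^4) (\<sigma> :: complex^3^3 \<Rightarrow> real^3 \<Rightarrow> real^3) i j \<phi>.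
           orthogonal_representation SU3 U2 \<rho> \<and>
           orthogonal_representation SU3 SU2 \<sigma> \<and>
           equivariant_gluing SU3 HP2 HP2_action
             (disc_bundle SU3 U2 \<rho>) (bundle_boundary SU3 U2 \<rho>) (bundle_action SU3) i
             (disc_bundle SU3 SU2 \<sigma>) (bundle_boundary SU3 SU2 \<sigma>) (bundle_action SU3) j \<phi> \<and>
           i ` zero_section SU3 U2 \<rho> = S \<and>
           j ` zero_section SU3 SU2 \<sigma> = T)) \<and>
     (\<forall>P\<in>principal_orbits SU3 (points HP2) HP2_action.
        equivariantly_diffeomorphic SU3 (smooth_restrict HP2 P) HP2_action
          (Aloff_Wallach 1 (-1)) (coset_action SU3)) \<and>
     equivariantly_diffeomorphic SU3 (Aloff_Wallach 1 (-1)) (coset_action SU3)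
       (Aloff_Wallach 1 0) (coset_action SU3)"
proof -
  obtain \<psi> where \<psi>: "equivariant_diffeomorphism SU3 HP2 HP2_action (euclidean_subset HP2_model) act \<psi>"
    using HP2_equivariant_model by blast
  have d\<psi>: "diffeomorphism HP2 (euclidean_subset HP2_model) \<psi>"
    and eq\<psi>: "\<And>g x. g \<in> carrier SU3 \<Longrightarrow> x \<in> points HP2 \<Longrightarrow> \<psi> (HP2_action g x) = act g (\<psi> x)"
    using \<psi> by (auto simp: equivariant_diffeomorphism_def)
  have image: "\<psi> ` points HP2 = HP2_model" using diffeomorphism_image [OF d\<psi>] by simp
  have inj: "inj_on \<psi> (points HP2)" by (rule diffeomorphism_inj_on [OF d\<psi>])
  have det: "determined_by_values HP2" by (simp add: HP2_def determined_by_values_homogeneous_space)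
  have in_model: "\<psi> x \<in> HP2_model" if "x \<in> points HP2" for x using image that by blast
  \<comment> \<open>A set of values of |w| is allowed, so that the orbits and the images of the two
    disc bundles are covered by the same facts.\<close>
  define level where "level R = {x \<in> points HP2. norm (snd (\<psi> x)) \<in> R}" for R
  have level_points: "level R \<subseteq> points HP2" for R by (auto simp: level_def)
  have level_image: "\<psi> ` level R = {y \<in> HP2_model. norm (snd y) \<in> R}" for R
    unfolding level_def image [symmetric] by auto
  have level_closed: "HP2_action g x \<in> level R" if "g \<in> carrier SU3" "x \<in> level R" for g x R
    using that HP2_action_in_points by (simp add: level_def eq\<psi> norm_snd_act)
  have level_model: "equivariant_diffeomorphism SU3 (smooth_restrict HP2 (level R)) HP2_action
      (euclidean_subset {y \<in> HP2_model. norm (snd y) \<in> R}) act \<psi>" for R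
    using equivariant_diffeomorphism_restrict_euclidean [OF \<psi> det level_points] unfolding level_image .
  have level_diffeo: "diffeomorphism (smooth_restrict HP2 (level {r}))
      (euclidean_subset {y \<in> HP2_model. norm (snd y) = r}) \<psi>" for r
    using level_model [of "{r}"] by (simp add: equivariant_diffeomorphism_def)
  have points_level: "points (smooth_restrict HP2 (level R)) = level R" for R
    using level_points [of R] by auto
  have orbit: "orbit SU3 HP2_action x = level {norm (snd (\<psi> x))}" if x: "x \<in> points HP2" for x
  proof (intro equalityI subsetI)
    fix z assume "z \<in> orbit SU3 HP2_action x"
    then show "z \<in> level {norm (snd (\<psi> x))}"
      using x level_closed [of _ x "{norm (snd (\<psi> x))}"] by (auto simp: orbit_def level_def)
  next
    fix z assume z: "z \<in> level {norm (snd (\<psi> x))}"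
    define r where "r = norm (snd (\<psi> x))"
    have zr: "z \<in> points HP2" "norm (snd (\<psi> z)) = r" using z by (simp_all add: level_def r_def)
    obtain g where g: "g \<in> carrier SU3" "\<psi> x = act g (normal_form r)"
      using HP2_model_normal_form_norm [OF in_model [OF x]] unfolding r_def by blast
    obtain h where h: "h \<in> carrier SU3" "\<psi> z = act h (normal_form r)"
      using HP2_model_normal_form_norm [OF in_model [OF zr(1)]] unfolding zr(2) by blast
    \<comment> \<open>\<open>x\<close> and \<open>z\<close> both come from the normal form of their
      common level, so this product carries \<open>x\<close> to \<open>z\<close>.\<close>
    have hg: "h ** dag g \<in> carrier SU3" using g h SU3.mult SU3.dag by blast
    have "\<psi> (HP2_action (h ** dag g) x) = \<psi> z"
      using g h by (simp add: eq\<psi> [OF hg x] act_mult act_cancel)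
    then have "z = HP2_action (h ** dag g) x"
      using inj zr(1) HP2_action_in_points [OF hg x] by (auto dest: inj_onD)
    then show "z \<in> orbit SU3 HP2_action x" using hg by (auto simp: orbit_def)
  qed
  have ex_level: "\<exists>x\<in>points HP2. \<psi> x = act g (normal_form r) \<and> norm (snd (\<psi> x)) = r"
    if "g \<in> carrier SU3" "0 \<le> r" "r \<le> 1 / 2" for g r
  proof -
    have "act g (normal_form r) \<in> \<psi> ` points HP2"
      unfolding image by (rule act_HP2_model [OF that(1) normal_form_in_HP2_model [OF that(2,3)]])
    then obtain x where "x \<in> points HP2" "\<psi> x = act g (normal_form r)" by auto
    then show ?thesis using that by (intro bexI [of _ x]) (simp_all add: norm_snd_act norm_snd_normal_form)
  qed
  have orbits: "orbits SU3 (points HP2) HP2_action = {level {r} | r. 0 \<le> r \<and> r \<le> 1 / 2}"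
  proof (intro equalityI subsetI)
    fix P assume "P \<in> orbits SU3 (points HP2) HP2_action"
    then obtain x where "x \<in> points HP2" "P = level {norm (snd (\<psi> x))}" using orbit by (auto simp: orbits_def)
    then show "P \<in> {level {r} | r. 0 \<le> r \<and> r \<le> 1 / 2}" using norm_snd_le_half in_model norm_ge_zero by blast
  next
    fix P assume "P \<in> {level {r} | r. 0 \<le> r \<and> r \<le> 1 / 2}"
    then obtain r where r: "0 \<le> r" "r \<le> 1 / 2" "P = level {r}" by blast
    then obtain x where "x \<in> points HP2" "norm (snd (\<psi> x)) = r" using ex_level [OF SU3.one] by blast
    then show "P \<in> orbits SU3 (points HP2) HP2_action" using orbit r(3) by (auto simp: orbits_def)
  qed
  have stab: "stabilizer SU3 HP2_action x = isotropy (\<psi> x)" if x: "x \<in> points HP2" for x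
  proof -
    have "HP2_action g x = x \<longleftrightarrow> act g (\<psi> x) = \<psi> x" if "g \<in> carrier SU3" for g
      using inj HP2_action_in_points [OF that x] x eq\<psi> [OF that x] by (metis inj_onD)
    then show ?thesis by (auto simp: stabilizer_def isotropy_def)
  qed
  have principal: "principal_orbits SU3 (points HP2) HP2_action = {level {r} | r. 0 < r \<and> r < 1 / 2}"
  proof (intro equalityI subsetI)
    fix P assume P: "P \<in> principal_orbits SU3 (points HP2) HP2_action"
    then obtain r where r: "0 \<le> r" "r \<le> 1 / 2" "P = level {r}"
      unfolding principal_orbits_def orbits by blast
    \<comment> \<open>The value 1/4 stands for any intermediate level: its isotropy group is the
      circle \<open>U1 1 0\<close>, which contains no isotropy group of an extreme level.\<close>
    obtain y where y: "y \<in> points HP2" "\<psi> y = normal_form (1 / 4)"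
      using ex_level [OF SU3.one, of "1 / 4"] by auto
    then obtain x where x: "x \<in> level {r}" "stabilizer SU3 HP2_action x \<subseteq> stabilizer SU3 HP2_action y"
      using P r(3) unfolding principal_orbits_def by blast
    have xp: "x \<in> points HP2" "norm (snd (\<psi> x)) = r" using x(1) by (auto simp: level_def)
    have "isotropy (\<psi> x) \<subseteq> U1 1 0"
      using x(2) isotropy_normal_form [of "1 / 4"] by (simp add: stab xp(1) y)
    then have "r \<noteq> 0 \<and> r \<noteq> 1 / 2" using stabilizer_not_small [OF in_model [OF xp(1)]] xp(2) by blast
    then show "P \<in> {level {r} | r. 0 < r \<and> r < 1 / 2}" using r by force
  next
    fix P assume "P \<in> {level {r} | r. 0 < r \<and> r < 1 / 2}"
    then obtain r where r: "0 < r" "r < 1 / 2" "P = level {r}" by blast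
    have "\<exists>x\<in>P. stabilizer SU3 HP2_action x \<subseteq> stabilizer SU3 HP2_action y" if y: "y \<in> points HP2" for y
    proof -
      obtain g where g: "g \<in> carrier SU3" "\<psi> y = act g (normal_form (norm (snd (\<psi> y))))"
        using HP2_model_normal_form_norm [OF in_model [OF y]] by blast
      \<comment> \<open>The same \<open>g\<close> is used on both levels, so the inclusion of the
        circle in every isotropy group is merely conjugated by \<open>g\<close>.\<close>
      obtain x where x: "x \<in> points HP2" "\<psi> x = act g (normal_form r)" "norm (snd (\<psi> x)) = r"
        using ex_level [OF g(1), of r] r by auto
      have "isotropy (act g (normal_form r)) \<subseteq> isotropy (act g (normal_form (norm (snd (\<psi> y)))))"
        unfolding isotropy_act [OF g(1)] isotropy_normal_form [OF r(1,2)]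
        by (intro image_mono U1_1_0_subset_isotropy)
      then have "isotropy (\<psi> x) \<subseteq> isotropy (\<psi> y)" using x(2) g(2) by simp
      moreover have "x \<in> P" using x r by (simp add: level_def)
      ultimately show ?thesis using stab x(1) y by blast
    qed
    moreover have "P \<in> orbits SU3 (points HP2) HP2_action" unfolding orbits using r by force
    ultimately show "P \<in> principal_orbits SU3 (points HP2) HP2_action" by (simp add: principal_orbits_def)
  qed
  define S T where "S = level {0}" and "T = level {1 / 2}"
  note man = determined_by_values_smooth_restrict level_diffeo
  have principal_manifold: "smooth_manifold TYPE(real^7) (smooth_restrict HP2 P)"
    if "P \<in> principal_orbits SU3 (points HP2) HP2_action" for P
    using that smooth_manifold_principal_orbit [OF _ _ man] unfolding principal by blast
  have cohom: "cohomogeneity_one TYPE(real^7) SU3 HP2 HP2_action"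
    unfolding cohomogeneity_one_def
  proof (intro conjI ballI)
    show "group_action SU3 (points HP2) HP2_action" by (rule group_action_HP2)
    show "smooth_manifold TYPE((real^7) \<times> real) HP2" by (rule smooth_manifold_HP2_model [OF det d\<psi>])
    have "level {1 / 4} \<in> principal_orbits SU3 (points HP2) HP2_action"
      unfolding principal by (intro CollectI exI [of _ "1 / 4"]) simp
    then show "principal_orbits SU3 (points HP2) HP2_action \<noteq> {}" by blast
  qed (rule principal_manifold)
  have singular_S: "singular_orbit TYPE(real^4) TYPE(real^7) SU3 HP2 HP2_action S"
    unfolding singular_orbit_def
  proof (intro conjI ballI)
    show "S \<in> orbits SU3 (points HP2) HP2_action" unfolding orbits S_def by force
    show "smooth_manifold TYPE(real^4) (smooth_restrict HP2 S)"
      unfolding S_def by (rule smooth_manifold_CP2_orbit [OF man])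
  qed (simp_all add: principal_manifold)
  have singular_T: "singular_orbit TYPE(real^5) TYPE(real^7) SU3 HP2 HP2_action T"
    unfolding singular_orbit_def
  proof (intro conjI ballI)
    show "T \<in> orbits SU3 (points HP2) HP2_action" unfolding orbits T_def by force
    show "smooth_manifold TYPE(real^5) (smooth_restrict HP2 T)"
      unfolding T_def by (rule smooth_manifold_S5_orbit [OF man])
  qed (simp_all add: principal_manifold)
  have all_orbits: "orbits SU3 (points HP2) HP2_action =
      principal_orbits SU3 (points HP2) HP2_action \<union> {S, T}"
  proof (intro equalityI subsetI)
    fix P assume "P \<in> orbits SU3 (points HP2) HP2_action"
    then obtain r where r: "0 \<le> r" "r \<le> 1 / 2" "P = level {r}" unfolding orbits by blast
    show "P \<in> principal_orbits SU3 (points HP2) HP2_action \<union> {S, T}"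
    proof (cases "r = 0 \<or> r = 1 / 2")
      case True
      then show ?thesis using r(3) unfolding S_def T_def by blast
    next
      case False
      then have "0 < r" "r < 1 / 2" using r by auto
      then show ?thesis using r(3) unfolding principal by blast
    qed
  next
    fix P assume "P \<in> principal_orbits SU3 (points HP2) HP2_action \<union> {S, T}"
    then show "P \<in> orbits SU3 (points HP2) HP2_action"
      using singular_S singular_T by (auto simp: principal_orbits_def singular_orbit_def)
  qed
  obtain \<kappa> where \<kappa>: "equivariant_diffeomorphism SU3 (homogeneous_space SU3 U2) (coset_action SU3)
      (euclidean_subset {y \<in> HP2_model. norm (snd y) = 0}) act \<kappa>"
    using CP2_orbit_model by blast
  obtain \<kappa>' where \<kappa>': "equivariant_diffeomorphism SU3 CP2 CP2_action
      (euclidean_subset {y \<in> HP2_model. norm (snd y) = 0}) act \<kappa>'"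
    using CP2_model by blast
  obtain \<tau> where \<tau>: "equivariant_diffeomorphism SU3 (homogeneous_space SU3 SU2) (coset_action SU3) S5 S5_action \<tau>"
    using SU3_SU2_model by blast
  note \<tau>' = equivariant_diffeomorphism_trans [OF \<tau> S5_model]
  note hom = determined_by_values_homogeneous_space coset_action_in_points
  have S_U2: "equivariantly_diffeomorphic SU3 (smooth_restrict HP2 S) HP2_action (homogeneous_space SU3 U2) (coset_action SU3)"
    using equivariantly_diffeomorphic_common_model [OF level_model [of "{0}", unfolded singleton_iff] \<kappa> hom]
    unfolding equivariantly_diffeomorphic_def S_def by blast
  have U2_CP2: "equivariantly_diffeomorphic SU3 (homogeneous_space SU3 U2) (coset_action SU3) CP2 CP2_action"
    using equivariantly_diffeomorphic_common_model [OF \<kappa> \<kappa>' determined_by_values_CP2 CP2_action_in_points]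
    unfolding equivariantly_diffeomorphic_def by blast
  have T_SU2: "equivariantly_diffeomorphic SU3 (smooth_restrict HP2 T) HP2_action (homogeneous_space SU3 SU2) (coset_action SU3)"
    using equivariantly_diffeomorphic_common_model [OF level_model [of "{1 / 2}", unfolded singleton_iff] \<tau>' hom]
    unfolding equivariantly_diffeomorphic_def T_def by blast
  have SU2_S5: "equivariantly_diffeomorphic SU3 (homogeneous_space SU3 SU2) (coset_action SU3) S5 S5_action"
    using \<tau> unfolding equivariantly_diffeomorphic_def by blast
  have principal_AW: "equivariantly_diffeomorphic SU3 (smooth_restrict HP2 P) HP2_action (Aloff_Wallach 1 (-1)) (coset_action SU3)"
    if P: "P \<in> principal_orbits SU3 (points HP2) HP2_action" for P
  proof -
    obtain r where r: "0 < r" "r < 1 / 2" "P = level {r}" using P unfolding principal by blast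
    obtain \<alpha> where \<alpha>: "equivariant_diffeomorphism SU3 (Aloff_Wallach 1 (-1)) (coset_action SU3)
        (euclidean_subset {y \<in> HP2_model. norm (snd y) = r}) act \<alpha>"
      using Aloff_Wallach_model(2) [OF r(1,2)] by blast
    show ?thesis
      using equivariantly_diffeomorphic_common_model [OF level_model [of "{r}", unfolded singleton_iff]
          \<alpha> [unfolded Aloff_Wallach_def] hom]
      unfolding equivariantly_diffeomorphic_def r(3) Aloff_Wallach_def by blast
  qed
  have AW: "equivariantly_diffeomorphic SU3 (Aloff_Wallach 1 (-1)) (coset_action SU3) (Aloff_Wallach 1 0) (coset_action SU3)"
  proof -
    \<comment> \<open>Any orbit strictly between the extreme levels identifies the two
      spaces.\<close>
    have r: "0 < (1 / 4 :: real)" "(1 / 4 :: real) < 1 / 2" by simp_all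
    obtain \<alpha> \<beta> where "equivariant_diffeomorphism SU3 (Aloff_Wallach 1 (-1)) (coset_action SU3)
        (euclidean_subset {y \<in> HP2_model. norm (snd y) = 1 / 4}) act \<alpha>"
      and "equivariant_diffeomorphism SU3 (Aloff_Wallach 1 0) (coset_action SU3)
        (euclidean_subset {y \<in> HP2_model. norm (snd y) = 1 / 4}) act \<beta>"
      using Aloff_Wallach_model [OF r] by blast
    from equivariantly_diffeomorphic_common_model [OF this [unfolded Aloff_Wallach_def] hom]
    show ?thesis unfolding equivariantly_diffeomorphic_def Aloff_Wallach_def by blast
  qed
  obtain \<rho> :: "complex^3^3 \<Rightarrow> real^4 \<Rightarrow> real^4" and \<alpha> where \<rho>: "orthogonal_representation SU3 U2 \<rho>"
    and \<alpha>: "equivariant_diffeomorphism SU3 (disc_bundle SU3 U2 \<rho>) (bundle_action SU3)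
       (euclidean_subset {y \<in> HP2_model. norm (snd y) \<le> 2 / 5}) act \<alpha>"
    and \<alpha>b: "\<And>g v. g \<in> carrier SU3 \<Longrightarrow> v \<in> cball 0 1 \<Longrightarrow> norm (snd (\<alpha> (bundle_class SU3 U2 \<rho> (g, v)))) = 2 / 5 \<longleftrightarrow> norm v = 1"
    and \<alpha>z: "\<And>g v. g \<in> carrier SU3 \<Longrightarrow> v \<in> cball 0 1 \<Longrightarrow> norm (snd (\<alpha> (bundle_class SU3 U2 \<rho> (g, v)))) = 0 \<longleftrightarrow> v = 0"
    using CP2_disc_bundle_model by blast
  obtain \<sigma> :: "complex^3^3 \<Rightarrow> real^3 \<Rightarrow> real^3" and \<beta> where \<sigma>: "orthogonal_representation SU3 SU2 \<sigma>"
    and \<beta>: "equivariant_diffeomorphism SU3 (disc_bundle SU3 SU2 \<sigma>) (bundle_action SU3)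
       (euclidean_subset {y \<in> HP2_model. 2 / 5 \<le> norm (snd y)}) act \<beta>"
    and \<beta>b: "\<And>g v. g \<in> carrier SU3 \<Longrightarrow> v \<in> cball 0 1 \<Longrightarrow> norm (snd (\<beta> (bundle_class SU3 SU2 \<sigma> (g, v)))) = 2 / 5 \<longleftrightarrow> norm v = 1"
    and \<beta>z: "\<And>g v. g \<in> carrier SU3 \<Longrightarrow> v \<in> cball 0 1 \<Longrightarrow> norm (snd (\<beta> (bundle_class SU3 SU2 \<sigma> (g, v)))) = 1 / 2 \<longleftrightarrow> v = 0"
    using S5_disc_bundle_model by blast
  let ?X = "disc_bundle SU3 U2 \<rho>" and ?Y = "disc_bundle SU3 SU2 \<sigma>"
  let ?A = "bundle_boundary SU3 U2 \<rho>" and ?B = "bundle_boundary SU3 SU2 \<sigma>"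
  define \<psi>' where "\<psi>' = inv_into (points HP2) \<psi>"
  have \<psi>'1: "\<psi>' (\<psi> x) = x" if "x \<in> points HP2" for x using inj that by (simp add: \<psi>'_def)
  have \<psi>'2: "\<psi> (\<psi>' y) = y" "\<psi>' y \<in> points HP2" if "y \<in> HP2_model" for y
    using that unfolding \<psi>'_def image [symmetric] by (auto intro: f_inv_into_f inv_into_into)
  define \<beta>' where "\<beta>' = inv_into (points ?Y) \<beta>"
  have \<alpha>_image: "\<alpha> ` points ?X = {y \<in> HP2_model. norm (snd y) \<in> {..2 / 5}}"
    using \<alpha> diffeomorphism_image by (fastforce simp: equivariant_diffeomorphism_def)
  have \<beta>_image: "\<beta> ` points ?Y = {y \<in> HP2_model. norm (snd y) \<in> {2 / 5..}}"
    using \<beta> diffeomorphism_image by (fastforce simp: equivariant_diffeomorphism_def)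
  have \<beta>_inj: "inj_on \<beta> (points ?Y)"
    using \<beta> diffeomorphism_inj_on by (auto simp: equivariant_diffeomorphism_def)
  have pull: "\<psi>' ` {y \<in> HP2_model. norm (snd y) \<in> R} = level R" for R
  proof -
    have "\<psi>' ` (\<psi> ` level R) = level R"
      unfolding image_image using \<psi>'1 level_points [of R] by (force simp: image_iff)
    then show ?thesis unfolding level_image .
  qed
  \<comment> \<open>The bundles are modelled on parts of \<open>HP2_model\<close>;
    \<open>\<psi>'\<close> carries these back to HP(2).\<close>
  define i where "i = \<psi>' \<circ> \<alpha>"
  define j where "j = \<psi>' \<circ> \<beta>"
  \<comment> \<open>Both boundaries correspond to the level 2/5 of the model, through which they are
    compared.\<close>
  define \<phi> where "\<phi> = \<beta>' \<circ> \<alpha>"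
  have i_image: "i ` points ?X = level {..2 / 5}"
    unfolding i_def image_comp [symmetric] \<alpha>_image by (rule pull)
  have j_image: "j ` points ?Y = level {2 / 5..}"
    unfolding j_def image_comp [symmetric] \<beta>_image by (rule pull)
  have level_inverse: "equivariant_diffeomorphism SU3 (euclidean_subset {y \<in> HP2_model. norm (snd y) \<in> R}) act
      (smooth_restrict HP2 (level R)) HP2_action \<psi>'" for R
    by (rule equivariant_diffeomorphism_inverse [OF level_model determined_by_values_smooth_restrict];
        unfold points_level) (use level_closed level_points \<psi>'1 in blast)+
  have i: "equivariant_diffeomorphism SU3 ?X (bundle_action SU3) (smooth_restrict HP2 (i ` points ?X)) HP2_action i"
    unfolding i_image unfolding i_def
    by (rule equivariant_diffeomorphism_trans [OF _ level_inverse]) (use \<alpha> in simp)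
  have j: "equivariant_diffeomorphism SU3 ?Y (bundle_action SU3) (smooth_restrict HP2 (j ` points ?Y)) HP2_action j"
    unfolding j_image unfolding j_def
    by (rule equivariant_diffeomorphism_trans [OF _ level_inverse]) (use \<beta> in simp)
  have \<alpha>_boundary: "\<alpha> ` ?A = {y \<in> HP2_model. norm (snd y) = 2 / 5}"
    "x \<in> points ?X \<Longrightarrow> x \<in> ?A \<longleftrightarrow> norm (snd (\<alpha> x)) = 2 / 5" for x
    using disc_bundle_level_set [OF \<alpha>, of "sphere 0 1" "\<lambda>y. norm (snd y) = 2 / 5"] \<alpha>b
    unfolding bundle_boundary_def by (auto simp: sphere_cball)
  have \<beta>_boundary: "\<beta> ` ?B = {y \<in> HP2_model. norm (snd y) = 2 / 5}"
    using disc_bundle_level_set [OF \<beta>, of "sphere 0 1" "\<lambda>y. norm (snd y) = 2 / 5"] \<beta>b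
    unfolding bundle_boundary_def by (auto simp: sphere_cball)
  have A_sub: "?A \<subseteq> points ?X" and B_sub: "?B \<subseteq> points ?Y"
    unfolding bundle_boundary_def points_disc_bundle by auto
  have \<phi>: "equivariant_diffeomorphism SU3 (smooth_restrict ?X ?A) (bundle_action SU3)
      (smooth_restrict ?Y ?B) (bundle_action SU3) \<phi>"
  proof -
    have a: "equivariant_diffeomorphism SU3 (smooth_restrict ?X ?A) (bundle_action SU3)
        (euclidean_subset {y \<in> HP2_model. norm (snd y) = 2 / 5}) act \<alpha>"
      using equivariant_diffeomorphism_restrict_euclidean [OF \<alpha> determined_by_values_disc_bundle A_sub]
      unfolding \<alpha>_boundary .
    have b: "equivariant_diffeomorphism SU3 (smooth_restrict ?Y ?B) (bundle_action SU3)
        (euclidean_subset {y \<in> HP2_model. norm (snd y) = 2 / 5}) act \<beta>"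
      using equivariant_diffeomorphism_restrict_euclidean [OF \<beta> determined_by_values_disc_bundle B_sub]
      unfolding \<beta>_boundary .
    have pB: "points (smooth_restrict ?Y ?B) = ?B" using B_sub by auto
    have "equivariant_diffeomorphism SU3 (euclidean_subset {y \<in> HP2_model. norm (snd y) = 2 / 5}) act
        (smooth_restrict ?Y ?B) (bundle_action SU3) \<beta>'"
    proof (rule equivariant_diffeomorphism_inverse [OF b determined_by_values_smooth_restrict])
      show "bundle_action SU3 g x \<in> points (smooth_restrict ?Y ?B)"
        if "g \<in> carrier SU3" "x \<in> points (smooth_restrict ?Y ?B)" for g x
        using that bundle_boundary_closed [OF unitary_subgroup_SU2] unfolding pB by blast
      show "\<beta>' (\<beta> x) = x" if "x \<in> points (smooth_restrict ?Y ?B)" for x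
        using that B_sub \<beta>_inj unfolding pB by (auto simp: \<beta>'_def)
    qed
    from equivariant_diffeomorphism_trans [OF a this] show ?thesis unfolding \<phi>_def .
  qed
  have gluing: "equivariant_gluing SU3 HP2 HP2_action ?X ?A (bundle_action SU3) i ?Y ?B (bundle_action SU3) j \<phi>"
    unfolding equivariant_gluing_def
  proof (intro conjI ballI \<phi> i j)
    show "points HP2 = i ` points ?X \<union> j ` points ?Y"
      unfolding i_image j_image by (auto simp: level_def)
    fix x y assume x: "x \<in> points ?X" and y: "y \<in> points ?Y"
    have \<alpha>x: "\<alpha> x \<in> HP2_model" "norm (snd (\<alpha> x)) \<le> 2 / 5" using x \<alpha>_image by auto
    have \<beta>y: "\<beta> y \<in> HP2_model" "2 / 5 \<le> norm (snd (\<beta> y))" using y \<beta>_image by auto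
    have "i x = j y \<longleftrightarrow> \<alpha> x = \<beta> y"
    proof
      assume "i x = j y"
      then have "\<psi> (\<psi>' (\<alpha> x)) = \<psi> (\<psi>' (\<beta> y))" by (simp add: i_def j_def)
      then show "\<alpha> x = \<beta> y" unfolding \<psi>'2(1) [OF \<alpha>x(1)] \<psi>'2(1) [OF \<beta>y(1)] .
    qed (simp add: i_def j_def)
    also have "\<dots> \<longleftrightarrow> x \<in> ?A \<and> y = \<phi> x"
    proof
      assume e: "\<alpha> x = \<beta> y"
      \<comment> \<open>One bundle covers |w| \<le> 2/5 and the other |w| \<ge> 2/5, so a common
        point lies on both boundaries.\<close>
      then have "norm (snd (\<alpha> x)) = 2 / 5" using \<alpha>x \<beta>y by simp
      then have "x \<in> ?A" using \<alpha>_boundary(2) x by blast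
      moreover have "\<phi> x = y" using \<beta>_inj y by (simp add: \<phi>_def \<beta>'_def e)
      ultimately show "x \<in> ?A \<and> y = \<phi> x" by blast
    next
      assume xy: "x \<in> ?A \<and> y = \<phi> x"
      then have "\<alpha> x \<in> \<beta> ` points ?Y" using \<alpha>_boundary(2) [OF x] \<alpha>x \<beta>_image by auto
      then show "\<alpha> x = \<beta> y" using xy by (simp add: \<phi>_def \<beta>'_def f_inv_into_f)
    qed
    finally show "i x = j y \<longleftrightarrow> x \<in> ?A \<and> y = \<phi> x" .
  qed
  have "\<alpha> ` zero_section SU3 U2 \<rho> = {y \<in> HP2_model. norm (snd y) \<in> {0}}"
    using disc_bundle_level_set(1) [OF \<alpha>, of "{0}" "\<lambda>y. norm (snd y) = 0"] \<alpha>z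
    unfolding zero_section_def by auto
  then have i_zero: "i ` zero_section SU3 U2 \<rho> = S"
    unfolding i_def image_comp [symmetric] S_def by (simp only: pull)
  have "\<beta> ` zero_section SU3 SU2 \<sigma> = {y \<in> HP2_model. norm (snd y) \<in> {1 / 2}}"
    using disc_bundle_level_set(1) [OF \<beta>, of "{0}" "\<lambda>y. norm (snd y) = 1 / 2"] \<beta>z
    unfolding zero_section_def by auto
  then have j_zero: "j ` zero_section SU3 SU2 \<sigma> = T"
    unfolding j_def image_comp [symmetric] T_def by (simp only: pull)
  show ?thesis
    by (intro conjI cohom ballI principal_AW AW; (assumption | rule exI [of _ S], rule exI [of _ T],
          intro conjI singular_S singular_T all_orbits S_U2 U2_CP2 T_SU2 SU2_S5, intro exI conjI,
          rule \<rho>, rule \<sigma>, rule gluing, rule i_zero, rule j_zero))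
qed

end
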